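(* Let $n\ge1$, $b\neq0$ a real constant, and let $e^1,\dots,e^{4n},\eta_1,\eta_2,\eta_3$ be the standard left-invariant coframe of the $(4n+3)$-dimensional quaternionic Heisenberg group $G(\mathbb H)$. Then, with $\sigma$ the coordinate on $\mathbb R$, the metric $$g=e^{2b\sigma}\big((e^1)^2+\dots+(e^{4n})^2\big)+b^2e^{4b\sigma}\big((\eta_1)^2+(\eta_2)^2+(\eta_3)^2\big)+d\sigma^2$$ on $G(\mathbb H)\times\mathbb R$ is a complete quaternionic Kähler metric in dimension $4n+4$, with Einstein constant $-4(n+3)b^2$ (i.e. $Ric=-4(n+3)b^2g$). Moreover $g$ is a left-invariant metric on a $(4n+4)$-dimensional Lie group: the $1$-forms $\tilde e^i=e^{b\sigma}e^i$, $\tilde\eta_s=e^{2b\sigma}\eta_s$ and $d\sigma$ define a $(4n+4)$-dimensional Lie algebra, with $d\tilde e^i=-b\,\tilde e^i\wedge d\sigma$, $d\tilde\eta_s=2\tilde\omega_s-2b\,\tilde\eta_s\wedge d\sigma$, where $\tilde\omega_s$ is obtained from $\omega_s$ by replacing each $e^i$ with $\tilde e^i$.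
   Context: The $(4n+3)$-dimensional quaternionic Heisenberg group $G(\mathbb H)$ is the simply connected $2$-step nilpotent Lie group whose left-invariant $1$-forms $e^1,\dots,e^{4n},\eta_1,\eta_2,\eta_3$ satisfy (with $e^{ij}=e^i\wedge e^j$) $de^a=0$ for $1\le a\le4n$ and $$\begin{aligned} d\eta_1&=2\omega_1=2(e^{12}+e^{34}+\dots+e^{(4n-3)(4n-2)}+e^{(4n-1)4n}),\\ d\eta_2&=2\omega_2=2(e^{13}+e^{42}+\dots+e^{(4n-3)(4n-1)}+e^{4n(4n-2)}),\\ d\eta_3&=2\omega_3=2(e^{14}+e^{23}+\dots+e^{(4n-3)4n}+e^{(4n-2)(4n-1)}). \end{aligned}$$ A metric in dimension $4n+4$ is quaternionic Kähler if its Levi-Civita holonomy is contained in $Sp(n+1)Sp(1)$. *)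

theory Defs
  imports "HOL-Analysis.Analysis"
begin

section \<open>Tensors and forms on a Euclidean space\<close>

text \<open>
  All manifolds occurring here are diffeomorphic to a Euclidean space, so a manifold is a
  type of class \<open>euclidean_space\<close> with its identity chart, every tangent space being
  that type again. A covariant tensor field is a function of the base point and of tangent vectors.
\<close>

type_synonym 'a one_form = "'a \<Rightarrow> 'a \<Rightarrow> real"
type_synonym 'a two_tensor = "'a \<Rightarrow> 'a \<Rightarrow> 'a \<Rightarrow> real"

primrec Ck :: "nat \<Rightarrow> ('a::euclidean_space \<Rightarrow> 'b::euclidean_space) \<Rightarrow> bool" where
  "Ck 0 = (\<lambda>f. continuous_on UNIV f)"
| "Ck (Suc k) = (\<lambda>f. \<exists>f'. (\<forall>x. (f has_derivative f' x) (at x)) \<and> (\<forall>v. Ck k (\<lambda>x. f' x v)))"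

definition smooth :: "('a::euclidean_space \<Rightarrow> 'b::euclidean_space) \<Rightarrow> bool" where
  "smooth f \<longleftrightarrow> (\<forall>k. Ck k f)"

definition smooth_one_form :: "('a::euclidean_space) one_form \<Rightarrow> bool" where
  "smooth_one_form \<alpha> \<longleftrightarrow> (\<forall>x. linear (\<alpha> x)) \<and> (\<forall>v. smooth (\<lambda>x. \<alpha> x v))"

text \<open>
  Conventions: \<open>(\<alpha> \<and> \<beta>)(u,v) = \<alpha>(u)\<beta>(v) - \<alpha>(v)\<beta>(u)\<close> and
  \<open>d\<alpha>(u,v) = u(\<alpha>(v)) - v(\<alpha>(u))\<close> for constant vector fields \<open>u\<close>, \<open>v\<close>
  (their Lie bracket vanishes).
\<close>

definition wedge :: "'a one_form \<Rightarrow> 'a one_form \<Rightarrow> 'a two_tensor" where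
  "wedge \<alpha> \<beta> x u v = \<alpha> x u * \<beta> x v - \<alpha> x v * \<beta> x u"

definition ext_deriv :: "('a::euclidean_space) one_form \<Rightarrow> 'a two_tensor" where
  "ext_deriv \<alpha> x u v =
     frechet_derivative (\<lambda>y. \<alpha> y v) (at x) u - frechet_derivative (\<lambda>y. \<alpha> y u) (at x) v"

definition coframe :: "('i::finite \<Rightarrow> ('a::euclidean_space) one_form) \<Rightarrow> bool" where
  "coframe \<theta> \<longleftrightarrow> (\<forall>i. smooth_one_form (\<theta> i)) \<and> (\<forall>x c. \<exists>!v. \<forall>i. \<theta> i x v = c i)"

text \<open>
  A coframe \<open>\<theta>\<close> defines a Lie algebra of dimension \<open>CARD('i)\<close> if
  \<open>d\<theta>\<^sub>k = - (\<Sum>i<j. c i j k \<theta>\<^sub>i \<and> \<theta>\<^sub>j)\<close>, where the constants \<open>c\<close> are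
  the structure constants of a Lie algebra with basis \<open>X\<^sub>i\<close> dual to \<open>\<theta>\<close>,
  \<open>[X\<^sub>i, X\<^sub>j] = (\<Sum>k. c i j k X\<^sub>k)\<close>; the sum below runs over all ordered pairs,
  whence the factor 1/2.
\<close>

definition lie_structure_constants :: "('i::finite \<Rightarrow> 'i \<Rightarrow> 'i \<Rightarrow> real) \<Rightarrow> bool" where
  "lie_structure_constants c \<longleftrightarrow>
     (\<forall>i j k. c i j k = - c j i k) \<and>
     (\<forall>i j k l. (\<Sum>m\<in>UNIV. c i j m * c m k l + c j k m * c m i l + c k i m * c m j l) = 0)"

definition defines_lie_algebra :: "('i::finite \<Rightarrow> ('a::euclidean_space) one_form) \<Rightarrow> bool" where
  "defines_lie_algebra \<theta> \<longleftrightarrow> coframe \<theta> \<and>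
     (\<exists>c. lie_structure_constants c \<and>
        (\<forall>k x u v. ext_deriv (\<theta> k) x u v
            = - (1/2) * (\<Sum>i\<in>UNIV. \<Sum>j\<in>UNIV. c i j k * wedge (\<theta> i) (\<theta> j) x u v)))"


section \<open>Lie groups and left invariance\<close>

definition lie_group ::
    "('a::euclidean_space \<Rightarrow> 'a \<Rightarrow> 'a) \<Rightarrow> 'a \<Rightarrow> ('a \<Rightarrow> 'a) \<Rightarrow> bool" where
  "lie_group mul e iv \<longleftrightarrow>
     group mul e iv \<and> smooth (\<lambda>p. mul (fst p) (snd p)) \<and> smooth iv"

definition left_invariant_form ::
    "('a::euclidean_space \<Rightarrow> 'a \<Rightarrow> 'a) \<Rightarrow> 'a one_form \<Rightarrow> bool" where
  "left_invariant_form mul \<alpha> \<longleftrightarrow>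
     (\<forall>a x v. \<alpha> (mul a x) (frechet_derivative (mul a) (at x) v) = \<alpha> x v)"

definition left_invariant_metric ::
    "('a::euclidean_space \<Rightarrow> 'a \<Rightarrow> 'a) \<Rightarrow> 'a two_tensor \<Rightarrow> bool" where
  "left_invariant_metric mul g \<longleftrightarrow>
     (\<forall>a x v w. g (mul a x) (frechet_derivative (mul a) (at x) v)
                            (frechet_derivative (mul a) (at x) w) = g x v w)"


section \<open>Riemannian metrics\<close>

definition riemannian_metric :: "('a::euclidean_space) two_tensor \<Rightarrow> bool" where
  "riemannian_metric g \<longleftrightarrow>
     (\<forall>x. bilinear (g x)) \<and> (\<forall>x v w. g x v w = g x w v) \<and>
     (\<forall>x v. v \<noteq> 0 \<longrightarrow> g x v v > 0) \<and> (\<forall>v w. smooth (\<lambda>x. g x v w))"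

text \<open>
  A library \<open>valid_path\<close> may have an unbounded derivative near a break point and hence
  infinite length, for which \<open>integral\<close> would return 0; bounding the derivative
  excludes this. Every piecewise \<open>C\<^sup>1\<close> curve in the usual sense is admissible.
\<close>

definition admissible_path :: "(real \<Rightarrow> 'a::euclidean_space) \<Rightarrow> bool" where
  "admissible_path \<gamma> \<longleftrightarrow>
     valid_path \<gamma> \<and> bounded ((\<lambda>t. vector_derivative \<gamma> (at t)) ` {0..1})"

definition riemannian_length :: "('a::euclidean_space) two_tensor \<Rightarrow> (real \<Rightarrow> 'a) \<Rightarrow> real" where
  "riemannian_length g \<gamma> =
     integral {0..1} (\<lambda>t. sqrt (g (\<gamma> t) (vector_derivative \<gamma> (at t)) (vector_derivative \<gamma> (at t))))"

definition riemannian_dist :: "('a::euclidean_space) two_tensor \<Rightarrow> 'a \<Rightarrow> 'a \<Rightarrow> real" where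
  "riemannian_dist g x y =
     (INF \<gamma>\<in>{\<gamma>. admissible_path \<gamma> \<and> pathstart \<gamma> = x \<and> pathfinish \<gamma> = y}. riemannian_length g \<gamma>)"

definition complete_riemannian :: "('a::euclidean_space) two_tensor \<Rightarrow> bool" where
  "complete_riemannian g \<longleftrightarrow> Metric_space.mcomplete UNIV (riemannian_dist g)"

text \<open>
  A connection is represented by \<open>\<Gamma> x u v\<close>, the covariant derivative in direction
  \<open>u\<close> at \<open>x\<close> of the constant vector field \<open>v\<close>; thus
  \<open>\<nabla>\<^sub>u V = D V(u) + \<Gamma> x u (V x)\<close>. Symmetry of \<open>\<Gamma>\<close> is vanishing of the torsion.
\<close>

definition is_levi_civita :: "('a::euclidean_space) two_tensor \<Rightarrow> ('a \<Rightarrow> 'a \<Rightarrow> 'a \<Rightarrow> 'a) \<Rightarrow> bool" where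
  "is_levi_civita g \<Gamma> \<longleftrightarrow>
     (\<forall>x. bilinear (\<Gamma> x)) \<and> (\<forall>x u v. \<Gamma> x u v = \<Gamma> x v u) \<and>
     (\<forall>x u v w. frechet_derivative (\<lambda>y. g y v w) (at x) u = g x (\<Gamma> x u v) w + g x v (\<Gamma> x u w))"

definition levi_civita :: "('a::euclidean_space) two_tensor \<Rightarrow> 'a \<Rightarrow> 'a \<Rightarrow> 'a \<Rightarrow> 'a" where
  "levi_civita g = (THE \<Gamma>. is_levi_civita g \<Gamma>)"

text \<open>\<open>R(u,v)w = \<nabla>\<^sub>u\<nabla>\<^sub>v w - \<nabla>\<^sub>v\<nabla>\<^sub>u w\<close> for constant vector fields, and
  \<open>Ric(v,w) = tr (u \<mapsto> R(u,v)w)\<close>.\<close>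

definition riemann_curvature :: "('a::euclidean_space) two_tensor \<Rightarrow> 'a \<Rightarrow> 'a \<Rightarrow> 'a \<Rightarrow> 'a \<Rightarrow> 'a" where
  "riemann_curvature g x u v w =
     (let \<Gamma> = levi_civita g in
        frechet_derivative (\<lambda>y. \<Gamma> y v w) (at x) u - frechet_derivative (\<lambda>y. \<Gamma> y u w) (at x) v
        + \<Gamma> x u (\<Gamma> x v w) - \<Gamma> x v (\<Gamma> x u w))"

definition ricci :: "('a::euclidean_space) two_tensor \<Rightarrow> 'a two_tensor" where
  "ricci g x v w = (\<Sum>i\<in>Basis. riemann_curvature g x i v w \<bullet> i)"

definition parallel_along ::
    "('a::euclidean_space) two_tensor \<Rightarrow> (real \<Rightarrow> 'a) \<Rightarrow> (real \<Rightarrow> 'a) \<Rightarrow> bool" where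
  "parallel_along g \<gamma> V \<longleftrightarrow> continuous_on {0..1} V \<and>
     (\<exists>S. finite S \<and> (\<forall>t\<in>{0..1} - S. (V has_vector_derivative
          - levi_civita g (\<gamma> t) (vector_derivative \<gamma> (at t)) (V t)) (at t)))"

definition holonomy :: "('a::euclidean_space) two_tensor \<Rightarrow> 'a \<Rightarrow> ('a \<Rightarrow> 'a) set" where
  "holonomy g x = {A. \<exists>\<gamma>. admissible_path \<gamma> \<and> pathstart \<gamma> = x \<and> pathfinish \<gamma> = x \<and>
     (\<forall>v. \<exists>V. parallel_along g \<gamma> V \<and> V 0 = v \<and> V 1 = A v)}"


section \<open>Quaternions and quaternionic Kaehler metrics\<close>

text \<open>The quaternion \<open>a + bi + cj + dk\<close> is the vector with components \<open>a, b, c, d\<close>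
  at the indices \<open>1, 2, 3, 4\<close>.\<close>

type_synonym quat = "real^4"

definition qmul :: "quat \<Rightarrow> quat \<Rightarrow> quat" where
  "qmul p q = vector
     [p$1 * q$1 - p$2 * q$2 - p$3 * q$3 - p$4 * q$4,
      p$1 * q$2 + p$2 * q$1 + p$3 * q$4 - p$4 * q$3,
      p$1 * q$3 - p$2 * q$4 + p$3 * q$1 + p$4 * q$2,
      p$1 * q$4 + p$2 * q$3 - p$3 * q$2 + p$4 * q$1]"

definition qone :: quat where
  "qone = vector [1, 0, 0, 0]"

definition qcnj :: "quat \<Rightarrow> quat" where
  "qcnj q = vector [q$1, - q$2, - q$3, - q$4]"

text \<open>\<open>Sp(m)\<close>, with \<open>m = CARD('m)\<close>, consists of the quaternionic matrices \<open>A\<close>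
  with \<open>A\<^sup>* A = 1\<close>; the group \<open>Sp(m)Sp(1)\<close> acts on column vectors by
  \<open>x \<mapsto> A x q\<close>.\<close>

definition Sp :: "(quat^'m^'m::finite) set" where
  "Sp = {A. \<forall>i j. (\<Sum>k\<in>UNIV. qmul (qcnj (A$k$i)) (A$k$j)) = (if i = j then qone else 0)}"

definition SpSp1 :: "(quat^'m::finite \<Rightarrow> quat^'m) set" where
  "SpSp1 = {(\<lambda>x. \<chi> i. qmul (\<Sum>j\<in>UNIV. qmul (A$i$j) (x$j)) q) | A q. A \<in> Sp \<and> norm q = 1}"

text \<open>The holonomy is contained in \<open>Sp(m)Sp(1)\<close> if this is so after some linear isometry
  of the tangent space with \<open>H\<^sup>m\<close>.\<close>

definition quaternionic_kaehler :: "'m::finite itself \<Rightarrow> ('a::euclidean_space) two_tensor \<Rightarrow> bool" where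
  "quaternionic_kaehler _ g \<longleftrightarrow> riemannian_metric g \<and>
     (\<forall>x. \<exists>\<phi> :: 'a \<Rightarrow> quat^'m. linear \<phi> \<and> bij \<phi> \<and> (\<forall>v w. \<phi> v \<bullet> \<phi> w = g x v w) \<and>
        (\<forall>A\<in>holonomy g x. \<phi> \<circ> A \<circ> inv \<phi> \<in> SpSp1))"


section \<open>The quaternionic Heisenberg group\<close>

text \<open>
  With \<open>n = CARD('n)\<close>, the basic 1-form \<open>e^(4(r-1)+k)\<close> is written \<open>e r k\<close>, where
  \<open>r :: 'n\<close> numbers the blocks of four and \<open>k :: 4\<close> the place within the block.
\<close>

definition omega :: "('n::finite \<Rightarrow> 4 \<Rightarrow> 'a one_form) \<Rightarrow> 3 \<Rightarrow> 'a two_tensor" where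
  "omega e s x u v =
     (if s = 1 then \<Sum>r\<in>UNIV. wedge (e r 1) (e r 2) x u v + wedge (e r 3) (e r 4) x u v
      else if s = 2 then \<Sum>r\<in>UNIV. wedge (e r 1) (e r 3) x u v + wedge (e r 4) (e r 2) x u v
      else \<Sum>r\<in>UNIV. wedge (e r 1) (e r 4) x u v + wedge (e r 2) (e r 3) x u v)"

text \<open>
  The simply connected group is realised on \<open>H\<^sup>n \<times> Im H\<close>. The forms \<open>e r k\<close> are the
  coordinate differentials of the first factor, and \<open>\<omega>\<^sub>s\<close> is then a constant
  2-form; \<open>\<eta>\<^sub>s = dz\<^sub>s + \<omega>\<^sub>s(q, dq)\<close>. The lemmas at the end of this section show that this
  is a realisation of the group and coframe characterised by the structure equations.
\<close>

type_synonym 'n heis = "(quat, 'n) vec \<times> (real^3)"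

definition heis_e :: "'n::finite \<Rightarrow> 4 \<Rightarrow> 'n heis one_form" where
  "heis_e r k x u = fst u $ r $ k"

definition heis_eta :: "3 \<Rightarrow> ('n::finite) heis one_form" where
  "heis_eta s x u = snd u $ s + omega heis_e s 0 x u"

definition heis_mult :: "('n::finite) heis \<Rightarrow> 'n heis \<Rightarrow> 'n heis" where
  "heis_mult x y = (fst x + fst y, snd x + snd y - (\<chi> s. omega heis_e s 0 x y))"

definition heis_inv :: "('n::finite) heis \<Rightarrow> 'n heis" where
  "heis_inv x = (- fst x, - snd x)"

definition heis_coframe :: "'n \<times> 4 + 3 \<Rightarrow> ('n::finite) heis one_form" where
  "heis_coframe i = (case i of Inl (r, k) \<Rightarrow> heis_e r k | Inr s \<Rightarrow> heis_eta s)"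


lemma Ck_const: "Ck k (\<lambda>x. c)"
proof (induction k arbitrary: c)
  case (Suc k)
  have "\<forall>x. ((\<lambda>x. c) has_derivative (\<lambda>v. 0)) (at x)"
    by (auto intro!: derivative_eq_intros)
  then show ?case using Suc[of 0]
    by (simp only: Ck.simps) (rule exI[of _ "\<lambda>x v. 0"], simp)
qed simp

lemma Ck_bounded_linear: "bounded_linear f \<Longrightarrow> Ck k f"
proof (cases k)
  case 0
  assume "bounded_linear f"
  then show ?thesis using 0 by (simp add: linear_continuous_on)
next
  case (Suc j)
  assume "bounded_linear f"
  then have "\<forall>x. (f has_derivative f) (at x)"
    by (simp add: bounded_linear_imp_has_derivative)
  then show ?thesis unfolding Suc
    by (simp only: Ck.simps) (rule exI[of _ "\<lambda>x. f"], simp add: Ck_const)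
qed

lemma Ck_add: "Ck k f \<Longrightarrow> Ck k g \<Longrightarrow> Ck k (\<lambda>x. f x + g x)"
proof (induction k arbitrary: f g)
  case 0
  then show ?case by (simp add: continuous_on_add)
next
  case (Suc k)
  obtain f' where f: "\<forall>x. (f has_derivative f' x) (at x)" "\<forall>v. Ck k (\<lambda>x. f' x v)"
    using Suc.prems(1) by auto
  obtain g' where g: "\<forall>x. (g has_derivative g' x) (at x)" "\<forall>v. Ck k (\<lambda>x. g' x v)"
    using Suc.prems(2) by auto
  have "\<forall>x. ((\<lambda>x. f x + g x) has_derivative (\<lambda>v. f' x v + g' x v)) (at x)"
    using f(1) g(1) by (auto intro: has_derivative_add)
  then show ?case using f(2) g(2) Suc.IH
    by (simp only: Ck.simps) (rule exI[of _ "\<lambda>x v. f' x v + g' x v"], simp)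
qed

lemma Ck_quadratic:
  assumes h: "bounded_bilinear h" and l: "bounded_linear l" and m: "bounded_linear m"
  shows "Ck k (\<lambda>x. h (l x) (m x))"
proof (cases k)
  case 0
  then show ?thesis
    using bounded_bilinear.continuous_on[OF h linear_continuous_on[OF l] linear_continuous_on[OF m]]
    by simp
next
  case (Suc j)
  have "\<forall>x. ((\<lambda>x. h (l x) (m x)) has_derivative (\<lambda>v. h (l x) (m v) + h (l v) (m x))) (at x)"
    using bounded_bilinear.FDERIV[OF h bounded_linear_imp_has_derivative[OF l]
        bounded_linear_imp_has_derivative[OF m]] by blast
  moreover have "Ck j (\<lambda>x. h (l x) (m v) + h (l v) (m x))" for v
    by (intro Ck_bounded_linear bounded_linear_add
        bounded_linear_compose[OF bounded_bilinear.bounded_linear_left[OF h] l]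
        bounded_linear_compose[OF bounded_bilinear.bounded_linear_right[OF h] m])
  ultimately show ?thesis unfolding Suc
    by (simp only: Ck.simps) (rule exI[of _ "\<lambda>x v. h (l x) (m v) + h (l v) (m x)"], simp)
qed

lemma omega_heis_e_base: "omega heis_e s x u v = omega heis_e s 0 u v"
  by (simp add: omega_def wedge_def heis_e_def)

lemma omega_heis_e_linear:
  "omega heis_e s x (u + u') v = omega heis_e s x u v + omega heis_e s x u' v"
  "omega heis_e s x u (v + v') = omega heis_e s x u v + omega heis_e s x u v'"
  "omega heis_e s x (c *\<^sub>R u) v = c * omega heis_e s x u v"
  "omega heis_e s x u (c *\<^sub>R v) = c * omega heis_e s x u v"
  by (auto simp: omega_def wedge_def heis_e_def algebra_simps sum.distrib
      sum_distrib_left sum_subtractf)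

lemma omega_heis_e_snd:
  "omega heis_e s x (a, c) v = omega heis_e s x (a, 0) v"
  "omega heis_e s x u (a, c) = omega heis_e s x u (a, 0)"
  by (auto simp: omega_def wedge_def heis_e_def)

lemma omega_heis_e_antisym: "omega heis_e s x v u = - omega heis_e s x u v"
  by (auto simp: omega_def wedge_def heis_e_def sum_negf[symmetric] intro!: sum.cong)

definition heis_omega_vec :: "('n::finite) heis \<Rightarrow> 'n heis \<Rightarrow> real^3" where
  "heis_omega_vec u v = (\<chi> s. omega heis_e s 0 u v)"

lemma bounded_bilinear_heis_omega_vec: "bounded_bilinear heis_omega_vec"
  unfolding bilinear_conv_bounded_bilinear[symmetric] bilinear_def heis_omega_vec_def
  by (intro allI conjI linearI) (simp_all add: omega_heis_e_linear vec_eq_iff)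

lemma heis_mult_has_derivative:
  "(heis_mult a has_derivative (\<lambda>v. (fst v, snd v - heis_omega_vec a v))) (at x)"
proof -
  have 1: "heis_mult a = (\<lambda>x. a + (fst x, snd x - heis_omega_vec a x))"
    by (auto simp: heis_mult_def heis_omega_vec_def prod_eq_iff)
  have "bounded_linear (\<lambda>v. (fst v, snd v - heis_omega_vec a v))"
    by (intro bounded_linear_Pair bounded_linear_sub bounded_linear_fst bounded_linear_snd
        bounded_bilinear.bounded_linear_right[OF bounded_bilinear_heis_omega_vec])
  from has_derivative_add[OF has_derivative_const bounded_linear_imp_has_derivative[OF this]]
  show ?thesis unfolding 1 by simp
qed

lemma lie_group_heis: "lie_group heis_mult (0 :: ('n::finite) heis) heis_inv"
  unfolding lie_group_def
proof (intro conjI)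
  show "group heis_mult (0 :: 'n heis) heis_inv"
  proof
    fix a b c :: "'n heis"
    have pair: "omega heis_e s 0 (fst a + fst b, z) c = omega heis_e s 0 (a + b) c"
      "omega heis_e s 0 a (fst b + fst c, z) = omega heis_e s 0 a (b + c)" for s z
      by (auto simp: omega_def wedge_def heis_e_def)
    show "heis_mult (heis_mult a b) c = heis_mult a (heis_mult b c)"
      by (auto simp: heis_mult_def prod_eq_iff vec_eq_iff pair omega_heis_e_linear)
    show "heis_mult 0 a = a"
      by (auto simp: heis_mult_def prod_eq_iff vec_eq_iff omega_def wedge_def heis_e_def)
    show "heis_mult (heis_inv a) a = 0"
      by (auto simp: heis_mult_def heis_inv_def prod_eq_iff vec_eq_iff omega_def wedge_def heis_e_def)
  qed
  have l: "bounded_linear (\<lambda>p :: 'n heis \<times> 'n heis. fst p + snd p)"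
    by (intro bounded_linear_add bounded_linear_fst bounded_linear_snd)
  have h: "bounded_bilinear (\<lambda>u v :: 'n heis. (0 :: quat^'n, - heis_omega_vec u v))"
    unfolding bilinear_conv_bounded_bilinear[symmetric] bilinear_def heis_omega_vec_def
    by (intro allI conjI linearI) (simp_all add: omega_heis_e_linear vec_eq_iff)
  have "(\<lambda>p :: 'n heis \<times> 'n heis. heis_mult (fst p) (snd p))
      = (\<lambda>p. (fst p + snd p) + (0, - heis_omega_vec (fst p) (snd p)))"
    by (auto simp: heis_mult_def heis_omega_vec_def prod_eq_iff)
  then show "smooth (\<lambda>p :: 'n heis \<times> 'n heis. heis_mult (fst p) (snd p))"
    unfolding smooth_def
    by (auto intro!: Ck_add Ck_bounded_linear[OF l]
        Ck_quadratic[OF h bounded_linear_fst bounded_linear_snd])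
  have "(heis_inv :: 'n heis \<Rightarrow> _) = (\<lambda>x. - x)"
    by (auto simp: heis_inv_def prod_eq_iff)
  then show "smooth (heis_inv :: 'n heis \<Rightarrow> _)"
    unfolding smooth_def
    by (auto intro!: Ck_bounded_linear bounded_linear_minus bounded_linear_ident)
qed

lemma simply_connected_heis: "simply_connected (UNIV :: ('n::finite) heis set)"
  by (simp add: convex_imp_simply_connected)

definition heis_commutator :: "('n::finite) heis \<Rightarrow> 'n heis \<Rightarrow> 'n heis" where
  "heis_commutator x y = heis_mult (heis_mult x y) (heis_mult (heis_inv x) (heis_inv y))"

lemma heis_commutator_eq:
  fixes x y :: "('n::finite) heis"
  shows "heis_commutator x y = (0, - 2 *\<^sub>R heis_omega_vec x y)"
proof -
  have inv: "heis_inv z = - z" for z :: "'n heis"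
    by (simp add: heis_inv_def prod_eq_iff)
  have mul: "heis_mult u v = u + v + (0, - heis_omega_vec u v)" for u v :: "'n heis"
    by (simp add: heis_mult_def heis_omega_vec_def prod_eq_iff)
  have central: "heis_omega_vec (u + (0, c)) (v + (0, d)) = heis_omega_vec u v"
    for u v :: "'n heis" and c d
    by (simp add: heis_omega_vec_def vec_eq_iff omega_def wedge_def heis_e_def)
  interpret bounded_bilinear "heis_omega_vec :: 'n heis \<Rightarrow> _"
    by (rule bounded_bilinear_heis_omega_vec)
  have self: "heis_omega_vec u (- u) = 0" for u :: "'n heis"
    by (simp add: heis_omega_vec_def vec_eq_iff omega_def wedge_def heis_e_def)
  have "heis_omega_vec (x + y + (0, - heis_omega_vec x y)) (- x + - y + (0, - heis_omega_vec x y))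
      = heis_omega_vec (x + y) (- (x + y))"
    by (subst central) simp
  then have "heis_omega_vec (x + y + (0, - heis_omega_vec x y))
      (- x + - y + (0, - heis_omega_vec x y)) = 0"
    by (simp only: self)
  then show ?thesis
    unfolding heis_commutator_def inv mul by (simp add: minus_left minus_right prod_eq_iff scaleR_2)
qed

lemma heis_two_step_nilpotent:
  "heis_commutator (heis_commutator x y) z = 0"
  "\<exists>u v :: ('n::finite) heis. heis_commutator u v \<noteq> 0"
proof -
  show "heis_commutator (heis_commutator x y) z = 0"
    by (simp add: heis_commutator_eq heis_omega_vec_def omega_def wedge_def heis_e_def prod_eq_iff
        vec_eq_iff)
  define u v :: "'n heis" where "u = ((\<chi> r. axis 1 1), 0)" and "v = ((\<chi> r. axis 2 1), 0)"
  have "heis_omega_vec u v $ 1 = real CARD('n)"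
    by (simp add: heis_omega_vec_def omega_def wedge_def heis_e_def u_def v_def axis_def)
  then have "heis_omega_vec u v \<noteq> 0" by auto
  then show "\<exists>u v :: 'n heis. heis_commutator u v \<noteq> 0"
    unfolding heis_commutator_eq by (intro exI[of _ u] exI[of _ v]) (simp add: prod_eq_iff)
qed

lemma coframe_heis: "coframe (heis_coframe :: _ \<Rightarrow> ('n::finite) heis one_form)"
  unfolding coframe_def
proof (intro conjI allI)
  fix i :: "'n \<times> 4 + 3"
  have e: "smooth_one_form (heis_e r k :: 'n heis one_form)" for r k
    unfolding smooth_one_form_def smooth_def heis_e_def
    by (auto intro!: linearI Ck_const)
  have "Ck k (\<lambda>x. heis_eta s x v)" for k s and v :: "'n heis"
  proof -
    have "bounded_linear (\<lambda>x. omega heis_e s 0 x v)"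
      by (intro linear_conv_bounded_linear[THEN iffD1] linearI) (simp_all add: omega_heis_e_linear)
    then show ?thesis
      unfolding heis_eta_def by (intro Ck_add Ck_const Ck_bounded_linear)
  qed
  then have eta: "smooth_one_form (heis_eta s :: 'n heis one_form)" for s
    unfolding smooth_one_form_def smooth_def
    by (intro allI conjI linearI) (simp_all add: heis_eta_def omega_heis_e_linear algebra_simps)
  show "smooth_one_form (heis_coframe i)"
    using e eta by (auto simp: heis_coframe_def split: sum.splits prod.splits)
next
  fix x :: "'n heis" and c :: "'n \<times> 4 + 3 \<Rightarrow> real"
  define q :: "quat^'n" where "q = (\<chi> r k. c (Inl (r, k)))"
  define v :: "'n heis" where "v = (q, (\<chi> s. c (Inr s) - omega heis_e s 0 x (q, 0)))"
  show "\<exists>!v. \<forall>i. heis_coframe i x v = c i"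
  proof (rule ex1I[of _ v])
    show "\<forall>i. heis_coframe i x v = c i"
    proof
      fix i
      have "heis_coframe (Inl (r, k)) x v = c (Inl (r, k))" for r k
        by (simp add: heis_coframe_def heis_e_def v_def q_def)
      moreover have "omega heis_e s 0 x v = omega heis_e s 0 x (q, 0)" for s
        unfolding v_def by (rule omega_heis_e_snd)
      then have "heis_coframe (Inr s) x v = c (Inr s)" for s
        by (simp add: heis_coframe_def heis_eta_def) (simp add: v_def)
      ultimately show "heis_coframe i x v = c i"
        by (cases i) auto
    qed
  next
    fix w assume w: "\<forall>i. heis_coframe i x w = c i"
    have "fst w = q"
      using w[rule_format, of "Inl _"]
      by (auto simp: vec_eq_iff q_def heis_coframe_def heis_e_def split_def)
    then obtain z where wz: "w = (q, z)" by (cases w) auto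
    have "z $ s + omega heis_e s 0 x (q, 0) = c (Inr s)" for s
      using w[rule_format, of "Inr s"] omega_heis_e_snd(2)[of s 0 x q z]
      by (simp add: heis_coframe_def heis_eta_def wz)
    then show "w = v" by (auto simp: wz v_def vec_eq_iff algebra_simps)
  qed
qed

lemma left_invariant_heis:
  "left_invariant_form heis_mult (heis_coframe i :: ('n::finite) heis one_form)"
  unfolding left_invariant_form_def
proof (intro allI)
  fix a x v :: "'n heis"
  define w where "w = (fst v, snd v - heis_omega_vec a v)"
  have D: "frechet_derivative (heis_mult a) (at x) v = w"
    using fun_cong[OF frechet_derivative_at[OF heis_mult_has_derivative[of a x]], of v]
    by (simp add: w_def)
  have 1: "omega heis_e s 0 (heis_mult a x) w = omega heis_e s 0 (a + x) v" for s
    by (simp add: omega_def wedge_def heis_e_def heis_mult_def w_def)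
  have e: "heis_e r k (heis_mult a x) w = heis_e r k x v" for r k
    by (simp add: heis_e_def w_def)
  have "heis_eta s (heis_mult a x) w = heis_eta s x v" for s
    unfolding heis_eta_def 1 omega_heis_e_linear by (simp add: w_def heis_omega_vec_def)
  then show "heis_coframe i (heis_mult a x) (frechet_derivative (heis_mult a) (at x) v)
      = heis_coframe i x v"
    unfolding D heis_coframe_def using e by (simp split: sum.splits prod.splits)
qed

lemma heis_structure_equations:
  "ext_deriv (heis_e r k) x u v = 0"
  "ext_deriv (heis_eta s) x u v = 2 * omega heis_e s x u v"
proof -
  show "ext_deriv (heis_e r k) x u v = 0"
    by (simp add: ext_deriv_def heis_e_def)
  have "bounded_linear (\<lambda>y. omega heis_e s 0 y w)" for w
    by (intro linear_conv_bounded_linear[THEN iffD1] linearI) (simp_all add: omega_heis_e_linear)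
  then have "((\<lambda>y. heis_eta s y w) has_derivative (\<lambda>y. omega heis_e s 0 y w)) (at x)" for w
    unfolding heis_eta_def
    using has_derivative_add[OF has_derivative_const
        bounded_linear_imp_has_derivative[of "\<lambda>y. omega heis_e s 0 y w"],
        of "snd w $ s" "at x"] \<open>bounded_linear (\<lambda>y. omega heis_e s 0 y w)\<close> by simp
  then have D: "frechet_derivative (\<lambda>y. heis_eta s y w) (at x) = (\<lambda>y. omega heis_e s 0 y w)" for w
    using frechet_derivative_at by metis
  show "ext_deriv (heis_eta s) x u v = 2 * omega heis_e s x u v"
    unfolding ext_deriv_def D
    using omega_heis_e_antisym[of s 0 v u] omega_heis_e_base[of s x u v] by simp
qed


section \<open>The metric on the product with the line\<close>

definition dsigma :: "('a \<times> real) one_form" where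
  "dsigma p u = snd u"

definition qk_metric :: "real \<Rightarrow> (('n::finite) heis \<times> real) two_tensor" where
  "qk_metric b p u v =
     exp (2 * b * snd p) *
       (\<Sum>r\<in>UNIV. \<Sum>k\<in>UNIV. heis_e r k (fst p) (fst u) * heis_e r k (fst p) (fst v))
     + b\<^sup>2 * exp (4 * b * snd p) *
       (\<Sum>s\<in>UNIV. heis_eta s (fst p) (fst u) * heis_eta s (fst p) (fst v))
     + dsigma p u * dsigma p v"

definition e_tilde :: "real \<Rightarrow> 'n::finite \<Rightarrow> 4 \<Rightarrow> ('n heis \<times> real) one_form" where
  "e_tilde b r k p u = exp (b * snd p) * heis_e r k (fst p) (fst u)"

definition eta_tilde :: "real \<Rightarrow> 3 \<Rightarrow> (('n::finite) heis \<times> real) one_form" where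
  "eta_tilde b s p u = exp (2 * b * snd p) * heis_eta s (fst p) (fst u)"

definition tilde_coframe :: "real \<Rightarrow> ('n \<times> 4 + 3) option \<Rightarrow> (('n::finite) heis \<times> real) one_form" where
  "tilde_coframe b i =
     (case i of None \<Rightarrow> dsigma | Some (Inl (r, k)) \<Rightarrow> e_tilde b r k | Some (Inr s) \<Rightarrow> eta_tilde b s)"

end

(*
  In a left-invariant orthonormal frame the tangent spaces become H^n + H, the last summand
  being spanned by d sigma and b eta~, and the Levi-Civita connection form is
    L(X, y) (W, w) = b (X w + W Im y, - X^* W + (Im y) w + w Im y),
  the sum of an element of sp(n+1) and of right multiplication by b Im y.
  Its curvature is that of quaternionic hyperbolic space, which gives the Ricci tensor.
  For the holonomy, the quaternion-valued product h of two parallel fields along a curve solves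
  h' = [b Im y, h]. Norms of differences of solutions are constant, so solutions are unique, and
  the value at time 1 is an algebra automorphism of the value at time 0. By Skolem-Noether it is
  conjugation by a unit quaternion, and what is left of the transport preserves h.
  Completeness: along a curve of length l starting in a bounded set one bounds in turn the
  displacements of sigma, of the H^n-coordinate and of the central coordinate by a multiple of l.
*)
theory Submission
  imports Defs
begin

section \<open>Quaternionic linear algebra\<close>

text \<open>The definition of holonomy supplies, for each initial vector, only some parallel field;
  there is no transport operator and no splitting of it. The usual way to separate the Sp(1) factor
  is to solve a linear equation for a unit quaternion along the curve, which calls for an existence
  theorem with merely piecewise continuous coefficients. The commutator equation avoids existence
  altogether: solutions with every initial value are already at hand as products h(W(e), W(ep)) of
  parallel fields W started at a unit vector e and at its multiples ep. Since a commutator is a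
  derivation, uniqueness alone then makes the endpoint map multiplicative.

  In the completeness estimate the order matters: sigma controls the exponential weights, these
  control the H^n-coordinate, and that coordinate enters the coefficients of eta.\<close>

lemma vector_4:
  "(vector [x, y, z, w] :: ('a::zero)^4) $ 1 = x" "(vector [x, y, z, w] :: 'a^4) $ 2 = y"
  "(vector [x, y, z, w] :: 'a^4) $ 3 = z" "(vector [x, y, z, w] :: 'a^4) $ 4 = w"
  unfolding vector_def by simp_all

lemma qmul_nth [simp]:
  "qmul p q $ 1 = p$1 * q$1 - p$2 * q$2 - p$3 * q$3 - p$4 * q$4"
  "qmul p q $ 2 = p$1 * q$2 + p$2 * q$1 + p$3 * q$4 - p$4 * q$3"
  "qmul p q $ 3 = p$1 * q$3 - p$2 * q$4 + p$3 * q$1 + p$4 * q$2"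
  "qmul p q $ 4 = p$1 * q$4 + p$2 * q$3 - p$3 * q$2 + p$4 * q$1"
  by (simp_all add: qmul_def vector_4)

lemma qcnj_nth [simp]:
  "qcnj q $ 1 = q$1" "qcnj q $ 2 = - q$2" "qcnj q $ 3 = - q$3" "qcnj q $ 4 = - q$4"
  by (simp_all add: qcnj_def vector_4)

lemma qone_nth [simp]: "qone $ 1 = 1" "qone $ 2 = 0" "qone $ 3 = 0" "qone $ 4 = 0"
  by (simp_all add: qone_def vector_4)

lemma quat_eq_iff: "p = q \<longleftrightarrow> p$1 = q$1 \<and> p$2 = q$2 \<and> p$3 = q$3 \<and> p$4 = q$4"
  for p q :: quat
  unfolding vec_eq_iff forall_4 ..

lemma quat_inner: "p \<bullet> q = p$1 * q$1 + p$2 * q$2 + p$3 * q$3 + p$4 * q$4" for p q :: quat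
  unfolding inner_vec_def sum_4 by simp

lemma quat_norm_sq: "(norm q)\<^sup>2 = q$1 * q$1 + q$2 * q$2 + q$3 * q$3 + q$4 * q$4" for q :: quat
  by (simp add: power2_norm_eq_inner quat_inner)

lemma bounded_bilinear_qmul: "bounded_bilinear qmul"
  unfolding bilinear_conv_bounded_bilinear[symmetric] bilinear_def
  by (intro allI conjI linearI) (simp_all add: quat_eq_iff algebra_simps)

interpretation qmul: bounded_bilinear qmul
  by (rule bounded_bilinear_qmul)

lemma qcnj_linear:
  "qcnj (p + q) = qcnj p + qcnj q" "qcnj (c *\<^sub>R p) = c *\<^sub>R qcnj p" "qcnj 0 = 0"
  by (simp_all add: quat_eq_iff)

lemma qcnj_diff: "qcnj (p - q) = qcnj p - qcnj q"
  by (simp add: quat_eq_iff)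

lemma qcnj_sum: "qcnj (\<Sum>i\<in>A. f i) = (\<Sum>i\<in>A. qcnj (f i))"
  by (induction A rule: infinite_finite_induct) (simp_all add: qcnj_linear)

lemma qmul_assoc: "qmul (qmul p q) r = qmul p (qmul q r)"
  by (simp add: quat_eq_iff algebra_simps)

lemma qmul_one [simp]: "qmul qone q = q" "qmul q qone = q"
  by (simp_all add: quat_eq_iff)

lemma qcnj_qmul: "qcnj (qmul p q) = qmul (qcnj q) (qcnj p)"
  by (simp add: quat_eq_iff algebra_simps)

lemma qcnj_qcnj [simp]: "qcnj (qcnj q) = q"
  by (simp add: quat_eq_iff)

lemma qcnj_qone [simp]: "qcnj qone = qone"
  by (simp add: quat_eq_iff)

lemma qmul_qcnj: "qmul (qcnj q) q = (norm q)\<^sup>2 *\<^sub>R qone" "qmul q (qcnj q) = (norm q)\<^sup>2 *\<^sub>R qone"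
  by (simp_all add: quat_eq_iff quat_norm_sq algebra_simps)

definition qim :: "quat \<Rightarrow> quat" where
  "qim q = q - q$1 *\<^sub>R qone"

lemma qim_nth [simp]: "qim q $ 1 = 0" "qim q $ 2 = q$2" "qim q $ 3 = q$3" "qim q $ 4 = q$4"
  by (simp_all add: qim_def)

text \<open>Skolem-Noether for the quaternions. The averages
  \<open>Q x = (\<Sum>e. e x \<rho>(e)\<^sup>-\<^sup>1)\<close> over the units \<open>e = 1, i, j, k\<close> intertwine \<open>\<rho>\<close> with the identity, and they do
  not all vanish because \<open>(\<Sum>x. Q x x\<^sup>-\<^sup>1) = 4\<close>.\<close>

lemma quat_automorphism_inner:
  assumes add: "\<And>p q. \<rho> (p + q) = \<rho> p + \<rho> q" and scale: "\<And>c p. \<rho> (c *\<^sub>R p) = c *\<^sub>R \<rho> p"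
    and one: "\<rho> qone = qone" and mul: "\<And>p q. \<rho> (qmul p q) = qmul (\<rho> p) (\<rho> q)"
  shows "\<exists>q. norm q = 1 \<and> (\<forall>p. \<rho> p = qmul (qcnj q) (qmul p q))"
proof -
  define e2 e3 e4 :: quat
    where "e2 = vector [0,1,0,0]" and "e3 = vector [0,0,1,0]" and "e4 = vector [0,0,0,1]"
  have e [simp]: "e2$1 = 0" "e2$2 = 1" "e2$3 = 0" "e2$4 = 0" "e3$1 = 0" "e3$2 = 0" "e3$3 = 1"
    "e3$4 = 0" "e4$1 = 0" "e4$2 = 0" "e4$3 = 0" "e4$4 = 1"
    by (simp_all add: e2_def e3_def e4_def vector_4)
  define r2 r3 r4 where "r2 = \<rho> e2" and "r3 = \<rho> e3" and "r4 = \<rho> e4"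
  have minus: "\<rho> (- p) = - \<rho> p" for p
    using scale[of "-1" p] by simp
  have ee: "qmul e2 e2 = - qone" "qmul e3 e3 = - qone" "qmul e4 e4 = - qone"
    "qmul e2 e3 = e4" "qmul e3 e2 = - e4" "qmul e3 e4 = e2" "qmul e4 e3 = - e2"
    "qmul e4 e2 = e3" "qmul e2 e4 = - e3"
    by (simp_all add: quat_eq_iff)
  have rr: "qmul r2 r2 = - qone" "qmul r3 r3 = - qone" "qmul r4 r4 = - qone"
    "qmul r2 r3 = r4" "qmul r3 r2 = - r4" "qmul r3 r4 = r2" "qmul r4 r3 = - r2"
    "qmul r4 r2 = r3" "qmul r2 r4 = - r3"
    unfolding r2_def r3_def r4_def mul[symmetric] ee by (simp_all add: minus one)
  \<comment> \<open>A nonzero real part would make the three imaginary parts vanish, leaving a real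
    square equal to -1.\<close>
  have re0: "r$1 = 0" if "qmul r r = - qone" for r
  proof (rule ccontr)
    assume nz: "r$1 \<noteq> 0"
    have q: "r$1 * r$1 - r$2 * r$2 - r$3 * r$3 - r$4 * r$4 = -1"
      "2 * (r$1 * r$2) = 0" "2 * (r$1 * r$3) = 0" "2 * (r$1 * r$4) = 0"
      using that by (auto simp: quat_eq_iff)
    then have "r$2 = 0" "r$3 = 0" "r$4 = 0" using nz by auto
    then have "r$1 * r$1 = -1" using q(1) by simp
    moreover have "r$1 * r$1 \<ge> 0" by simp
    ultimately show False by linarith
  qed
  have re: "r2$1 = 0" "r3$1 = 0" "r4$1 = 0"
    using rr(1-3) re0 by auto
  define Q where "Q x = x - qmul e2 (qmul x r2) - qmul e3 (qmul x r3) - qmul e4 (qmul x r4)" for x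
  have expand: "p = p$1 *\<^sub>R qone + p$2 *\<^sub>R e2 + p$3 *\<^sub>R e3 + p$4 *\<^sub>R e4" for p
    by (simp add: quat_eq_iff)
  have rho: "\<rho> p = p$1 *\<^sub>R qone + p$2 *\<^sub>R r2 + p$3 *\<^sub>R r3 + p$4 *\<^sub>R r4" for p
    by (subst expand) (simp only: add scale one r2_def r3_def r4_def)
  have comm: "qmul (Q x) (\<rho> p) = qmul p (Q x)" for x p
  proof -
    define a2 a3 a4 where "a2 = qmul x r2" and "a3 = qmul x r3" and "a4 = qmul x r4"
    have a: "qmul a2 r2 = - x" "qmul a3 r2 = - a4" "qmul a4 r2 = a3"
      "qmul a2 r3 = a4" "qmul a3 r3 = - x" "qmul a4 r3 = - a2"
      "qmul a2 r4 = - a3" "qmul a3 r4 = a2" "qmul a4 r4 = - x"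
      unfolding a2_def a3_def a4_def qmul_assoc rr by (simp_all add: qmul.minus_right)
    have Q: "Q x = x - qmul e2 a2 - qmul e3 a3 - qmul e4 a4"
      by (simp add: Q_def a2_def a3_def a4_def)
    \<comment> \<open>Together with 1 the units span, so these three cases suffice: right
      multiplication by the image of a unit permutes the summands of \<open>Q x\<close> up to sign
      exactly as left multiplication by that unit does.\<close>
    have 2: "qmul (Q x) r2 = qmul e2 (Q x)" "qmul (Q x) r3 = qmul e3 (Q x)" "qmul (Q x) r4 = qmul e4 (Q x)"
      unfolding Q qmul.diff_left qmul_assoc a a2_def[symmetric] a3_def[symmetric] a4_def[symmetric]
      by (simp_all add: quat_eq_iff)
    show ?thesis
      unfolding rho qmul.add_right qmul.scaleR_right 2 qmul_one
      by (subst (9) expand) (simp add: qmul.add_left qmul.scaleR_left)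
  qed
  have "\<exists>x. Q x \<noteq> 0"
  proof (rule ccontr)
    assume "\<not> ?thesis"
    then have "Q x = 0" for x by auto
    \<comment> \<open>The component of \<open>Q x\<close> along a unit x is the real part of
      \<open>Q x\<close> times the inverse of x; computed from the definition of \<open>Q\<close>,
      the four components add up to 4.\<close>
    then have "Q qone $ 1 + Q e2 $ 2 + Q e3 $ 3 + Q e4 $ 4 = 0"
      by simp
    then show False
      using re by (simp add: Q_def)
  qed
  then obtain x where x: "Q x \<noteq> 0" by auto
  define q where "q = (1 / norm (Q x)) *\<^sub>R Q x"
  have n: "norm q = 1" using x by (simp add: q_def)
  have c: "qmul q (\<rho> p) = qmul p q" for p
    by (simp add: q_def qmul.scaleR_left qmul.scaleR_right comm)
  have "\<rho> p = qmul (qcnj q) (qmul p q)" for p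
    unfolding c[of p, symmetric] qmul_assoc[symmetric] by (simp add: qmul_qcnj n qmul.scaleR_left)
  then show ?thesis using n by blast
qed

section \<open>The quaternionic Hermitian form and the group Sp(m)Sp(1)\<close>

definition hform :: "quat^'m \<Rightarrow> quat^'m \<Rightarrow> quat" where
  "hform x y = (\<Sum>i\<in>UNIV. qmul (qcnj (x$i)) (y$i))"

lemma bounded_bilinear_hform: "bounded_bilinear (hform :: quat^'m \<Rightarrow> _)"
  unfolding bilinear_conv_bounded_bilinear[symmetric] bilinear_def
  by (intro allI conjI linearI)
    (simp_all add: hform_def qcnj_linear qmul.add_left qmul.add_right qmul.scaleR_left
      qmul.scaleR_right sum.distrib scaleR_sum_right)

interpretation hform: bounded_bilinear "hform :: quat^'m \<Rightarrow> _"
  by (rule bounded_bilinear_hform)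

lemma qcnj_hform: "qcnj (hform x y) = hform y x"
  by (simp add: hform_def qcnj_sum qcnj_qmul)

lemma hform_re: "hform x y $ 1 = x \<bullet> y"
  by (simp add: hform_def inner_vec_def[of x] quat_inner)

lemma hform_self: "hform x x = (norm x)\<^sup>2 *\<^sub>R qone"
proof -
  have "qcnj (hform x x) = hform x x" by (rule qcnj_hform)
  then have "hform x x $ 2 = 0" "hform x x $ 3 = 0" "hform x x $ 4 = 0"
    by (simp_all add: quat_eq_iff)
  then show ?thesis
    by (simp add: quat_eq_iff hform_re power2_norm_eq_inner)
qed

definition rmul :: "quat^'m \<Rightarrow> quat \<Rightarrow> quat^'m" where
  "rmul x q = (\<chi> i. qmul (x$i) q)"

lemma rmul_nth [simp]: "rmul x q $ i = qmul (x$i) q"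
  by (simp add: rmul_def)

lemma hform_rmul:
  "hform x (rmul y q) = qmul (hform x y) q" "hform (rmul x q) y = qmul (qcnj q) (hform x y)"
  by (simp_all add: hform_def qcnj_qmul qmul_assoc qmul.sum_left qmul.sum_right)

lemma hform_axis: "hform (axis i p) x = qmul (qcnj p) (x $ i)"
proof -
  have "hform (axis i p) x = (\<Sum>j\<in>UNIV. if j = i then qmul (qcnj p) (x $ j) else 0)"
    unfolding hform_def axis_def by (intro sum.cong) (auto simp: qcnj_linear qmul.zero_left)
  then show ?thesis by simp
qed

lemma hform_axis_right: "hform x (axis i p) = qmul (qcnj (x $ i)) p"
  by (metis hform_axis qcnj_hform qcnj_qcnj qcnj_qmul)

text \<open>Undoing q on the right turns T into a map B that preserves \<open>hform\<close> exactly.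
  Such a map is determined by the images of the unit vectors: their right-linear extension
  \<open>Ax\<close> has the same products with B as B itself, so the difference of the two has norm
  zero. This yields the linearity of T along with the matrix.\<close>

lemma hform_preserving_SpSp1:
  fixes T :: "quat^'m \<Rightarrow> quat^'m"
  assumes q: "norm q = 1" and T: "\<And>x y. hform (T x) (T y) = qmul (qcnj q) (qmul (hform x y) q)"
  shows "T \<in> SpSp1"
proof -
  define B where "B x = rmul (T x) (qcnj q)" for x
  define A :: "quat^'m^'m" where "A = (\<chi> i j. B (axis j qone) $ i)"
  have qq: "qmul q (qcnj q) = qone" "qmul (qcnj q) q = qone"
    using q by (simp_all add: qmul_qcnj)
  have cancel: "qmul (qcnj q) (qmul q z) = z" "qmul q (qmul (qcnj q) z) = z" for z
    unfolding qmul_assoc[symmetric] by (simp_all add: qq)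
  have B: "hform (B x) (B y) = hform x y" for x y
    by (simp add: B_def hform_rmul T qmul_assoc qq cancel)
  define Ax where "Ax x = (\<Sum>j\<in>UNIV. rmul (B (axis j qone)) (x $ j))" for x
  have r: "hform y (Ax x) = (\<Sum>j\<in>UNIV. qmul (hform y (B (axis j qone))) (x $ j))" for x y
    by (simp add: Ax_def hform.sum_right hform_rmul)
  have BA: "hform (B y) (Ax x) = hform y x" for x y
    unfolding r B hform_axis_right by (simp add: hform_def)
  have AB: "hform (Ax x) (B y) = hform x y" for x y
    using arg_cong[OF BA, of qcnj] by (simp add: qcnj_hform)
  have AA: "hform (Ax x) (Ax x) = hform x x" for x
    unfolding r AB hform_axis_right by (simp add: hform_def)
  have "B x = Ax x" for x
  proof -
    \<comment> \<open>All four products of the expansion equal \<open>hform x x\<close>, and they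
      enter with signs +, -, -, +.\<close>
    have "hform (B x - Ax x) (B x - Ax x) = 0"
      by (simp add: hform.diff_left hform.diff_right B BA AB AA)
    then show ?thesis by (simp add: hform_self quat_eq_iff)
  qed
  then have "Ax x = rmul (T x) (qcnj q)" for x by (simp add: B_def)
  then have "rmul (Ax x) q = T x" for x
    by (intro vec_eq_iff[THEN iffD2] allI) (simp only: rmul_nth qmul_assoc qq qmul_one)
  moreover have "Ax x $ i = (\<Sum>j\<in>UNIV. qmul (A$i$j) (x$j))" for x i
    by (simp add: Ax_def A_def)
  ultimately have T': "T = (\<lambda>x. \<chi> i. qmul (\<Sum>j\<in>UNIV. qmul (A$i$j) (x$j)) q)"
    by (metis (no_types, lifting) ext rmul_def vec_lambda_unique)
  have "(\<Sum>k\<in>UNIV. qmul (qcnj (A$k$i)) (A$k$j)) = hform (B (axis i qone)) (B (axis j qone))" for i j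
    by (simp add: A_def hform_def)
  then have "A \<in> Sp"
    by (auto simp: Sp_def B hform_axis) (auto simp: axis_def)
  then show ?thesis
    unfolding SpSp1_def using q T' by blast
qed

section \<open>The connection form and its curvature\<close>

definition op_trace :: "('a::euclidean_space \<Rightarrow> 'a) \<Rightarrow> real" where
  "op_trace f = (\<Sum>i\<in>Basis. f i \<bullet> i)"

text \<open>Two different spaces are allowed because Ricci is a trace over the tangent space, while
  the curvature is computed on the model space of the frame.\<close>

lemma op_trace_comp_commute:
  fixes f :: "'a::euclidean_space \<Rightarrow> 'b::euclidean_space"
  assumes "linear f" "linear g"
  shows "op_trace (\<lambda>x. g (f x)) = op_trace (\<lambda>y. f (g y))"
proof -
  interpret f: linear f by fact
  interpret g: linear g by fact
  have f: "f x = (\<Sum>j\<in>Basis. (f x \<bullet> j) *\<^sub>R j)" for x by (simp add: euclidean_representation)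
  have g: "g x = (\<Sum>j\<in>Basis. (g x \<bullet> j) *\<^sub>R j)" for x by (simp add: euclidean_representation)
  have 1: "g (f i) \<bullet> i = (\<Sum>j\<in>Basis. (f i \<bullet> j) * (g j \<bullet> i))" for i
    by (subst f) (simp add: g.sum g.scale inner_sum_left)
  have 2: "f (g j) \<bullet> j = (\<Sum>i\<in>Basis. (g j \<bullet> i) * (f i \<bullet> j))" for j
    by (subst g) (simp add: f.sum f.scale inner_sum_left)
  show ?thesis
    unfolding op_trace_def 1 2 by (subst sum.swap) (simp add: mult.commute)
qed

lemma sum_Basis_vec:
  fixes f :: "('a::euclidean_space)^'m \<Rightarrow> 'c::comm_monoid_add"
  shows "(\<Sum>x\<in>Basis. f x) = (\<Sum>i\<in>UNIV. \<Sum>u\<in>Basis. f (axis i u))"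
proof -
  have B: "(Basis :: ('a^'m) set) = (\<lambda>(i, u). axis i u) ` (UNIV \<times> Basis)"
    by (auto simp: Basis_vec_def)
  have "inj_on (\<lambda>(i :: 'm, u :: 'a). axis i u) (UNIV \<times> Basis)"
    by (auto simp: inj_on_def axis_eq_axis nonzero_Basis)
  then show ?thesis
    unfolding B by (simp add: sum.reindex sum.cartesian_product split_def)
qed

lemma sum_Basis_quat:
  "(\<Sum>u\<in>(Basis :: quat set). f u) = f (axis 1 1) + f (axis 2 1) + f (axis 3 1) + f (axis 4 1)"
  unfolding sum_Basis_vec sum_4 by simp

lemma axis_quat_nth:
  "(axis 1 1 :: quat) = vector [1,0,0,0]" "(axis 2 1 :: quat) = vector [0,1,0,0]"
  "(axis 3 1 :: quat) = vector [0,0,1,0]" "(axis 4 1 :: quat) = vector [0,0,0,1]"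
  by (auto simp: quat_eq_iff vector_4 axis_def)

lemma op_trace_rmul: "op_trace (\<lambda>x :: quat^'m. rmul x p) = 4 * real CARD('m) * p$1"
  unfolding op_trace_def sum_Basis_vec[where 'a=quat] inner_axis rmul_nth axis_nth sum_Basis_quat
  by (simp add: axis_quat_nth quat_inner vector_4)

text \<open>Coordinate by coordinate, with u running through 1, i, j, k, the first rests on the
  identity that the sum of u p u is -2 times the conjugate of p, the second on the sum of conj(u) p
  u being four times the real part of p.\<close>

lemma op_trace_rmul_hform:
  "op_trace (\<lambda>x :: quat^'m. rmul y (hform x z)) = - 2 * (y \<bullet> z)"
  "op_trace (\<lambda>x :: quat^'m. rmul y (hform z x)) = 4 * (y \<bullet> z)"
  unfolding op_trace_def sum_Basis_vec[where 'a=quat] inner_axis rmul_nth hform_axis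
    hform_axis_right sum_Basis_quat inner_vec_def[of y] sum_distrib_left
  by (intro sum.cong refl; simp add: axis_quat_nth quat_inner vector_4 algebra_simps)+

section \<open>The algebraic connection map and its curvature\<close>

lemma sum_option: "(\<Sum>i\<in>UNIV. f i) = f None + (\<Sum>r\<in>UNIV. f (Some r))"
  for f :: "'n::finite option \<Rightarrow> 'c::comm_monoid_add"
  by (simp add: UNIV_option_conv sum.reindex)

text \<open>The index \<open>None\<close> carries the dsigma- and eta-directions; the factor b of
  the connection form is kept outside. As \<open>qim\<close> discards the real part, the map
  vanishes for x along sigma: the frame is parallel along the sigma-lines.\<close>

definition qk_conn :: "quat^('n::finite option) \<Rightarrow> quat^('n option) \<Rightarrow> quat^('n option)" where
  "qk_conn x z = (\<chi> i. case i of
     Some r \<Rightarrow> qmul (x $ Some r) (z $ None) + qmul (z $ Some r) (qim (x $ None))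
   | None \<Rightarrow> qmul (qim (x $ None)) (z $ None) + qmul (z $ None) (qim (x $ None))
        - (\<Sum>r\<in>UNIV. qmul (qcnj (x $ Some r)) (z $ Some r)))"

definition hsome :: "quat^('n::finite option) \<Rightarrow> quat^('n option) \<Rightarrow> quat" where
  "hsome x z = (\<Sum>r\<in>UNIV. qmul (qcnj (x $ Some r)) (z $ Some r))"

lemma qk_conn_nth [simp]:
  "qk_conn x z $ Some r = qmul (x $ Some r) (z $ None) + qmul (z $ Some r) (qim (x $ None))"
  "qk_conn x z $ None = qmul (qim (x $ None)) (z $ None) + qmul (z $ None) (qim (x $ None)) - hsome x z"
  by (simp_all add: qk_conn_def hsome_def)

lemma hform_option: "hform x z = qmul (qcnj (x $ None)) (z $ None) + hsome x z"
  by (simp add: hform_def sum_option hsome_def)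

lemma hsome_commute: "hsome x y = qcnj (hsome y x)"
  by (simp add: hsome_def qcnj_sum qcnj_qmul)

lemma hsome_qk_conn:
  "hsome x (qk_conn y z) = qmul (hsome x y) (z $ None) + qmul (hsome x z) (qim (y $ None))"
  by (simp add: hsome_def qmul.add_right sum.distrib qmul.sum_left qmul_assoc)

lemma vec_option_eqI:
  "x $ None = y $ None \<Longrightarrow> (\<And>r. x $ Some r = y $ Some r) \<Longrightarrow> x = y"
  for x y :: "'b^('n::finite option)"
  unfolding vec_eq_iff by (metis not_Some_eq)

lemma bounded_bilinear_qk_conn: "bounded_bilinear (qk_conn :: quat^('n::finite option) \<Rightarrow> _)"
proof -
  have q: "qim (p + q) = qim p + qim q" "qim (c *\<^sub>R p) = c *\<^sub>R qim p" for p q c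
    by (simp_all add: quat_eq_iff)
  have h: "hsome (x + y) z = hsome x z + hsome y z" "hsome z (x + y) = hsome z x + hsome z y"
    "hsome (c *\<^sub>R x) z = c *\<^sub>R hsome x z" "hsome z (c *\<^sub>R x) = c *\<^sub>R hsome z x"
    for x y z :: "quat^('n option)" and c
    by (simp_all add: hsome_def qcnj_linear qmul.add_left qmul.add_right qmul.scaleR_left
        qmul.scaleR_right sum.distrib scaleR_sum_right)
  show ?thesis
    unfolding bilinear_conv_bounded_bilinear[symmetric] bilinear_def
    by (intro allI conjI linearI vec_option_eqI)
      (simp_all add: q h qmul.add_left qmul.add_right qmul.scaleR_left qmul.scaleR_right
        scaleR_diff_right scaleR_add_right)
qed

interpretation qk_conn: bounded_bilinear qk_conn
  by (rule bounded_bilinear_qk_conn)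

lemma hsome_qk_conn_left:
  "hsome (qk_conn y z) x = qmul (qcnj (z $ None)) (hsome y x) + qmul (qcnj (qim (y $ None))) (hsome z x)"
  by (subst hsome_commute) (simp add: hsome_qk_conn qcnj_linear qcnj_qmul hsome_commute[symmetric])

text \<open>The sp(n+1)-part of the connection is skew for \<open>hform\<close> and cancels. Right
  multiplication by p = \<open>qim (x $ None)\<close> contributes conj(p) h + h p, which is h p - p
  h because p is imaginary.\<close>

lemma hform_qk_conn:
  "hform (qk_conn x a) c + hform a (qk_conn x c)
     = qmul (hform a c) (qim (x $ None)) - qmul (qim (x $ None)) (hform a c)"
  unfolding hform_option hsome_qk_conn hsome_qk_conn_left qk_conn_nth hsome_commute[of a x]
  by (simp add: quat_eq_iff) (simp add: algebra_simps)

text \<open>The left side is the real part of a commutator of quaternions.\<close>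

lemma qk_conn_skew: "qk_conn x a \<bullet> c + a \<bullet> qk_conn x c = 0"
  using arg_cong[OF hform_qk_conn[of x a c], of "\<lambda>q. q $ 1"]
  by (simp add: hform_re)

text \<open>Multiplied by -b, these expressions are the exterior derivatives of the frame forms: the
  first encodes d e~ = -b e~ \<and> dsigma, the second d eta~ = 2 omega~ - 2b eta~ \<and> dsigma.
  This comparison is what fixes the shape of \<open>qk_conn\<close>.\<close>

lemma qk_conn_torsion:
  "(qk_conn x y - qk_conn y x) $ Some r = (y $ None $ 1) *\<^sub>R (x $ Some r) - (x $ None $ 1) *\<^sub>R (y $ Some r)"
  "(qk_conn x y - qk_conn y x) $ None
     = 2 *\<^sub>R ((y $ None $ 1) *\<^sub>R qim (x $ None) - (x $ None $ 1) *\<^sub>R qim (y $ None) - qim (hsome x y))"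
  using hsome_commute[of y x] by (simp_all add: quat_eq_iff algebra_simps)

text \<open>For constant connection coefficients no derivative terms survive, and by vanishing
  torsion the bracket of two frame fields is the difference inside the third term. The right side
  is, up to the factor \<open>b\<^sup>2\<close>, the curvature of quaternionic hyperbolic
  space.\<close>

lemma qk_conn_curvature:
  "qk_conn x (qk_conn y z) - qk_conn y (qk_conn x z) - qk_conn (qk_conn x y - qk_conn y x) z
     = rmul y (hform x z) - rmul x (hform y z) + rmul z (hform x y - hform y x)"
proof (rule vec_option_eqI)
  \<comment> \<open>\<open>hsome\<close> sees only the \<open>Some\<close>-components of the
    torsion, where the quaternionic products have cancelled and only real multiples of x and y are
    left.\<close>
  have T: "hsome (qk_conn x y - qk_conn y x) z
     = (y $ None $ 1) *\<^sub>R hsome x z - (x $ None $ 1) *\<^sub>R hsome y z"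
    unfolding hsome_def qk_conn_torsion
    by (simp add: qcnj_diff qcnj_linear qmul.diff_left qmul.scaleR_left sum_subtractf
        scaleR_sum_right)
  show "(qk_conn x (qk_conn y z) - qk_conn y (qk_conn x z) - qk_conn (qk_conn x y - qk_conn y x) z) $ None
     = (rmul y (hform x z) - rmul x (hform y z) + rmul z (hform x y - hform y x)) $ None"
    unfolding vector_minus_component vector_add_component rmul_nth qk_conn_nth hform_option
      hsome_qk_conn T hsome_commute[of y x] 
    by (simp add: quat_eq_iff) (simp add: algebra_simps)
  fix r
  show "(qk_conn x (qk_conn y z) - qk_conn y (qk_conn x z) - qk_conn (qk_conn x y - qk_conn y x) z) $ Some r
     = (rmul y (hform x z) - rmul x (hform y z) + rmul z (hform x y - hform y x)) $ Some r"
    unfolding vector_minus_component vector_add_component rmul_nth qk_conn_nth hform_option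
      hsome_commute[of y x] 
    by (simp add: quat_eq_iff) (simp add: algebra_simps)
qed

lemma op_trace_add: "op_trace (\<lambda>x. f x + g x) = op_trace f + op_trace g"
  and op_trace_diff: "op_trace (\<lambda>x. f x - g x) = op_trace f - op_trace g"
  by (simp_all add: op_trace_def inner_add_left inner_diff_left sum.distrib sum_subtractf)

lemma op_trace_scaleR: "op_trace (\<lambda>x. c *\<^sub>R f x) = c * op_trace f"
  by (simp add: op_trace_def sum_distrib_left)

text \<open>The four terms contribute -2, -4(n+1), -2 and -4 times the inner product, n+1 being the
  quaternionic dimension; the total is -4(n+3).\<close>

lemma op_trace_curvature:
  fixes y z :: "quat^('n::finite option)"
  shows "op_trace (\<lambda>x. rmul y (hform x z) - rmul x (hform y z) + rmul z (hform x y - hform y x))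
    = - 4 * (real CARD('n) + 3) * (y \<bullet> z)"
proof -
  have rd: "rmul z (p - q) = rmul z p - rmul z q" for p q and z :: "quat^('n option)"
    by (rule vec_eq_iff[THEN iffD2]) (simp add: qmul.diff_right)
  show ?thesis
    unfolding rd op_trace_add op_trace_diff op_trace_rmul op_trace_rmul_hform
    by (simp add: hform_re inner_commute algebra_simps)
qed

section \<open>Riemannian geometry in a moving frame\<close>

text \<open>The frame is a field of isomorphisms \<phi> onto a fixed Euclidean space with inverse
  \<psi>; its first and second derivatives are passed as data, so that they can be given in closed
  form. L is a connection form with constant coefficients: \<open>skew\<close> says that it is
  metric, and \<open>torsion\<close> is Cartan's first structure equation.\<close>

locale moving_frame =
  fixes \<phi> :: "'a::euclidean_space \<Rightarrow> 'a \<Rightarrow> 'b::euclidean_space"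
    and \<psi> :: "'a \<Rightarrow> 'b \<Rightarrow> 'a"
    and \<phi>' :: "'a \<Rightarrow> 'a \<Rightarrow> 'a \<Rightarrow> 'b"
    and \<phi>'' :: "'a \<Rightarrow> 'a \<Rightarrow> 'a \<Rightarrow> 'a \<Rightarrow> 'b"
    and L :: "'b \<Rightarrow> 'b \<Rightarrow> 'b"
  assumes linear: "linear (\<phi> x)"
    and linear': "linear (\<phi>' x u)"
    and inverse: "\<psi> x (\<phi> x v) = v" "\<phi> x (\<psi> x w) = w"
    and deriv: "((\<lambda>y. \<phi> y v) has_derivative (\<lambda>u. \<phi>' x u v)) (at x)"
    and deriv': "((\<lambda>y. \<phi>' y u v) has_derivative (\<lambda>t. \<phi>'' x t u v)) (at x)"
    and second_symmetric: "\<phi>'' x t u v = \<phi>'' x u t v"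
    and inverse_differentiable: "(\<lambda>y. \<psi> y w) differentiable (at x)"
    and L_bilinear: "bounded_bilinear L"
    and skew: "L \<xi> \<zeta> \<bullet> \<zeta>' + \<zeta> \<bullet> L \<xi> \<zeta>' = 0"
    and torsion: "\<phi>' x u v - \<phi>' x v u = L (\<phi> x v) (\<phi> x u) - L (\<phi> x u) (\<phi> x v)"
begin

sublocale L: bounded_bilinear L
  by (rule L_bilinear)

definition g :: "'a two_tensor" where
  "g x u v = \<phi> x u \<bullet> \<phi> x v"

text \<open>Obtained by solving \<phi>(\<nabla>_u V) = D_u(\<phi> V) + L(\<phi> u)(\<phi> V) for the
  covariant derivative of a constant field V = v.\<close>

definition \<Gamma> :: "'a \<Rightarrow> 'a \<Rightarrow> 'a \<Rightarrow> 'a" where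
  "\<Gamma> x u v = \<psi> x (\<phi>' x u v + L (\<phi> x u) (\<phi> x v))"

lemma linear_inverse: "linear (\<psi> x)"
proof (rule linearI)
  fix a b
  show "\<psi> x (a + b) = \<psi> x a + \<psi> x b"
    using linear_add[OF linear, of x "\<psi> x a" "\<psi> x b"] by (metis inverse)
  fix c
  show "\<psi> x (c *\<^sub>R a) = c *\<^sub>R \<psi> x a"
    using linear_scale[OF linear, of x c "\<psi> x a"] by (metis inverse)
qed

lemma frame_eq_iff: "\<phi> x u = \<phi> x v \<longleftrightarrow> u = v"
  by (metis inverse(1))

lemma bilinear_g: "bilinear (g x)"
  unfolding bilinear_def g_def
  by (intro allI conjI linearI)
    (simp_all add: linear_add[OF linear] linear_scale[OF linear] inner_add_left inner_add_right)

lemma linear'_left: "linear (\<lambda>u. \<phi>' x u v)"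
  using has_derivative_linear[OF deriv] .

lemma bilinear_\<Gamma>: "bilinear (\<Gamma> x)"
  unfolding bilinear_def \<Gamma>_def
  by (intro allI conjI linear_compose[OF _ linear_inverse, unfolded o_def] linearI)
    (simp_all add: linear_add[OF linear] linear_scale[OF linear] linear_add[OF linear']
      linear_scale[OF linear'] linear_add[OF linear'_left] linear_scale[OF linear'_left]
      L.add_left L.add_right L.scaleR_left L.scaleR_right algebra_simps)

lemma frame_\<Gamma>: "\<phi> x (\<Gamma> x u v) = \<phi>' x u v + L (\<phi> x u) (\<phi> x v)"
  by (simp add: \<Gamma>_def inverse)

lemma has_derivative_g:
  "((\<lambda>y. g y v w) has_derivative (\<lambda>u. \<phi> x v \<bullet> \<phi>' x u w + \<phi>' x u v \<bullet> \<phi> x w)) (at x)"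
  unfolding g_def by (rule has_derivative_inner[OF deriv deriv])

lemma is_levi_civita_\<Gamma>: "is_levi_civita g \<Gamma>"
  unfolding is_levi_civita_def
proof (intro conjI allI bilinear_\<Gamma>)
  fix x u v w
  have "\<phi>' x u v + L (\<phi> x u) (\<phi> x v) = \<phi>' x v u + L (\<phi> x v) (\<phi> x u)"
    using torsion[of x u v] by (simp add: algebra_simps)
  then show "\<Gamma> x u v = \<Gamma> x v u"
    by (simp add: \<Gamma>_def)
  have "frechet_derivative (\<lambda>y. g y v w) (at x) u = \<phi> x v \<bullet> \<phi>' x u w + \<phi>' x u v \<bullet> \<phi> x w"
    using frechet_derivative_at[OF has_derivative_g] by metis
  also have "\<dots> = g x (\<Gamma> x u v) w + g x v (\<Gamma> x u w)"
    using skew[of "\<phi> x u" "\<phi> x v" "\<phi> x w"]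
    by (simp add: g_def frame_\<Gamma> inner_add_left inner_add_right)
  finally show "frechet_derivative (\<lambda>y. g y v w) (at x) u = g x (\<Gamma> x u v) w + g x v (\<Gamma> x u w)" .
qed

text \<open>The Koszul argument: the difference of two such connections, paired with a third vector,
  is symmetric in the first two slots and skew in the last two. Three applications of skewness
  return the same value with opposite sign.\<close>

lemma is_levi_civita_unique:
  assumes "is_levi_civita g \<Gamma>1"
  shows "\<Gamma>1 = \<Gamma>"
proof (intro ext)
  fix x u v
  define \<Delta> where "\<Delta> u v = \<phi> x (\<Gamma>1 x u v) - \<phi> x (\<Gamma> x u v)" for u v
  have sym: "\<Delta> u v = \<Delta> v u" for u v
    using assms is_levi_civita_\<Gamma> unfolding \<Delta>_def is_levi_civita_def by metis
  have "g x (\<Gamma>1 x u v) w + g x v (\<Gamma>1 x u w) = g x (\<Gamma> x u v) w + g x v (\<Gamma> x u w)" for u v w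
    using assms is_levi_civita_\<Gamma> unfolding is_levi_civita_def by metis
  note metric = this
  have skew: "\<Delta> u v \<bullet> \<phi> x w = - (\<Delta> u w \<bullet> \<phi> x v)" for u v w
    using metric[of u v w, unfolded g_def] inner_commute[of "\<phi> x v" "\<phi> x (\<Gamma>1 x u w)"]
      inner_commute[of "\<phi> x v" "\<phi> x (\<Gamma> x u w)"]
    unfolding \<Delta>_def inner_diff_left by linarith
  have zero: "\<Delta> u v \<bullet> \<phi> x w = 0" for u v w
    using skew[of u v w] skew[of w u v] skew[of v w u]
    unfolding sym[of v u] sym[of w v] sym[of w u] by linarith
  have "\<Delta> u v \<bullet> \<Delta> u v = 0"
    using zero[of u v "\<psi> x (\<Delta> u v)"] by (simp add: inverse)
  then have "\<Delta> u v = 0" by simp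
  then show "\<Gamma>1 x u v = \<Gamma> x u v"
    by (simp add: \<Delta>_def frame_eq_iff)
qed

lemma levi_civita_eq: "levi_civita g = \<Gamma>"
  unfolding levi_civita_def by (rule the_equality, rule is_levi_civita_\<Gamma>, erule is_levi_civita_unique)

text \<open>The derivative of \<phi> is known only for a fixed vector. Expanding the moving vector
  in the standard basis turns the claim into finitely many product rules. The base point moves along
  p, which is the identity for the curvature and a curve for parallel transport.\<close>

lemma has_derivative_frame_apply:
  assumes V: "(V has_derivative V') (at x within S)" and p: "(p has_derivative p') (at x within S)"
  shows "((\<lambda>y. \<phi> (p y) (V y)) has_derivative (\<lambda>t. \<phi>' (p x) (p' t) (V x) + \<phi> (p x) (V' t))) (at x within S)"
proof -
  have 1: "\<phi> y v = (\<Sum>i\<in>Basis. (v \<bullet> i) *\<^sub>R \<phi> y i)" for y v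
    by (subst euclidean_representation[symmetric, of v])
      (simp only: linear_sum[OF linear] linear_scale[OF linear])
  have 2: "\<phi>' y u v = (\<Sum>i\<in>Basis. (v \<bullet> i) *\<^sub>R \<phi>' y u i)" for y u v
    by (subst euclidean_representation[symmetric, of v])
      (simp only: linear_sum[OF linear'] linear_scale[OF linear'])
  have c: "((\<lambda>y. \<phi> (p y) i) has_derivative (\<lambda>t. \<phi>' (p x) (p' t) i)) (at x within S)" for i
    using has_derivative_compose[OF p deriv] .
  have "((\<lambda>y. \<Sum>i\<in>Basis. (V y \<bullet> i) *\<^sub>R \<phi> (p y) i) has_derivative
     (\<lambda>t. \<Sum>i\<in>Basis. (V x \<bullet> i) *\<^sub>R \<phi>' (p x) (p' t) i + (V' t \<bullet> i) *\<^sub>R \<phi> (p x) i)) (at x within S)"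
    by (intro has_derivative_sum has_derivative_scaleR c has_derivative_inner_left V)
  then show ?thesis
    by (simp add: 1[of _ "V _"] 1[of _ "V' _"] 2[of _ _ "V _"] sum.distrib)
qed

lemma has_derivative_\<Gamma>_frame:
  "((\<lambda>y. \<phi>' y v w + L (\<phi> y v) (\<phi> y w)) has_derivative
     (\<lambda>u. \<phi>'' x u v w + (L (\<phi> x v) (\<phi>' x u w) + L (\<phi>' x u v) (\<phi> x w)))) (at x)"
  by (intro has_derivative_add deriv' L.FDERIV deriv)

text \<open>Guarantees that \<open>frechet_derivative\<close> in \<open>riemann_curvature\<close> is
  a genuine derivative; its value is found without differentiating \<psi>.\<close>

lemma \<Gamma>_differentiable: "(\<lambda>y. \<Gamma> y v w) differentiable (at x)"
proof -
  have 1: "\<psi> y \<xi> = (\<Sum>i\<in>Basis. (\<xi> \<bullet> i) *\<^sub>R \<psi> y i)" for y \<xi>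
    by (subst euclidean_representation[symmetric, of \<xi>])
      (simp only: linear_sum[OF linear_inverse] linear_scale[OF linear_inverse])
  have "(\<lambda>y. \<phi>' y v w + L (\<phi> y v) (\<phi> y w)) differentiable (at x)"
    using has_derivative_\<Gamma>_frame unfolding differentiable_def by blast
  then show ?thesis
    unfolding \<Gamma>_def by (subst 1) (intro differentiable_sum differentiable_scaleR
        differentiable_inner differentiable_const inverse_differentiable ballI finite_Basis)
qed

lemma frame_curvature:
  "\<phi> x (riemann_curvature g x u v w)
     = L (\<phi> x u) (L (\<phi> x v) (\<phi> x w)) - L (\<phi> x v) (L (\<phi> x u) (\<phi> x w))
       - L (L (\<phi> x u) (\<phi> x v) - L (\<phi> x v) (\<phi> x u)) (\<phi> x w)"
proof -
  define D where "D u v w = frechet_derivative (\<lambda>y. \<Gamma> y v w) (at x) u" for u v w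
  have "((\<lambda>y. \<Gamma> y v w) has_derivative (\<lambda>u. D u v w)) (at x)" for v w
    using \<Gamma>_differentiable[of v w x] unfolding D_def by (simp add: frechet_derivative_works[symmetric])
  \<comment> \<open>Differentiating \<phi>(\<Gamma>) = \<phi>' + L in two ways determines \<phi>
    applied to the derivative of \<Gamma>.\<close>
  from has_derivative_frame_apply[OF this has_derivative_ident]
  have "((\<lambda>y. \<phi>' y v w + L (\<phi> y v) (\<phi> y w)) has_derivative
      (\<lambda>u. \<phi>' x u (\<Gamma> x v w) + \<phi> x (D u v w))) (at x)" for v w
    unfolding frame_\<Gamma> by simp
  from has_derivative_unique[OF this has_derivative_\<Gamma>_frame]
  have D: "\<phi> x (D u v w) = \<phi>'' x u v w + (L (\<phi> x v) (\<phi>' x u w) + L (\<phi>' x u v) (\<phi> x w))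
      - \<phi>' x u (\<Gamma> x v w)" for u v w
    by (auto simp: fun_eq_iff algebra_simps)
  \<comment> \<open>After the second derivatives cancel by symmetry, the first derivatives of the
    frame survive only in this antisymmetric combination, which \<open>torsion\<close> makes
    algebraic.\<close>
  have t: "L (\<phi>' x u v) \<zeta> - L (\<phi>' x v u) \<zeta> = - L (L (\<phi> x u) (\<phi> x v) - L (\<phi> x v) (\<phi> x u)) \<zeta>" for \<zeta>
    unfolding L.diff_left[symmetric] torsion L.minus_left[symmetric] by simp
  show ?thesis
    unfolding riemann_curvature_def levi_civita_eq Let_def D_def[symmetric]
    using t[of "\<phi> x w"] second_symmetric[of x u v w]
    by (simp add: linear_add[OF linear] linear_diff[OF linear] D frame_\<Gamma> L.add_right L.diff_left
        algebra_simps)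
qed

text \<open>As a function of its first slot the curvature is conjugate, via the frame, to an
  operator on the model space, and a trace is invariant under conjugation.\<close>

lemma ricci_frame:
  "ricci g x v w = op_trace (\<lambda>\<xi>. L \<xi> (L (\<phi> x v) (\<phi> x w)) - L (\<phi> x v) (L \<xi> (\<phi> x w))
       - L (L \<xi> (\<phi> x v) - L (\<phi> x v) \<xi>) (\<phi> x w))" (is "_ = op_trace ?F")
proof -
  have lF: "linear ?F"
    by (intro linearI) (simp_all add: L.add_left L.add_right L.scaleR_left L.scaleR_right
        L.diff_left L.diff_right algebra_simps)
  have "riemann_curvature g x u v w = \<psi> x (?F (\<phi> x u))" for u
    using frame_curvature[of x u v w] by (metis inverse(1))
  then have "ricci g x v w = op_trace (\<lambda>u. \<psi> x (?F (\<phi> x u)))"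
    by (simp add: ricci_def op_trace_def)
  also have "\<dots> = op_trace (\<lambda>\<xi>. ?F (\<phi> x (\<psi> x \<xi>)))"
    using op_trace_comp_commute[OF linear_compose[OF linear lF, unfolded o_def] linear_inverse] .
  finally show ?thesis by (simp add: inverse)
qed

text \<open>The derivative of the frame along the curve cancels the term \<phi>' in \<Gamma>, which
  leaves a linear equation in the fixed model space. The exceptional set absorbs the break points of
  the curve as well as those of V.\<close>

lemma parallel_frame:
  assumes V: "parallel_along g \<gamma> V" and \<gamma>: "valid_path \<gamma>"
  obtains S where "finite S" "continuous_on {0..1} (\<lambda>t. \<phi> (\<gamma> t) (V t))"
    "\<And>t. t \<in> {0..1} - S \<Longrightarrow> ((\<lambda>t. \<phi> (\<gamma> t) (V t)) has_vector_derivative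
       - L (\<phi> (\<gamma> t) (vector_derivative \<gamma> (at t))) (\<phi> (\<gamma> t) (V t))) (at t)"
proof -
  obtain S where S: "finite S" "continuous_on {0..1} V"
    "\<And>t. t \<in> {0..1} - S \<Longrightarrow> (V has_vector_derivative
       - \<Gamma> (\<gamma> t) (vector_derivative \<gamma> (at t)) (V t)) (at t)"
    using V unfolding parallel_along_def levi_civita_eq by blast
  obtain S' where S': "finite S'" "\<And>t. t \<in> {0..1} - S' \<Longrightarrow> \<gamma> differentiable (at t)"
    "continuous_on {0..1} \<gamma>"
    using \<gamma> unfolding valid_path_def piecewise_C1_differentiable_on_def C1_differentiable_on_eq
    by blast
  have 1: "\<phi> y v = (\<Sum>i\<in>Basis. (v \<bullet> i) *\<^sub>R \<phi> y i)" for y v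
    by (subst euclidean_representation[symmetric, of v])
      (simp only: linear_sum[OF linear] linear_scale[OF linear])
  have c: "continuous_on UNIV (\<lambda>y. \<phi> y i)" for i
    using has_derivative_continuous[OF deriv] by (simp add: continuous_on_eq_continuous_at)
  have c2: "continuous_on {0..1} (\<lambda>t. \<phi> (\<gamma> t) (V t))"
    by (subst 1) (intro continuous_intros S(2) continuous_on_compose2[OF c S'(3)] subset_UNIV)
  show ?thesis
  proof (rule that[of "S \<union> S'"])
    fix t assume t: "t \<in> {0..1} - (S \<union> S')"
    define v where "v = vector_derivative \<gamma> (at t)"
    have "(\<gamma> has_vector_derivative v) (at t)"
      unfolding v_def using S'(2) t vector_derivative_works by blast
    then have "((\<lambda>t. \<phi> (\<gamma> t) (V t)) has_derivative
       (\<lambda>s. \<phi>' (\<gamma> t) (s *\<^sub>R v) (V t) + \<phi> (\<gamma> t) (s *\<^sub>R (- \<Gamma> (\<gamma> t) v (V t))))) (at t)"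
      using has_derivative_frame_apply[of V _ t UNIV \<gamma>] S(3)[of t] t
      unfolding has_vector_derivative_def v_def by blast
    then show "((\<lambda>t. \<phi> (\<gamma> t) (V t)) has_vector_derivative
       - L (\<phi> (\<gamma> t) (vector_derivative \<gamma> (at t))) (\<phi> (\<gamma> t) (V t))) (at t)"
      unfolding has_vector_derivative_def v_def[symmetric]
      by (simp add: linear_scale[OF linear'_left] linear_scale[OF linear] frame_\<Gamma>
          linear_neg[OF linear] scaleR_add_right)
  qed (use S S' c2 in auto)
qed

end

section \<open>Holonomy and the quaternionic frame\<close>

text \<open>Uniqueness will rest on a conservation law instead of a Lipschitz estimate, so q is an
  arbitrary function and the equation is imposed off a finite set.\<close>

definition commutator_solution :: "(real \<Rightarrow> quat) \<Rightarrow> (real \<Rightarrow> quat) \<Rightarrow> bool" where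
  "commutator_solution q f \<longleftrightarrow> continuous_on {0..1} f \<and>
     (\<exists>S. finite S \<and> (\<forall>t\<in>{0..1} - S. (f has_vector_derivative
        qmul (q t) (f t) - qmul (f t) (q t)) (at t)))"

lemma commutator_solution_const: "commutator_solution q (\<lambda>t. qone)"
  unfolding commutator_solution_def by (auto intro!: exI[of _ "{}"])

lemma commutator_solution_scaleR:
  assumes "commutator_solution q f"
  shows "commutator_solution q (\<lambda>t. c *\<^sub>R f t)"
proof -
  obtain S where S: "finite S" "\<And>t. t \<in> {0..1} - S \<Longrightarrow>
      (f has_vector_derivative qmul (q t) (f t) - qmul (f t) (q t)) (at t)" "continuous_on {0..1} f"
    using assms unfolding commutator_solution_def by auto
  show ?thesis
    unfolding commutator_solution_def
  proof (intro conjI exI[of _ S] ballI)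
    fix t assume t: "t \<in> {0..1} - S"
    show "((\<lambda>t. c *\<^sub>R f t) has_vector_derivative qmul (q t) (c *\<^sub>R f t) - qmul (c *\<^sub>R f t) (q t)) (at t)"
      using bounded_linear.has_vector_derivative[OF bounded_linear_scaleR_right[of c] S(2)[of t]] t
      by (simp add: qmul.scaleR_left qmul.scaleR_right algebra_simps)
  qed (use S in \<open>auto intro: continuous_intros\<close>)
qed

text \<open>The map f \<mapsto> [q, f] is a derivation, so the solutions form an algebra under
  pointwise operations.\<close>

lemma commutator_solution_combine:
  assumes "commutator_solution q f" "commutator_solution q g"
  shows "commutator_solution q (\<lambda>t. f t + g t)" "commutator_solution q (\<lambda>t. qmul (f t) (g t))"
proof -
  obtain S where S: "finite S" "\<And>t. t \<in> {0..1} - S \<Longrightarrow>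
      (f has_vector_derivative qmul (q t) (f t) - qmul (f t) (q t)) (at t)" "continuous_on {0..1} f"
    using assms(1) unfolding commutator_solution_def by auto
  obtain S' where S': "finite S'" "\<And>t. t \<in> {0..1} - S' \<Longrightarrow>
      (g has_vector_derivative qmul (q t) (g t) - qmul (g t) (q t)) (at t)" "continuous_on {0..1} g"
    using assms(2) unfolding commutator_solution_def by auto
  show "commutator_solution q (\<lambda>t. f t + g t)"
    unfolding commutator_solution_def
  proof (intro conjI exI[of _ "S \<union> S'"] ballI)
    fix t assume t: "t \<in> {0..1} - (S \<union> S')"
    show "((\<lambda>t. f t + g t) has_vector_derivative qmul (q t) (f t + g t) - qmul (f t + g t) (q t)) (at t)"
      using has_vector_derivative_add[OF S(2)[of t] S'(2)[of t]] t
      by (simp add: qmul.add_left qmul.add_right algebra_simps)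
  qed (use S S' in \<open>auto intro: continuous_intros\<close>)
  show "commutator_solution q (\<lambda>t. qmul (f t) (g t))"
    unfolding commutator_solution_def
  proof (intro conjI exI[of _ "S \<union> S'"] ballI)
    fix t assume t: "t \<in> {0..1} - (S \<union> S')"
    show "((\<lambda>t. qmul (f t) (g t)) has_vector_derivative
        qmul (q t) (qmul (f t) (g t)) - qmul (qmul (f t) (g t)) (q t)) (at t)"
      using bounded_bilinear.has_vector_derivative[OF bounded_bilinear_qmul S(2)[of t] S'(2)[of t]] t
      by (simp add: qmul.diff_left qmul.diff_right qmul_assoc)
  qed (use S S' in \<open>auto intro: qmul.continuous_on\<close>)
qed

lemma commutator_solution_zero:
  assumes f: "commutator_solution q f" and 0: "f 0 = 0" and t: "t \<in> {0..1}"
  shows "f t = 0"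
proof -
  obtain S where S: "finite S" "\<And>t. t \<in> {0..1} - S \<Longrightarrow>
      (f has_vector_derivative qmul (q t) (f t) - qmul (f t) (q t)) (at t)" "continuous_on {0..1} f"
    using f unfolding commutator_solution_def by auto
  \<comment> \<open>The inner products of f with q f and with f q both equal the squared norm of f
    times the real part of q.\<close>
  have z: "f t \<bullet> (qmul (q t) (f t) - qmul (f t) (q t)) = 0" for t
    by (simp add: quat_inner algebra_simps)
  have "((\<lambda>t. f t \<bullet> f t) has_derivative (\<lambda>h. 0)) (at t within {0..1})" if "t \<in> {0..1} - S" for t
  proof -
    have "((\<lambda>t. f t \<bullet> f t) has_vector_derivative 0) (at t)"
      using bounded_bilinear.has_vector_derivative[OF bounded_bilinear_inner S(2)[OF that] S(2)[OF that]]
      by (simp add: z inner_commute[of _ "f t"])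
    then show ?thesis
      by (auto simp: has_vector_derivative_def intro: has_derivative_at_withinI)
  qed
  then have "f t \<bullet> f t = f 0 \<bullet> f 0"
    using has_derivative_zero_unique_strong_interval[of S 0 1 "\<lambda>t. f t \<bullet> f t" "f 0 \<bullet> f 0" t] S(1,3) t
    by (auto intro: continuous_intros)
  then show ?thesis by (simp add: 0)
qed

lemma commutator_solution_unique:
  assumes "commutator_solution q f" "commutator_solution q g" "f 0 = g 0" "t \<in> {0..1}"
  shows "f t = g t"
proof -
  have "commutator_solution q (\<lambda>t. f t + (-1) *\<^sub>R g t)"
    by (intro commutator_solution_combine commutator_solution_scaleR assms)
  from commutator_solution_zero[OF this _ assms(4)] show ?thesis
    using assms(3) by simp
qed

lemma holonomy_frame:
  fixes \<phi> :: "'a::euclidean_space \<Rightarrow> 'a \<Rightarrow> quat^'m"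
  assumes frame: "moving_frame \<phi> \<psi> \<phi>' \<phi>'' L"
    and hL: "\<And>x a c. hform (L x a) c + hform a (L x c) = qmul (hform a c) (Q x) - qmul (Q x) (hform a c)"
    and A: "A \<in> holonomy (moving_frame.g \<phi>) x"
  shows "\<phi> x \<circ> A \<circ> inv (\<phi> x) \<in> SpSp1"
proof -
  interpret moving_frame \<phi> \<psi> \<phi>' \<phi>'' L by (rule frame)
  obtain \<gamma> where \<gamma>: "admissible_path \<gamma>" "pathstart \<gamma> = x" "pathfinish \<gamma> = x"
    "\<And>v. \<exists>V. parallel_along g \<gamma> V \<and> V 0 = v \<and> V 1 = A v"
    using A unfolding holonomy_def by auto
  have vp: "valid_path \<gamma>" and ends: "\<gamma> 0 = x" "\<gamma> 1 = x"
    using \<gamma> by (auto simp: admissible_path_def pathstart_def pathfinish_def)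
  \<comment> \<open>The fields are chosen independently for each v; their compatibility is recovered
    afterwards from uniqueness.\<close>
  obtain V where V: "\<And>v. parallel_along g \<gamma> (V v)" "\<And>v. V v 0 = v" "\<And>v. V v 1 = A v"
    using \<gamma>(4) by metis
  define W where "W \<xi> t = \<phi> (\<gamma> t) (V (\<psi> x \<xi>) t)" for \<xi> t
  define q where "q t = Q (\<phi> (\<gamma> t) (vector_derivative \<gamma> (at t)))" for t
  have inv: "inv (\<phi> x) = \<psi> x"
    by (rule inv_equality) (simp_all add: inverse)
  have W0: "W \<xi> 0 = \<xi>" for \<xi>
    by (simp add: W_def ends V inverse)
  have W1: "W \<xi> 1 = (\<phi> x \<circ> A \<circ> inv (\<phi> x)) \<xi>" for \<xi>
    by (simp add: W_def ends V inv)
  have sol: "commutator_solution q (\<lambda>t. hform (W \<xi> t) (W \<zeta> t))" for \<xi> \<zeta>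
  proof -
    obtain S where S: "finite S" "continuous_on {0..1} (W \<xi>)"
      "\<And>t. t \<in> {0..1} - S \<Longrightarrow> (W \<xi> has_vector_derivative
         - L (\<phi> (\<gamma> t) (vector_derivative \<gamma> (at t))) (W \<xi> t)) (at t)"
      using parallel_frame[OF V(1) vp, of "\<psi> x \<xi>"] unfolding W_def by metis
    obtain S' where S': "finite S'" "continuous_on {0..1} (W \<zeta>)"
      "\<And>t. t \<in> {0..1} - S' \<Longrightarrow> (W \<zeta> has_vector_derivative
         - L (\<phi> (\<gamma> t) (vector_derivative \<gamma> (at t))) (W \<zeta> t)) (at t)"
      using parallel_frame[OF V(1) vp, of "\<psi> x \<zeta>"] unfolding W_def by metis
    show ?thesis
      unfolding commutator_solution_def
    proof (intro conjI exI[of _ "S \<union> S'"] ballI)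
      fix t assume t: "t \<in> {0..1} - (S \<union> S')"
      have e: "hform (W \<xi> t) (- L X (W \<zeta> t)) + hform (- L X (W \<xi> t)) (W \<zeta> t)
          = qmul (Q X) (hform (W \<xi> t) (W \<zeta> t)) - qmul (hform (W \<xi> t) (W \<zeta> t)) (Q X)" for X
        using hL[of X "W \<xi> t" "W \<zeta> t"]
        by (simp add: hform.minus_left hform.minus_right algebra_simps)
      show "((\<lambda>t. hform (W \<xi> t) (W \<zeta> t)) has_vector_derivative
          qmul (q t) (hform (W \<xi> t) (W \<zeta> t)) - qmul (hform (W \<xi> t) (W \<zeta> t)) (q t)) (at t)"
        using bounded_bilinear.has_vector_derivative[OF bounded_bilinear_hform S(3)[of t] S'(3)[of t]] t
        unfolding e q_def by simp
    qed (use S S' in \<open>auto intro: hform.continuous_on\<close>)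
  qed
  \<comment> \<open>Any one coordinate serves, hence the index \<open>undefined\<close>. The product
    of \<open>e qone\<close> with \<open>e p\<close> is p, so every quaternion is the initial value
    of a product of parallel fields.\<close>
  define e :: "quat \<Rightarrow> quat^'m" where "e p = axis undefined p" for p
  have he: "hform (e qone) (e p) = p" for p
    by (simp add: e_def hform_axis)
  define R where "R t p = hform (W (e qone) t) (W (e p) t)" for t p
  have R: "commutator_solution q (\<lambda>t. R t p)" "R 0 p = p" for p
    using sol by (simp_all add: R_def W0 he)
  define \<rho> where "\<rho> = R 1"
  have add: "\<rho> (p + p') = \<rho> p + \<rho> p'" for p p'
    unfolding \<rho>_def
    by (rule commutator_solution_unique[where f = "\<lambda>t. R t (p + p')" and q = q])
      (simp_all add: R commutator_solution_combine)
  have scale: "\<rho> (c *\<^sub>R p) = c *\<^sub>R \<rho> p" for c p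
    unfolding \<rho>_def
    by (rule commutator_solution_unique[where f = "\<lambda>t. R t (c *\<^sub>R p)" and q = q])
      (simp_all add: R commutator_solution_scaleR)
  have mul: "\<rho> (qmul p p') = qmul (\<rho> p) (\<rho> p')" for p p'
    unfolding \<rho>_def
    by (rule commutator_solution_unique[where f = "\<lambda>t. R t (qmul p p')" and q = q])
      (simp_all add: R commutator_solution_combine)
  have one: "\<rho> qone = qone"
    unfolding \<rho>_def
    by (rule commutator_solution_unique[where f = "\<lambda>t. R t qone" and q = q])
      (simp_all add: R commutator_solution_const)
  obtain r where r: "norm r = 1" "\<And>p. \<rho> p = qmul (qcnj r) (qmul p r)"
    using quat_automorphism_inner[of \<rho>, OF add scale one mul] by metis
  \<comment> \<open>The product of any two parallel fields solves the same equation as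
    \<open>R\<close> with initial quaternion \<open>hform \<xi> \<zeta>\<close>, so the one
    automorphism \<rho> governs all products.\<close>
  have "hform (W \<xi> 1) (W \<zeta> 1) = \<rho> (hform \<xi> \<zeta>)" for \<xi> \<zeta>
    unfolding \<rho>_def
    by (rule commutator_solution_unique[where f = "\<lambda>t. hform (W \<xi> t) (W \<zeta> t)" and q = q])
      (simp_all add: R sol W0)
  then show ?thesis
    using hform_preserving_SpSp1[OF r(1), of "\<phi> x \<circ> A \<circ> inv (\<phi> x)"] unfolding W1 r(2) by blast
qed

section \<open>The explicit frame and the Einstein equation\<close>

definition imq :: "real^3 \<Rightarrow> quat" where
  "imq z = vector [0, z$1, z$2, z$3]"

lemma imq_nth [simp]: "imq z $ 1 = 0" "imq z $ 2 = z$1" "imq z $ 3 = z$2" "imq z $ 4 = z$3"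
  by (simp_all add: imq_def vector_4)

lemma imq_linear: "imq (x + y) = imq x + imq y" "imq (c *\<^sub>R x) = c *\<^sub>R imq x"
  by (simp_all add: quat_eq_iff)

lemma bounded_linear_imq: "bounded_linear imq"
  unfolding linear_conv_bounded_linear[symmetric] by (intro linearI imq_linear)

lemma heis_omega_vec_nth:
  "heis_omega_vec u v $ 1 = (\<Sum>r\<in>UNIV. wedge (heis_e r 1) (heis_e r 2) 0 u v + wedge (heis_e r 3) (heis_e r 4) 0 u v)"
  "heis_omega_vec u v $ 2 = (\<Sum>r\<in>UNIV. wedge (heis_e r 1) (heis_e r 3) 0 u v + wedge (heis_e r 4) (heis_e r 2) 0 u v)"
  "heis_omega_vec u v $ 3 = (\<Sum>r\<in>UNIV. wedge (heis_e r 1) (heis_e r 4) 0 u v + wedge (heis_e r 2) (heis_e r 3) 0 u v)"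
  by (simp_all add: heis_omega_vec_def omega_def)

text \<open>The three forms are the imaginary part of the sum of u conj(v), up to sign. This sign is
  the reason why \<open>imq\<close> enters the frame with a minus sign.\<close>

lemma imq_heis_omega_vec:
  "imq (heis_omega_vec u v) = - qim (\<Sum>r\<in>UNIV. qmul (fst u $ r) (qcnj (fst v $ r)))"
  by (simp add: quat_eq_iff heis_omega_vec_nth wedge_def heis_e_def sum_negf[symmetric] algebra_simps)

interpretation heis_omega_vec: bounded_bilinear heis_omega_vec
  by (rule bounded_bilinear_heis_omega_vec)

lemma heis_omega_vec_commute: "heis_omega_vec u v = - heis_omega_vec v u"
  using omega_heis_e_antisym[of _ 0 u v] by (simp add: heis_omega_vec_def vec_eq_iff)

definition eta_vec :: "('n::finite) heis \<Rightarrow> 'n heis \<Rightarrow> real^3" where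
  "eta_vec x u = snd u + heis_omega_vec x u"

lemma eta_vec_nth: "eta_vec x u $ s = heis_eta s x u"
  by (simp add: eta_vec_def heis_eta_def heis_omega_vec_def)

text \<open>The conjugates turn the left-Hermitian form, of which the \<open>\<omega>\<^sub>s\<close> are the imaginary
  parts, into \<^const>\<open>hform\<close>, for which \<open>Sp(m)\<close> acts from the left as in \<^const>\<open>Sp\<close>.\<close>

definition qk_frame :: "real \<Rightarrow> ('n::finite) heis \<times> real \<Rightarrow> 'n heis \<times> real \<Rightarrow> quat^('n option)" where
  "qk_frame b p u = (\<chi> i. case i of
      Some r \<Rightarrow> exp (b * snd p) *\<^sub>R qcnj (fst (fst u) $ r)
    | None \<Rightarrow> snd u *\<^sub>R qone - (b * exp (2 * b * snd p)) *\<^sub>R imq (eta_vec (fst p) (fst u)))"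

definition qk_frame_inv :: "real \<Rightarrow> ('n::finite) heis \<times> real \<Rightarrow> quat^('n option) \<Rightarrow> 'n heis \<times> real" where
  "qk_frame_inv b p w =
     (let q = (\<chi> r. exp (- b * snd p) *\<^sub>R qcnj (w $ Some r));
          z = - (exp (- 2 * b * snd p) / b) *\<^sub>R vector [w $ None $ 2, w $ None $ 3, w $ None $ 4]
      in ((q, z - heis_omega_vec (fst p) (q, 0)), w $ None $ 1))"

text \<open>The derivative at p, in the direction t, of the frame applied to a constant vector u.
  Since \<open>eta_vec\<close> is affine in the base point, it contributes only the constant form
  evaluated at t and u.\<close>

definition qk_frame_deriv ::
    "real \<Rightarrow> ('n::finite) heis \<times> real \<Rightarrow> 'n heis \<times> real \<Rightarrow> 'n heis \<times> real \<Rightarrow> quat^('n option)" where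
  "qk_frame_deriv b p t u = (\<chi> i. case i of
      Some r \<Rightarrow> (b * snd t * exp (b * snd p)) *\<^sub>R qcnj (fst (fst u) $ r)
    | None \<Rightarrow> - (b * exp (2 * b * snd p)) *\<^sub>R
        imq ((2 * b * snd t) *\<^sub>R eta_vec (fst p) (fst u) + heis_omega_vec (fst t) (fst u)))"

text \<open>The derivative of \<open>qk_frame_deriv b p s u\<close> in the direction t; only the
  exponential factors are differentiated twice.\<close>

definition qk_frame_deriv2 ::
    "real \<Rightarrow> ('n::finite) heis \<times> real \<Rightarrow> 'n heis \<times> real \<Rightarrow> 'n heis \<times> real \<Rightarrow> 'n heis \<times> real
      \<Rightarrow> quat^('n option)" where
  "qk_frame_deriv2 b p t s u = (\<chi> i. case i of
      Some r \<Rightarrow> (b * snd t * b * snd s * exp (b * snd p)) *\<^sub>R qcnj (fst (fst u) $ r)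
    | None \<Rightarrow> - (b * exp (2 * b * snd p)) *\<^sub>R
        imq ((2 * b * snd t) *\<^sub>R ((2 * b * snd s) *\<^sub>R eta_vec (fst p) (fst u) + heis_omega_vec (fst s) (fst u))
          + (2 * b * snd s) *\<^sub>R heis_omega_vec (fst t) (fst u)))"

lemma qk_frame_nth [simp]:
  "qk_frame b p u $ Some r = exp (b * snd p) *\<^sub>R qcnj (fst (fst u) $ r)"
  "qk_frame b p u $ None = snd u *\<^sub>R qone - (b * exp (2 * b * snd p)) *\<^sub>R imq (eta_vec (fst p) (fst u))"
  by (simp_all add: qk_frame_def)

lemma eta_vec_linear:
  "eta_vec x (u + v) = eta_vec x u + eta_vec x v" "eta_vec x (c *\<^sub>R u) = c *\<^sub>R eta_vec x u"
  by (simp_all add: eta_vec_def heis_omega_vec.add_right heis_omega_vec.scaleR_right algebra_simps)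

lemma has_derivative_vec_nthI:
  fixes f :: "'a::euclidean_space \<Rightarrow> 'b::euclidean_space^'m"
  assumes "\<And>i. ((\<lambda>x. f x $ i) has_derivative (\<lambda>h. f' h $ i)) (at x within S)"
  shows "(f has_derivative f') (at x within S)"
proof (subst has_derivative_componentwise_within, rule ballI)
  fix e :: "'b^'m" assume "e \<in> Basis"
  then obtain i u where e: "e = axis i u" by (auto simp: Basis_vec_def)
  show "((\<lambda>x. f x \<bullet> e) has_derivative (\<lambda>h. f' h \<bullet> e)) (at x within S)"
    unfolding e inner_axis by (rule has_derivative_inner_left[OF assms])
qed

lemma has_derivative_exp_snd:
  "((\<lambda>y :: 'a::real_normed_vector \<times> real. exp (c * snd y)) has_derivative (\<lambda>h. c * snd h * exp (c * snd x))) (at x)"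
  by (auto intro!: derivative_eq_intros)

lemma has_derivative_eta_vec:
  "((\<lambda>y :: 'n::finite heis \<times> real. eta_vec (fst y) u) has_derivative (\<lambda>h. heis_omega_vec (fst h) u)) (at x)"
proof -
  have "bounded_linear (\<lambda>y :: 'n heis \<times> real. heis_omega_vec (fst y) u)"
    by (intro bounded_linear_compose[OF heis_omega_vec.bounded_linear_left bounded_linear_fst])
  from has_derivative_add[OF has_derivative_const bounded_linear_imp_has_derivative[OF this]]
  show ?thesis unfolding eta_vec_def by simp
qed

lemma heis_omega_vec_snd: "heis_omega_vec x (q, z) = heis_omega_vec x (q, 0)"
  unfolding heis_omega_vec_def by (subst omega_heis_e_snd(2)) (rule refl)

lemma hsome_qk_frame:
  "hsome (qk_frame b p u) (qk_frame b p v)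
     = exp (2 * b * snd p) *\<^sub>R (\<Sum>r\<in>UNIV. qmul (fst (fst u) $ r) (qcnj (fst (fst v) $ r)))"
proof -
  have "exp (2 * b * snd p) = exp (b * snd p) * exp (b * snd p)"
    by (simp add: mult_exp_exp)
  then show ?thesis
    by (simp add: hsome_def qcnj_linear qmul.scaleR_left qmul.scaleR_right scaleR_sum_right)
qed

lemma moving_frame_qk:
  fixes b :: real
  assumes b: "b \<noteq> 0"
  shows "moving_frame (qk_frame b :: 'n::finite heis \<times> real \<Rightarrow> _) (qk_frame_inv b)
     (qk_frame_deriv b) (qk_frame_deriv2 b) (\<lambda>x y. b *\<^sub>R qk_conn x y)"
proof (rule moving_frame.intro)
  fix x u v t :: "'n heis \<times> real" and w \<xi> \<zeta> \<zeta>' :: "quat^('n option)"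
  note lin = eta_vec_linear imq_linear qcnj_linear heis_omega_vec.add_right heis_omega_vec.scaleR_right
  show "linear (qk_frame b x)"
    by (intro linearI vec_option_eqI) (simp_all add: lin algebra_simps)
  show "linear (qk_frame_deriv b x u)"
    by (intro linearI vec_option_eqI) (simp_all add: qk_frame_deriv_def lin algebra_simps)
  show "qk_frame_inv b x (qk_frame b x v) = v"
  proof -
    have q: "(\<chi> r. exp (- b * snd x) *\<^sub>R qcnj (qk_frame b x v $ Some r)) = fst (fst v)"
      by (rule vec_eq_iff[THEN iffD2]) (simp add: qcnj_linear exp_minus)
    have om: "heis_omega_vec (fst x) (fst (fst v), 0) = heis_omega_vec (fst x) (fst v)"
      using heis_omega_vec_snd[of "fst x" "fst (fst v)" "snd (fst v)"] by simp
    have z: "- (exp (- 2 * b * snd x) / b) *\<^sub>R vector [qk_frame b x v $ None $ 2,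
        qk_frame b x v $ None $ 3, qk_frame b x v $ None $ 4] = eta_vec (fst x) (fst v)"
      using b by (simp add: vec_eq_iff forall_3 exp_minus)
    show ?thesis
      unfolding qk_frame_inv_def Let_def q z om by (simp add: eta_vec_def prod_eq_iff)
  qed
  show "qk_frame b x (qk_frame_inv b x w) = w"
  proof (rule vec_option_eqI)
    show "qk_frame b x (qk_frame_inv b x w) $ None = w $ None"
      using b by (simp add: qk_frame_inv_def Let_def eta_vec_def heis_omega_vec_snd[of _ _ "_ - _"]
          quat_eq_iff exp_minus)
    show "qk_frame b x (qk_frame_inv b x w) $ Some r = w $ Some r" for r
      by (simp add: qk_frame_inv_def Let_def qcnj_linear exp_minus)
  qed
  note imq = bounded_linear.has_derivative[OF bounded_linear_imq]
  show "((\<lambda>y. qk_frame b y v) has_derivative (\<lambda>u. qk_frame_deriv b x u v)) (at x)"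
  proof (rule has_derivative_vec_nthI)
    fix i
    have "((\<lambda>y. qk_frame b y v $ None) has_derivative (\<lambda>u. qk_frame_deriv b x u v $ None)) (at x)"
      unfolding qk_frame_nth
      by (rule has_derivative_eq_rhs, (rule has_derivative_diff has_derivative_const has_derivative_scaleR
            has_derivative_mult_right has_derivative_exp_snd imq has_derivative_eta_vec)+)
        (simp add: fun_eq_iff qk_frame_deriv_def imq_linear algebra_simps)
    moreover have "((\<lambda>y. qk_frame b y v $ Some r) has_derivative (\<lambda>u. qk_frame_deriv b x u v $ Some r)) (at x)" for r
      unfolding qk_frame_nth
      by (rule has_derivative_eq_rhs, rule has_derivative_scaleR_left, rule has_derivative_exp_snd)
        (simp add: fun_eq_iff qk_frame_deriv_def)
    ultimately show "((\<lambda>y. qk_frame b y v $ i) has_derivative (\<lambda>u. qk_frame_deriv b x u v $ i)) (at x)"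
      by (cases i) simp_all
  qed
  show "((\<lambda>y. qk_frame_deriv b y u v) has_derivative (\<lambda>t. qk_frame_deriv2 b x t u v)) (at x)"
  proof (rule has_derivative_vec_nthI)
    fix i
    have "((\<lambda>y. qk_frame_deriv b y u v $ None) has_derivative (\<lambda>t. qk_frame_deriv2 b x t u v $ None)) (at x)"
      unfolding qk_frame_deriv_def vec_lambda_beta option.case
      by (rule has_derivative_eq_rhs, (rule has_derivative_minus has_derivative_const has_derivative_scaleR
            has_derivative_scaleR_right has_derivative_add
            has_derivative_mult_right has_derivative_exp_snd imq has_derivative_eta_vec)+)
        (simp add: fun_eq_iff qk_frame_deriv2_def imq_linear algebra_simps)
    moreover have "((\<lambda>y. qk_frame_deriv b y u v $ Some r) has_derivative (\<lambda>t. qk_frame_deriv2 b x t u v $ Some r)) (at x)" for r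
      unfolding qk_frame_deriv_def vec_lambda_beta option.case
      by (rule has_derivative_eq_rhs, rule has_derivative_scaleR_left, rule has_derivative_mult_right,
          rule has_derivative_exp_snd)
        (simp add: fun_eq_iff qk_frame_deriv2_def algebra_simps)
    ultimately show "((\<lambda>y. qk_frame_deriv b y u v $ i) has_derivative (\<lambda>t. qk_frame_deriv2 b x t u v $ i)) (at x)"
      by (cases i) simp_all
  qed
  show "qk_frame_deriv2 b x t u v = qk_frame_deriv2 b x u t v"
    unfolding qk_frame_deriv2_def
    by (intro vec_option_eqI) (simp_all add: algebra_simps)
  show "(\<lambda>y. qk_frame_inv b y w) differentiable (at x)"
  proof -
    define Q :: "quat^'n" where "Q = (\<chi> r. qcnj (w $ Some r))"
    define z :: "real^3" where "z = - (1 / b) *\<^sub>R vector [w $ None $ 2, w $ None $ 3, w $ None $ 4]"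
    have e: "((exp c *\<^sub>R Q, 0) :: 'n heis) = exp c *\<^sub>R (Q, 0)" for c
      by simp
    \<comment> \<open>In this closed form the dependence on y is through exponentials in sigma times
      constant or linear terms.\<close>
    have "qk_frame_inv b y w = ((exp (- b * snd y) *\<^sub>R Q,
        exp (- 2 * b * snd y) *\<^sub>R z - exp (- b * snd y) *\<^sub>R heis_omega_vec (fst y) (Q, 0)), w $ None $ 1)" for y
    proof -
      have "(\<chi> r. exp (- b * snd y) *\<^sub>R qcnj (w $ Some r)) = exp (- b * snd y) *\<^sub>R Q"
        by (simp add: Q_def vec_eq_iff)
      then show ?thesis
        unfolding qk_frame_inv_def Let_def z_def by (simp only: e heis_omega_vec.scaleR_right) simp
    qed
    moreover have "bounded_linear (\<lambda>y :: 'n heis \<times> real. heis_omega_vec (fst y) (Q, 0))"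
      by (intro bounded_linear_compose[OF heis_omega_vec.bounded_linear_left bounded_linear_fst])
    note om = bounded_linear_imp_has_derivative[OF this]
    have "\<exists>D. ((\<lambda>y. ((exp (- b * snd y) *\<^sub>R Q,
        exp (- 2 * b * snd y) *\<^sub>R z - exp (- b * snd y) *\<^sub>R heis_omega_vec (fst y) (Q, 0)), w $ None $ 1))
        has_derivative D) (at x)"
      by (rule exI, (rule has_derivative_Pair has_derivative_const has_derivative_diff
            has_derivative_scaleR has_derivative_exp_snd om)+)
    ultimately show ?thesis
      unfolding differentiable_def by simp
  qed
  show "bounded_bilinear (\<lambda>x y :: quat^('n option). b *\<^sub>R qk_conn x y)"
    unfolding bilinear_conv_bounded_bilinear[symmetric] bilinear_def
    by (intro allI conjI linearI)
      (simp_all add: qk_conn.add_left qk_conn.add_right qk_conn.scaleR_left qk_conn.scaleR_right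
        scaleR_add_right)
  show "b *\<^sub>R qk_conn \<xi> \<zeta> \<bullet> \<zeta>' + \<zeta> \<bullet> b *\<^sub>R qk_conn \<xi> \<zeta>' = 0"
    using qk_conn_skew[of \<xi> \<zeta> \<zeta>'] by (simp add: distrib_left[symmetric])
  \<comment> \<open>The torsion axiom has its arguments in the order opposite to
    \<open>qk_conn_torsion\<close>, whence the factor -b.\<close>
  have T: "(b *\<^sub>R qk_conn y z - b *\<^sub>R qk_conn z y) $ i = (- b) *\<^sub>R ((qk_conn z y - qk_conn y z) $ i)"
    for y z :: "quat^('n option)" and i
    by (simp add: algebra_simps)
  show "qk_frame_deriv b x u v - qk_frame_deriv b x v u
      = b *\<^sub>R qk_conn (qk_frame b x v) (qk_frame b x u) - b *\<^sub>R qk_conn (qk_frame b x u) (qk_frame b x v)"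
  proof (rule vec_option_eqI; unfold T qk_conn_torsion hsome_qk_frame)
    \<comment> \<open>Turns the Hermitian product of the H^n-parts into the forms \<omega>, which
      come from the derivative of eta on the other side.\<close>
    have q: "qim (e *\<^sub>R (\<Sum>r\<in>UNIV. qmul (fst (fst u) $ r) (qcnj (fst (fst v) $ r))))
        = - e *\<^sub>R imq (heis_omega_vec (fst u) (fst v))" for e
      by (simp add: imq_heis_omega_vec quat_eq_iff)
    show "(qk_frame_deriv b x u v - qk_frame_deriv b x v u) $ None
       = (- b) *\<^sub>R 2 *\<^sub>R ((qk_frame b x v $ None $ 1) *\<^sub>R qim (qk_frame b x u $ None)
          - (qk_frame b x u $ None $ 1) *\<^sub>R qim (qk_frame b x v $ None)
          - qim (exp (2 * b * snd x) *\<^sub>R (\<Sum>r\<in>UNIV. qmul (fst (fst u) $ r) (qcnj (fst (fst v) $ r)))))"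
      unfolding q using heis_omega_vec_commute[of "fst v" "fst u"]
      by (simp add: qk_frame_deriv_def quat_eq_iff algebra_simps)
  qed (simp add: qk_frame_deriv_def algebra_simps)
qed

lemma qk_metric_eq: "qk_metric b p u v = qk_frame b p u \<bullet> qk_frame b p v"
proof -
  have e: "exp (2 * b * snd p) = exp (b * snd p) * exp (b * snd p)"
    "exp (4 * b * snd p) = exp (2 * b * snd p) * exp (2 * b * snd p)"
    by (simp_all add: mult_exp_exp)
  have 1: "exp (2 * b * snd p) * (\<Sum>k\<in>UNIV. heis_e r k (fst p) (fst u) * heis_e r k (fst p) (fst v))
      = qk_frame b p u $ Some r \<bullet> qk_frame b p v $ Some r" for r
    unfolding sum_4 e(1) by (simp add: quat_inner heis_e_def algebra_simps)
  have 2: "b\<^sup>2 * exp (4 * b * snd p) * (\<Sum>s\<in>UNIV. heis_eta s (fst p) (fst u) * heis_eta s (fst p) (fst v))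
      + dsigma p u * dsigma p v = qk_frame b p u $ None \<bullet> qk_frame b p v $ None"
    unfolding sum_3 e(2)
    by (simp add: quat_inner dsigma_def eta_vec_nth power2_eq_square algebra_simps)
  show ?thesis
    unfolding qk_metric_def inner_vec_def[of "qk_frame b p u"] sum_option 1[symmetric] 2[symmetric]
    by (simp add: sum_distrib_left)
qed

lemma qk_metric_frame:
  assumes "b \<noteq> 0"
  shows "qk_metric b = moving_frame.g (qk_frame b :: 'n::finite heis \<times> real \<Rightarrow> _)"
  by (intro ext) (simp only: qk_metric_eq moving_frame.g_def[OF moving_frame_qk[OF assms]])

lemma ricci_qk_metric:
  fixes p :: "'n::finite heis \<times> real"
  assumes b: "b \<noteq> 0"
  shows "ricci (qk_metric b) p u v = - 4 * (real CARD('n) + 3) * b\<^sup>2 * qk_metric b p u v"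
proof -
  interpret moving_frame "qk_frame b :: 'n heis \<times> real \<Rightarrow> _" "qk_frame_inv b"
    "qk_frame_deriv b" "qk_frame_deriv2 b" "\<lambda>x y. b *\<^sub>R qk_conn x y"
    by (rule moving_frame_qk[OF b])
  have "b *\<^sub>R qk_conn x (b *\<^sub>R qk_conn y z) - b *\<^sub>R qk_conn y (b *\<^sub>R qk_conn x z)
      - b *\<^sub>R qk_conn (b *\<^sub>R qk_conn x y - b *\<^sub>R qk_conn y x) z
     = b\<^sup>2 *\<^sub>R (rmul y (hform x z) - rmul x (hform y z) + rmul z (hform x y - hform y x))"
    for x y z :: "quat^('n option)"
    unfolding qk_conn_curvature[symmetric]
    by (simp add: qk_conn.scaleR_right qk_conn.scaleR_left qk_conn.diff_left power2_eq_square algebra_simps)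
  then show ?thesis
    unfolding qk_metric_frame[OF b] ricci_frame
    by (simp add: op_trace_scaleR op_trace_curvature g_def)
qed

section \<open>Riemannian distance and completeness\<close>

text \<open>An explicit velocity off a finite set. For reversed and joined curves it can be written
  down, while \<open>vector_derivative\<close> at a break point is an arbitrary value.\<close>

definition path_velocity :: "(real \<Rightarrow> 'a::euclidean_space) \<Rightarrow> (real \<Rightarrow> 'a) \<Rightarrow> real set \<Rightarrow> bool" where
  "path_velocity \<gamma> D S \<longleftrightarrow> finite S \<and> continuous_on {0..1} \<gamma> \<and>
     (\<forall>t\<in>{0..1} - S. (\<gamma> has_vector_derivative D t) (at t)) \<and>
     continuous_on ({0..1} - S) D \<and> bounded (D ` ({0..1} - S))"

lemma path_velocity_imp_admissible:
  assumes "path_velocity \<gamma> D S"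
  shows "admissible_path \<gamma>"
proof -
  have d: "vector_derivative \<gamma> (at t) = D t" if "t \<in> {0..1} - S" for t
    using assms that unfolding path_velocity_def by (metis vector_derivative_at)
  have v: "valid_path \<gamma>"
    unfolding valid_path_def piecewise_C1_differentiable_on_def C1_differentiable_on_def
    using assms unfolding path_velocity_def by blast
  have "(\<lambda>t. vector_derivative \<gamma> (at t)) ` {0..1}
      \<subseteq> D ` ({0..1} - S) \<union> (\<lambda>t. vector_derivative \<gamma> (at t)) ` S"
  proof (rule image_subsetI)
    fix t :: real assume "t \<in> {0..1}"
    then show "vector_derivative \<gamma> (at t) \<in> D ` ({0..1} - S) \<union> (\<lambda>t. vector_derivative \<gamma> (at t)) ` S"
      using d[of t] by (cases "t \<in> S") auto
  qed
  moreover have "bounded (D ` ({0..1} - S) \<union> (\<lambda>t. vector_derivative \<gamma> (at t)) ` S)"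
    using assms unfolding path_velocity_def by (simp add: finite_imp_bounded)
  ultimately show ?thesis
    unfolding admissible_path_def using v bounded_subset by blast
qed

lemma admissible_velocity:
  assumes "admissible_path \<gamma>"
  obtains S where "path_velocity \<gamma> (\<lambda>t. vector_derivative \<gamma> (at t)) S"
proof -
  obtain S where S: "finite S" "\<gamma> C1_differentiable_on ({0..1} - S)" "continuous_on {0..1} \<gamma>"
    using assms unfolding admissible_path_def valid_path_def piecewise_C1_differentiable_on_def by blast
  have "path_velocity \<gamma> (\<lambda>t. vector_derivative \<gamma> (at t)) S"
    unfolding path_velocity_def
    using S assms unfolding C1_differentiable_on_eq admissible_path_def
    by (auto simp: vector_derivative_works[symmetric] intro: bounded_subset)
  then show ?thesis by (rule that)
qed

text \<open>Off S the function is measurable and bounded on a set of finite measure; putting the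
  finite set back does not affect integrability.\<close>

lemma integrable_continuous_bounded_except_finite:
  fixes f :: "real \<Rightarrow> real"
  assumes S: "finite S" and f: "continuous_on ({a..b} - S) f" "bounded (f ` ({a..b} - S))"
  shows "f integrable_on {a..b}"
proof -
  define U where "U = {a..b} - S"
  have neg: "negligible S" using S by (rule negligible_finite)
  have U: "U \<in> lmeasurable"
    unfolding U_def using S by (intro fmeasurable_Diff) (auto simp: lmeasurable_interval negligible_imp_sets negligible_finite)
  have "f \<in> borel_measurable (lebesgue_on U)"
    using f(1) U unfolding U_def by (intro continuous_imp_measurable_on_sets_lebesgue) auto
  moreover obtain B where "\<And>x. x \<in> U \<Longrightarrow> norm (f x) \<le> B"
    using f(2) unfolding bounded_iff U_def by blast
  ultimately have "f integrable_on U"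
    using U by (intro measurable_bounded_by_integrable_imp_integrable[of f U "\<lambda>_. B"])
      (auto intro: integrable_on_const fmeasurableD)
  then show ?thesis
    by (rule integrable_spike_set) (auto simp: U_def intro: negligible_subset[OF neg])
qed

locale riemannian =
  fixes g :: "('a::euclidean_space) two_tensor"
  assumes metric: "riemannian_metric g"
begin

abbreviation speed :: "(real \<Rightarrow> 'a) \<Rightarrow> (real \<Rightarrow> 'a) \<Rightarrow> real \<Rightarrow> real" where
  "speed \<gamma> D t \<equiv> sqrt (g (\<gamma> t) (D t) (D t))"

lemma bilinear: "bilinear (g x)"
  using metric by (simp add: riemannian_metric_def)

lemma nonneg: "g x v v \<ge> 0"
proof (cases "v = 0")
  case True
  then show ?thesis using bilinear_lzero[OF bilinear] by simp
next
  case False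
  then show ?thesis using metric by (auto simp: riemannian_metric_def intro: less_imp_le)
qed

lemma expand: "g x u v = (\<Sum>i\<in>Basis. \<Sum>j\<in>Basis. (u \<bullet> i) * (v \<bullet> j) * g x i j)"
proof -
  have "g x u v = g x (\<Sum>i\<in>Basis. (u \<bullet> i) *\<^sub>R i) (\<Sum>j\<in>Basis. (v \<bullet> j) *\<^sub>R j)"
    by (simp add: euclidean_representation)
  then show ?thesis
    by (simp add: bilinear_sum[OF bilinear] bilinear_lmul[OF bilinear] bilinear_rmul[OF bilinear]
        sum.cartesian_product split_def mult_ac)
qed

lemma continuous_component: "continuous_on UNIV (\<lambda>x. g x u v)"
proof -
  have "Ck 0 (\<lambda>x. g x u v)" using metric unfolding riemannian_metric_def smooth_def by blast
  then show ?thesis by simp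
qed

lemma continuous_speed:
  assumes "continuous_on T \<gamma>" "continuous_on T D"
  shows "continuous_on T (speed \<gamma> D)"
  by (subst expand) (intro continuous_intros assms continuous_on_compose2[OF continuous_component] subset_UNIV)

lemma g_bound:
  assumes "compact K"
  shows "\<exists>C>0. \<forall>x\<in>K. \<forall>v. sqrt (g x v v) \<le> C * norm v"
proof -
  have "\<exists>B. \<forall>x\<in>K. \<bar>g x i j\<bar> \<le> B" for i j
    using compact_imp_bounded[OF compact_continuous_image[OF continuous_on_subset[OF continuous_component] assms]]
    unfolding bounded_iff by fastforce
  then obtain B where B: "\<And>x i j. x \<in> K \<Longrightarrow> \<bar>g x i j\<bar> \<le> B i j"
    by metis
  define C where "C = (\<Sum>i\<in>(Basis::'a set). \<Sum>j\<in>(Basis::'a set). \<bar>B i j\<bar>)"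
  have C0: "C \<ge> 0" unfolding C_def by (intro sum_nonneg) auto
  \<comment> \<open>The constant C + 1 spares a square root, because C is at most its square, and it
    is positive even if C = 0.\<close>
  have "sqrt (g x v v) \<le> (C + 1) * norm v" if x: "x \<in> K" for x v
  proof (rule real_le_lsqrt)
    have "g x v v \<le> (\<Sum>i\<in>Basis. \<Sum>j\<in>Basis. (norm v)\<^sup>2 * \<bar>B i j\<bar>)"
    proof (subst expand, intro sum_mono)
      fix i j :: 'a assume ij: "i \<in> Basis" "j \<in> Basis"
      have "\<bar>(v \<bullet> i) * (v \<bullet> j) * g x i j\<bar> \<le> (norm v * norm v) * \<bar>B i j\<bar>"
        unfolding abs_mult using B[OF x, of i j] Basis_le_norm[OF ij(1), of v] Basis_le_norm[OF ij(2), of v]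
        by (intro mult_mono) auto
      then show "(v \<bullet> i) * (v \<bullet> j) * g x i j \<le> (norm v)\<^sup>2 * \<bar>B i j\<bar>"
        by (simp add: power2_eq_square)
    qed
    also have "\<dots> = (norm v)\<^sup>2 * C" by (simp add: C_def sum_distrib_left)
    also have "\<dots> \<le> (norm v)\<^sup>2 * (C + 1)\<^sup>2"
      using C0 by (intro mult_left_mono) (auto simp: power2_eq_square algebra_simps)
    finally show "g x v v \<le> ((C + 1) * norm v)\<^sup>2" by (simp add: power_mult_distrib mult.commute)
  qed (use C0 in auto)
  then show ?thesis using C0 by (intro exI[of _ "C + 1"]) auto
qed

lemma speed_integrable:
  assumes "path_velocity \<gamma> D S"
  shows "speed \<gamma> D integrable_on {0..1}"
proof (rule integrable_continuous_bounded_except_finite)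
  have c: "continuous_on {0..1} \<gamma>" "continuous_on ({0..1} - S) D"
    using assms by (auto simp: path_velocity_def)
  show "finite S" using assms by (simp add: path_velocity_def)
  show "continuous_on ({0..1} - S) (speed \<gamma> D)"
    by (rule continuous_speed[OF continuous_on_subset[OF c(1)] c(2)]) auto
  obtain C where C: "C > 0" "\<And>x v. x \<in> \<gamma> ` {0..1} \<Longrightarrow> sqrt (g x v v) \<le> C * norm v"
    using g_bound[OF compact_continuous_image[OF c(1)]] by (meson compact_Icc)
  obtain B where B: "\<And>t. t \<in> {0..1} - S \<Longrightarrow> norm (D t) \<le> B"
    using assms unfolding path_velocity_def bounded_iff by blast
  have "norm (speed \<gamma> D t) \<le> C * B" if "t \<in> {0..1} - S" for t
  proof -
    have "speed \<gamma> D t \<le> C * norm (D t)" using C(2) that by blast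
    also have "\<dots> \<le> C * B" using B[OF that] C(1) by simp
    finally show ?thesis using nonneg by simp
  qed
  then show "bounded (speed \<gamma> D ` ({0..1} - S))" unfolding bounded_iff by blast
qed

lemma length_eq:
  assumes "path_velocity \<gamma> D S"
  shows "riemannian_length g \<gamma> = integral {0..1} (speed \<gamma> D)"
  unfolding riemannian_length_def
proof (rule integral_spike[of S])
  show "negligible S" using assms by (simp add: path_velocity_def negligible_finite)
  show "speed \<gamma> D t = sqrt (g (\<gamma> t) (vector_derivative \<gamma> (at t)) (vector_derivative \<gamma> (at t)))"
    if "t \<in> {0..1} - S" for t
    using assms that vector_derivative_at unfolding path_velocity_def by metis
qed

text \<open>Valid for arbitrary curves: \<open>integral\<close> takes the default value 0 if the
  speed is not integrable.\<close>

lemma length_nonneg: "riemannian_length g \<gamma> \<ge> 0"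
  unfolding riemannian_length_def
  by (cases "(\<lambda>t. sqrt (g (\<gamma> t) (vector_derivative \<gamma> (at t)) (vector_derivative \<gamma> (at t)))) integrable_on {0..1}")
    (auto intro!: integral_nonneg nonneg simp: not_integrable_integral)

abbreviation paths :: "'a \<Rightarrow> 'a \<Rightarrow> (real \<Rightarrow> 'a) set" where
  "paths x y \<equiv> {\<gamma>. admissible_path \<gamma> \<and> pathstart \<gamma> = x \<and> pathfinish \<gamma> = y}"

lemma linepath_velocity: "path_velocity (linepath x y) (\<lambda>t. y - x) {}"
  unfolding path_velocity_def
  by (simp add: has_vector_derivative_linepath_within continuous_on_linepath image_constant_conv)

lemma linepath_in_paths: "linepath x y \<in> paths x y"
  using path_velocity_imp_admissible[OF linepath_velocity] by simp

lemma bdd_below_lengths: "bdd_below (riemannian_length g ` A)"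
  by (rule bdd_belowI[of _ 0]) (auto simp: length_nonneg)

lemma dist_le: "\<gamma> \<in> paths x y \<Longrightarrow> riemannian_dist g x y \<le> riemannian_length g \<gamma>"
  unfolding riemannian_dist_def by (rule cINF_lower[OF bdd_below_lengths])

lemma dist_ge_0: "riemannian_dist g x y \<ge> 0"
  unfolding riemannian_dist_def using linepath_in_paths length_nonneg by (intro cINF_greatest) blast+

lemma dist_less_obtain_path:
  assumes "riemannian_dist g x y < r"
  obtains \<gamma> where "\<gamma> \<in> paths x y" "riemannian_length g \<gamma> < r"
  using assms linepath_in_paths[of x y] unfolding riemannian_dist_def
  by (subst (asm) cINF_less_iff[OF _ bdd_below_lengths]) blast+

lemma length_reversepath:
  assumes "\<gamma> \<in> paths x y"
  shows "reversepath \<gamma> \<in> paths y x" "riemannian_length g (reversepath \<gamma>) = riemannian_length g \<gamma>"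
proof -
  define D where "D t = vector_derivative \<gamma> (at t)" for t
  obtain S where S: "path_velocity \<gamma> D S"
    using assms admissible_velocity[of \<gamma>] unfolding D_def by blast
  have R: "path_velocity (reversepath \<gamma>) (\<lambda>t. - D (1 - t)) ((\<lambda>t. 1 - t) ` S)"
    unfolding path_velocity_def
  proof (intro conjI ballI)
    show "finite ((\<lambda>t. 1 - t) ` S)" using S by (simp add: path_velocity_def)
    show "continuous_on {0..1} (reversepath \<gamma>)"
      using S unfolding path_velocity_def reversepath_def
      by (auto intro!: continuous_on_compose2[of "{0..1}" \<gamma>] continuous_intros)
    have sub: "1 - t \<in> {0..1} - S" if "t \<in> {0..1} - (\<lambda>t. 1 - t) ` S" for t
      using that by (auto simp: image_iff)
    show "continuous_on ({0..1} - (\<lambda>t. 1 - t) ` S) (\<lambda>t. - D (1 - t))"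
      using S sub unfolding path_velocity_def
      by (auto intro!: continuous_on_compose2[of "{0..1} - S" D] continuous_intros)
    have "(\<lambda>t. - D (1 - t)) ` ({0..1} - (\<lambda>t. 1 - t) ` S) \<subseteq> uminus ` D ` ({0..1} - S)"
      using sub by blast
    moreover have "bounded (uminus ` D ` ({0..1} - S))"
      using S unfolding path_velocity_def by (simp add: bounded_uminus)
    ultimately show "bounded ((\<lambda>t. - D (1 - t)) ` ({0..1} - (\<lambda>t. 1 - t) ` S))"
      using bounded_subset by blast
    fix t assume "t \<in> {0..1} - (\<lambda>t. 1 - t) ` S"
    then have "(\<gamma> has_vector_derivative D (1 - t)) (at (1 - t))"
      using S sub unfolding path_velocity_def by blast
    moreover have "((\<lambda>t. 1 - t) has_vector_derivative (-1)) (at t)"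
      by (auto intro!: derivative_eq_intros)
    ultimately show "(reversepath \<gamma> has_vector_derivative - D (1 - t)) (at t)"
      using vector_diff_chain_at[of "\<lambda>t. 1 - t" "-1" t \<gamma>] by (simp add: reversepath_def o_def)
  qed
  show "reversepath \<gamma> \<in> paths y x"
    using assms path_velocity_imp_admissible[OF R] by simp
  have "(speed \<gamma> D has_integral riemannian_length g \<gamma>) {0..1}"
    unfolding length_eq[OF S] by (rule integrable_integral[OF speed_integrable[OF S]])
  from has_integral_affinity[OF this[folded cbox_interval], of "-1" 1]
  have "((\<lambda>t. speed \<gamma> D (1 - t)) has_integral riemannian_length g \<gamma>) {0..1}"
    by simp
  moreover have "speed (reversepath \<gamma>) (\<lambda>t. - D (1 - t)) = (\<lambda>t. speed \<gamma> D (1 - t))"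
    by (simp add: reversepath_def bilinear_lneg[OF bilinear] bilinear_rneg[OF bilinear])
  ultimately show "riemannian_length g (reversepath \<gamma>) = riemannian_length g \<gamma>"
    unfolding length_eq[OF R] by (simp add: integral_unique)
qed

lemma length_joinpaths:
  assumes "\<gamma> \<in> paths x y" "\<gamma>' \<in> paths y z"
  shows "\<gamma> +++ \<gamma>' \<in> paths x z"
    "riemannian_length g (\<gamma> +++ \<gamma>') = riemannian_length g \<gamma> + riemannian_length g \<gamma>'"
proof -
  define D where "D t = vector_derivative \<gamma> (at t)" for t
  define D' where "D' t = vector_derivative \<gamma>' (at t)" for t
  obtain S where S: "path_velocity \<gamma> D S"
    using assms(1) admissible_velocity[of \<gamma>] unfolding D_def by blast
  obtain S' where S': "path_velocity \<gamma>' D' S'"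
    using assms(2) admissible_velocity[of \<gamma>'] unfolding D'_def by blast
  define J where "J t = (if t \<le> 1/2 then 2 *\<^sub>R D (2 * t) else 2 *\<^sub>R D' (2 * t - 1))" for t
  \<comment> \<open>The midpoint is always exceptional, since the one-sided velocities there may
    differ; the remaining points are the rescaled break points of the two curves.\<close>
  define T where "T = {1/2} \<union> (\<lambda>t. t / 2) ` S \<union> (\<lambda>t. (t + 1) / 2) ` S'"
  have low: "2 * t \<in> {0..1} - S" if "t \<in> {0..1} - T" "t < 1/2" for t
  proof -
    have "t \<noteq> s / 2" if "s \<in> S" for s using \<open>t \<in> {0..1} - T\<close> that unfolding T_def by auto
    then have "2 * t \<notin> S" by force
    then show ?thesis using that by auto
  qed
  have high: "2 * t - 1 \<in> {0..1} - S'" if "t \<in> {0..1} - T" "t > 1/2" for t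
  proof -
    have "t \<noteq> (s + 1) / 2" if "s \<in> S'" for s using \<open>t \<in> {0..1} - T\<close> that unfolding T_def by auto
    then have "2 * t - 1 \<notin> S'" by force
    then show ?thesis using that by auto
  qed
  have T12: "t < 1/2 \<or> t > 1/2" if "t \<in> {0..1} - T" for t
    using that unfolding T_def by (auto simp: not_less less_le)
  have J: "path_velocity (\<gamma> +++ \<gamma>') J T"
    unfolding path_velocity_def
  proof (intro conjI ballI)
    show "finite T" using S S' by (simp add: path_velocity_def T_def)
    show "continuous_on {0..1} (\<gamma> +++ \<gamma>')"
      using S S' assms path_join_imp[of \<gamma> \<gamma>'] unfolding path_velocity_def path_def by auto
    have c: "continuous_on ({0..1} - S) D" "continuous_on ({0..1} - S') D'"
      using S S' by (auto simp: path_velocity_def)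
    show "continuous_on ({0..1} - T) J"
      unfolding J_def
    proof (rule continuous_on_cases_le)
      show "continuous_on {t \<in> {0..1} - T. t \<le> 1/2} (\<lambda>t. 2 *\<^sub>R D (2 * t))"
      proof (rule continuous_on_scaleR[OF continuous_on_const continuous_on_compose2[OF c(1)]])
        have "2 * t \<in> {0..1} - S" if "t \<in> {t \<in> {0..1} - T. t \<le> 1/2}" for t
          using low[of t] T12[of t] that by fastforce
        then show "(\<lambda>t. 2 * t) ` {t \<in> {0..1} - T. t \<le> 1/2} \<subseteq> {0..1} - S" by blast
      qed (intro continuous_intros)
      show "continuous_on {t \<in> {0..1} - T. 1/2 \<le> t} (\<lambda>t. 2 *\<^sub>R D' (2 * t - 1))"
      proof (rule continuous_on_scaleR[OF continuous_on_const continuous_on_compose2[OF c(2)]])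
        have "2 * t - 1 \<in> {0..1} - S'" if "t \<in> {t \<in> {0..1} - T. 1/2 \<le> t}" for t
          using high[of t] T12[of t] that by fastforce
        then show "(\<lambda>t. 2 * t - 1) ` {t \<in> {0..1} - T. 1/2 \<le> t} \<subseteq> {0..1} - S'" by blast
      qed (intro continuous_intros)
    qed (auto simp: T_def intro: continuous_intros)
    have "J t \<in> (*\<^sub>R) 2 ` (D ` ({0..1} - S) \<union> D' ` ({0..1} - S'))" if "t \<in> {0..1} - T" for t
      using T12[OF that] low[OF that] high[OF that] unfolding J_def by auto
    moreover have "bounded ((*\<^sub>R) 2 ` (D ` ({0..1} - S) \<union> D' ` ({0..1} - S')))"
      using S S' unfolding path_velocity_def by (intro bounded_scaling) simp
    ultimately show "bounded (J ` ({0..1} - T))"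
      by (meson bounded_subset image_subsetI)
    fix t assume t: "t \<in> {0..1} - T"
    from T12[OF t] show "(\<gamma> +++ \<gamma>' has_vector_derivative J t) (at t)"
    proof
      assume h: "t < 1/2"
      have "(\<gamma> has_vector_derivative D (2 * t)) (at (2 * t))"
        using S low[OF t h] unfolding path_velocity_def by blast
      moreover have "((\<lambda>t. 2 * t) has_vector_derivative 2) (at t)"
        by (auto intro!: derivative_eq_intros)
      ultimately have "((\<lambda>t. \<gamma> (2 * t)) has_vector_derivative J t) (at t)"
        using vector_diff_chain_at[of "\<lambda>t. 2 * t" 2 t \<gamma>] h by (simp add: J_def o_def)
      then show ?thesis
        by (rule has_vector_derivative_transform_within_open[of _ _ _ "{..<1/2}"])
          (use h in \<open>auto simp: joinpaths_def\<close>)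
    next
      assume h: "t > 1/2"
      have "(\<gamma>' has_vector_derivative D' (2 * t - 1)) (at (2 * t - 1))"
        using S' high[OF t h] unfolding path_velocity_def by blast
      moreover have "((\<lambda>t. 2 * t - 1) has_vector_derivative 2) (at t)"
        by (auto intro!: derivative_eq_intros)
      ultimately have "((\<lambda>t. \<gamma>' (2 * t - 1)) has_vector_derivative J t) (at t)"
        using vector_diff_chain_at[of "\<lambda>t. 2 * t - 1" 2 t \<gamma>'] h by (simp add: J_def o_def)
      then show ?thesis
        by (rule has_vector_derivative_transform_within_open[of _ _ _ "{1/2<..}"])
          (use h in \<open>auto simp: joinpaths_def\<close>)
    qed
  qed
  show "\<gamma> +++ \<gamma>' \<in> paths x z"
    using assms path_velocity_imp_admissible[OF J] by simp
  have sp: "sqrt (g p (2 *\<^sub>R v) (2 *\<^sub>R v)) = 2 * sqrt (g p v v)" for p v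
    by (simp add: bilinear_lmul[OF bilinear] bilinear_rmul[OF bilinear] real_sqrt_mult)
  have I: "(speed \<gamma> D has_integral riemannian_length g \<gamma>) (cbox 0 1)"
    unfolding length_eq[OF S] using integrable_integral[OF speed_integrable[OF S]] by simp
  have I': "(speed \<gamma>' D' has_integral riemannian_length g \<gamma>') (cbox 0 1)"
    unfolding length_eq[OF S'] using integrable_integral[OF speed_integrable[OF S']] by simp
  have "((\<lambda>t. speed \<gamma> D (2 * t)) has_integral riemannian_length g \<gamma> / 2) {0..1/2}"
    using has_integral_affinity[OF I, of 2 0] by (simp add: scaleR_conv_of_real)
  from has_integral_mult_right[OF this, of 2]
  have "((\<lambda>t. 2 * speed \<gamma> D (2 * t)) has_integral riemannian_length g \<gamma>) {0..1/2}"
    by simp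
  then have 1: "(speed (\<gamma> +++ \<gamma>') J has_integral riemannian_length g \<gamma>) {0..1/2}"
    by (rule has_integral_eq[rotated]) (simp add: joinpaths_def J_def sp)
  have "(\<lambda>x::real. x / 2 + 1 / 2) ` {0..1} = {1/2..1}"
    using image_affinity_atLeastAtMost[of "1/2" "1/2" 0 "1::real"] by simp
  then have "((\<lambda>t. speed \<gamma>' D' (2 * t - 1)) has_integral riemannian_length g \<gamma>' / 2) {1/2..1}"
    using has_integral_affinity[OF I', of 2 "-1"] by (simp add: scaleR_conv_of_real)
  from has_integral_mult_right[OF this, of 2]
  have "((\<lambda>t. 2 * speed \<gamma>' D' (2 * t - 1)) has_integral riemannian_length g \<gamma>') {1/2..1}"
    by simp
  \<comment> \<open>At t = 1/2 both \<open>joinpaths\<close> and \<open>J\<close> take the first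
    branch, so that point has to be removed from the second half.\<close>
  then have 2: "(speed (\<gamma> +++ \<gamma>') J has_integral riemannian_length g \<gamma>') {1/2..1}"
    by (rule has_integral_spike_finite[of "{1/2}", rotated 2]) (auto simp: joinpaths_def J_def sp)
  show "riemannian_length g (\<gamma> +++ \<gamma>') = riemannian_length g \<gamma> + riemannian_length g \<gamma>'"
    unfolding length_eq[OF J] by (rule integral_unique[OF has_integral_combine[OF _ _ 1 2]]) auto
qed

lemma dist_triangle_ineq: "riemannian_dist g x z \<le> riemannian_dist g x y + riemannian_dist g y z"
proof (rule field_le_epsilon)
  fix e :: real assume e: "e > 0"
  obtain \<gamma> where 1: "\<gamma> \<in> paths x y" "riemannian_length g \<gamma> < riemannian_dist g x y + e/2"
    using dist_less_obtain_path[of x y "riemannian_dist g x y + e/2"] e by auto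
  obtain \<gamma>' where 2: "\<gamma>' \<in> paths y z" "riemannian_length g \<gamma>' < riemannian_dist g y z + e/2"
    using dist_less_obtain_path[of y z "riemannian_dist g y z + e/2"] e by auto
  show "riemannian_dist g x z \<le> riemannian_dist g x y + riemannian_dist g y z + e"
    using dist_le[OF length_joinpaths(1)[OF 1(1) 2(1)]] length_joinpaths(2)[OF 1(1) 2(1)] 1(2) 2(2)
    by linarith
qed

lemma dist_sym: "riemannian_dist g x y = riemannian_dist g y x"
proof -
  have "riemannian_dist g x y \<le> riemannian_dist g y x" for x y
  proof (rule field_le_epsilon)
    fix e :: real assume e: "e > 0"
    obtain \<gamma> where 1: "\<gamma> \<in> paths y x" "riemannian_length g \<gamma> < riemannian_dist g y x + e"
      using dist_less_obtain_path[of y x "riemannian_dist g y x + e"] e by auto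
    show "riemannian_dist g x y \<le> riemannian_dist g y x + e"
      using dist_le[OF length_reversepath(1)[OF 1(1)]] length_reversepath(2)[OF 1(1)] 1(2) by linarith
  qed
  then show ?thesis by (blast intro: antisym)
qed

text \<open>Straight segments are the competing curves: convexity keeps them inside K, where
  compactness bounds the metric.\<close>

lemma dist_le_norm:
  assumes "compact K" "convex K"
  shows "\<exists>C>0. \<forall>x\<in>K. \<forall>y\<in>K. riemannian_dist g x y \<le> C * norm (y - x)"
proof -
  obtain C where C: "C > 0" "\<And>x v. x \<in> K \<Longrightarrow> sqrt (g x v v) \<le> C * norm v"
    using g_bound[OF assms(1)] by blast
  have "riemannian_dist g x y \<le> C * norm (y - x)" if "x \<in> K" "y \<in> K" for x y
  proof -
    have "integral {0..1} (speed (linepath x y) (\<lambda>t. y - x)) \<le> integral {0..1} (\<lambda>t::real. C * norm (y - x))"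
    proof (rule integral_le[OF speed_integrable[OF linepath_velocity]])
      fix t :: real assume "t \<in> {0..1}"
      then have "linepath x y t \<in> K"
        using assms(2) that linepath_in_path[of t x y] by (auto simp: convex_contains_segment)
      then show "speed (linepath x y) (\<lambda>t. y - x) t \<le> C * norm (y - x)" by (rule C(2))
    qed auto
    then show ?thesis
      using dist_le[OF linepath_in_paths, of x y] unfolding length_eq[OF linepath_velocity] by simp
  qed
  then show ?thesis using C(1) by blast
qed

text \<open>If short curves cannot escape a Euclidean neighbourhood of their starting point, at a rate
  uniform on bounded sets, then the metric topology and the Cauchy sequences are the Euclidean
  ones.\<close>

lemma complete_if_displacement_bounded:
  assumes disp: "\<And>K R. \<exists>C. \<forall>\<gamma>. admissible_path \<gamma> \<longrightarrow> norm (pathstart \<gamma>) \<le> K \<longrightarrow>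
      riemannian_length g \<gamma> \<le> R \<longrightarrow> norm (pathfinish \<gamma> - pathstart \<gamma>) \<le> C * riemannian_length g \<gamma>"
  shows "complete_riemannian g"
proof -
  have lower: "\<exists>C>0. \<forall>x y. norm x \<le> K \<longrightarrow> riemannian_dist g x y < R \<longrightarrow> norm (y - x) \<le> C * riemannian_dist g x y"
    for K R
  proof -
    obtain C where C: "\<And>\<gamma>. admissible_path \<gamma> \<Longrightarrow> norm (pathstart \<gamma>) \<le> K \<Longrightarrow>
      riemannian_length g \<gamma> \<le> R \<Longrightarrow> norm (pathfinish \<gamma> - pathstart \<gamma>) \<le> C * riemannian_length g \<gamma>"
      using disp[of K R] by blast
    \<comment> \<open>C may have any sign; \<open>\<bar>C\<bar> + 1\<close> is positive, so one can
      divide by it. The distance is an infimum that need not be attained, hence the detour through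
      every larger z.\<close>
    have "norm (y - x) \<le> (\<bar>C\<bar> + 1) * riemannian_dist g x y" if "norm x \<le> K" "riemannian_dist g x y < R" for x y
    proof (rule dense_ge)
      fix z assume z: "(\<bar>C\<bar> + 1) * riemannian_dist g x y < z"
      then have "riemannian_dist g x y < min R (z / (\<bar>C\<bar> + 1))"
        using that(2) by (simp add: pos_less_divide_eq mult.commute)
      then obtain \<gamma> where \<gamma>: "\<gamma> \<in> paths x y" "riemannian_length g \<gamma> < min R (z / (\<bar>C\<bar> + 1))"
        by (rule dist_less_obtain_path)
      have "norm (y - x) \<le> C * riemannian_length g \<gamma>"
        using C[of \<gamma>] \<gamma> that by auto
      also have "\<dots> \<le> (\<bar>C\<bar> + 1) * riemannian_length g \<gamma>"
        using length_nonneg[of \<gamma>] by (intro mult_right_mono) auto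
      also have "\<dots> \<le> z"
        using \<gamma>(2) by (simp add: pos_less_divide_eq mult.commute)
      finally show "norm (y - x) \<le> z" .
    qed
    then show ?thesis by (intro exI[of _ "\<bar>C\<bar> + 1"]) auto
  qed
  have zero: "riemannian_dist g x y = 0 \<longleftrightarrow> x = y" for x y
  proof
    assume 0: "riemannian_dist g x y = 0"
    obtain C where "\<forall>x' y. norm x' \<le> norm x \<longrightarrow> riemannian_dist g x' y < 1
        \<longrightarrow> norm (y - x') \<le> C * riemannian_dist g x' y"
      using lower[of "norm x" 1] by blast
    from this[rule_format, of x y] show "x = y" by (simp add: 0)
  next
    assume "x = y"
    moreover obtain C where "riemannian_dist g x x \<le> C * norm (x - x)"
      using dist_le_norm[of "{x}"] by auto
    ultimately show "riemannian_dist g x y = 0" using dist_ge_0[of x x] by simp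
  qed
  interpret M: Metric_space UNIV "riemannian_dist g"
    by unfold_locales (auto simp: dist_ge_0 zero dist_sym intro: dist_triangle_ineq)
  show ?thesis
    unfolding complete_riemannian_def M.mcomplete_def
  proof (intro allI impI)
    fix \<sigma> assume "M.MCauchy \<sigma>"
    then have cauchy: "\<exists>N. \<forall>m n. N \<le> m \<longrightarrow> N \<le> n \<longrightarrow> riemannian_dist g (\<sigma> m) (\<sigma> n) < e" if "e > 0" for e
      using that by (auto simp: M.MCauchy_def)
    obtain N where N: "\<And>m n. N \<le> m \<Longrightarrow> N \<le> n \<Longrightarrow> riemannian_dist g (\<sigma> m) (\<sigma> n) < 1"
      using cauchy[of 1] by auto
    obtain C where C: "C > 0" "\<And>y. riemannian_dist g (\<sigma> N) y < 1 \<Longrightarrow> norm (y - \<sigma> N) \<le> C * riemannian_dist g (\<sigma> N) y"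
      using lower[of "norm (\<sigma> N)" 1] by auto
    \<comment> \<open>The displacement bound is uniform only for starting points in a bounded set.
      The tail is therefore first confined to a ball around one of its members, and the bound is
      then applied on that ball.\<close>
    define K where "K = norm (\<sigma> N) + C"
    have K: "norm (\<sigma> n) \<le> K" if "n \<ge> N" for n
    proof -
      have "norm (\<sigma> n - \<sigma> N) \<le> C * riemannian_dist g (\<sigma> N) (\<sigma> n)" using C(2) N that by simp
      also have "\<dots> \<le> C * 1" using N[of N n] that C(1) by (intro mult_left_mono) auto
      finally show ?thesis unfolding K_def using norm_triangle_sub[of "\<sigma> n" "\<sigma> N"] by linarith
    qed
    obtain C' where C': "C' > 0" "\<And>x y. norm x \<le> K \<Longrightarrow> riemannian_dist g x y < 1 \<Longrightarrow>
        norm (y - x) \<le> C' * riemannian_dist g x y"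
      using lower[of K 1] by auto
    have "Cauchy \<sigma>"
    proof (rule metric_CauchyI)
      fix e :: real assume e: "e > 0"
      obtain N' where N': "\<And>m n. N' \<le> m \<Longrightarrow> N' \<le> n \<Longrightarrow> riemannian_dist g (\<sigma> m) (\<sigma> n) < e / C'"
        using cauchy[of "e / C'"] e C'(1) by auto
      show "\<exists>M. \<forall>m\<ge>M. \<forall>n\<ge>M. dist (\<sigma> m) (\<sigma> n) < e"
      proof (intro exI[of _ "max N N'"] allI impI)
        fix m n assume mn: "m \<ge> max N N'" "n \<ge> max N N'"
        have "dist (\<sigma> m) (\<sigma> n) \<le> C' * riemannian_dist g (\<sigma> m) (\<sigma> n)"
          using C'(2)[OF K[of m] N[of m n]] mn by (simp add: dist_norm norm_minus_commute)
        also have "\<dots> < e"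
          using N'[of m n] mn C'(1) by (simp add: pos_less_divide_eq mult.commute)
        finally show "dist (\<sigma> m) (\<sigma> n) < e" .
      qed
    qed
    then obtain l where l: "\<sigma> \<longlonglongrightarrow> l" using Cauchy_convergent_iff convergent_def by blast
    \<comment> \<open>Returning from Euclidean to Riemannian convergence needs the opposite
      comparison, and only near the limit.\<close>
    obtain C2 where C2: "C2 > 0" "\<And>x y. x \<in> cball l 1 \<Longrightarrow> y \<in> cball l 1 \<Longrightarrow>
        riemannian_dist g x y \<le> C2 * norm (y - x)"
      using dist_le_norm[OF compact_cball convex_cball, of l 1] by blast
    have "limitin M.mtopology \<sigma> l sequentially"
      unfolding M.limit_metric_sequentially
    proof (intro conjI allI impI UNIV_I)
      fix e :: real assume e: "e > 0"
      obtain N1 where N1: "\<And>n. n \<ge> N1 \<Longrightarrow> dist (\<sigma> n) l < min 1 (e / C2)"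
        using l e C2(1) unfolding LIMSEQ_def by (metis min_less_iff_conj zero_less_divide_iff zero_less_one)
      show "\<exists>N. \<forall>n\<ge>N. \<sigma> n \<in> UNIV \<and> riemannian_dist g (\<sigma> n) l < e"
      proof (intro exI[of _ N1] allI impI conjI UNIV_I)
        fix n assume n: "n \<ge> N1"
        have "riemannian_dist g (\<sigma> n) l \<le> C2 * norm (l - \<sigma> n)"
          using N1[OF n] by (intro C2(2)) (auto simp: dist_commute less_imp_le)
        also have "\<dots> < e"
          using N1[OF n] C2(1) by (simp add: pos_less_divide_eq mult.commute dist_norm norm_minus_commute)
        finally show "riemannian_dist g (\<sigma> n) l < e" .
      qed
    qed
    then show "\<exists>x. limitin M.mtopology \<sigma> x sequentially" by blast
  qed
qed

end

section \<open>The metric on the solvable extension\<close>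

text \<open>Needed in the product rule, where the factor that is not differentiated is required one
  order lower.\<close>

lemma Ck_Suc_imp: "Ck (Suc k) f \<Longrightarrow> Ck k f"
proof (induction k arbitrary: f)
  case 0
  then obtain f' where "\<forall>x. (f has_derivative f' x) (at x)" by auto
  then show ?case
    by (auto simp: continuous_on_eq_continuous_at intro: has_derivative_continuous)
next
  case (Suc k)
  have "\<exists>f'. (\<forall>x. (f has_derivative f' x) (at x)) \<and> (\<forall>v. Ck (Suc k) (\<lambda>x. f' x v))"
    using Suc.prems unfolding Ck.simps(2)[of "Suc k"] .
  then obtain f' where f': "(\<forall>x. (f has_derivative f' x) (at x)) \<and> (\<forall>v. Ck (Suc k) (\<lambda>x. f' x v))" ..
  have "\<forall>v. Ck k (\<lambda>x. f' x v)"
    using f'[THEN conjunct2] by (intro allI Suc.IH) (rule spec)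
  then show ?case
    unfolding Ck.simps(2)[of k] using f'[THEN conjunct1] by (intro exI[of _ f'] conjI)
qed

lemma Ck_bilinear:
  assumes h: "bounded_bilinear h"
  shows "Ck k f \<Longrightarrow> Ck k g \<Longrightarrow> Ck k (\<lambda>x. h (f x) (g x))"
proof (induction k arbitrary: f g)
  case 0
  then show ?case using bounded_bilinear.continuous_on[OF h] by simp
next
  case (Suc k)
  obtain f' where f: "\<forall>x. (f has_derivative f' x) (at x)" "\<forall>v. Ck k (\<lambda>x. f' x v)"
    using Suc.prems(1) by auto
  obtain g' where g: "\<forall>x. (g has_derivative g' x) (at x)" "\<forall>v. Ck k (\<lambda>x. g' x v)"
    using Suc.prems(2) by auto
  have "\<forall>x. ((\<lambda>x. h (f x) (g x)) has_derivative (\<lambda>v. h (f x) (g' x v) + h (f' x v) (g x))) (at x)"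
    by (rule allI, rule bounded_bilinear.FDERIV[OF h f(1)[rule_format] g(1)[rule_format]])
  moreover have "Ck k (\<lambda>x. h (f x) (g' x v) + h (f' x v) (g x))" for v
    by (rule Ck_add; rule Suc.IH; rule f(2)[rule_format] g(2)[rule_format] Suc.prems[THEN Ck_Suc_imp])
  ultimately show ?case
    by (simp only: Ck.simps) (rule exI[of _ "\<lambda>x v. h (f x) (g' x v) + h (f' x v) (g x)"], simp)
qed

lemmas Ck_scaleR = Ck_bilinear[OF bounded_bilinear_scaleR]
lemmas Ck_mult = Ck_bilinear[OF bounded_bilinear_mult]

lemma Ck_sum: "(\<And>i. i \<in> A \<Longrightarrow> Ck k (f i)) \<Longrightarrow> Ck k (\<lambda>x. \<Sum>i\<in>A. f i x)"
  by (induction A rule: infinite_finite_induct) (simp_all add: Ck_const Ck_add del: Ck.simps)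

lemma Ck_exp:
  assumes l: "bounded_linear l"
  shows "Ck k (\<lambda>x. exp (l x :: real))"
proof (induction k)
  case 0
  show ?case using linear_continuous_on[OF l] by (auto intro: continuous_intros)
next
  case (Suc k)
  have "\<forall>x. ((\<lambda>x. exp (l x)) has_derivative (\<lambda>v. exp (l x) * l v)) (at x)"
    using bounded_linear_imp_has_derivative[OF l] by (auto intro!: derivative_eq_intros)
  moreover have "Ck k (\<lambda>x. exp (l x) * l v)" for v
    by (rule Ck_mult[OF Suc Ck_const])
  ultimately show ?case
    by (simp only: Ck.simps) (rule exI[of _ "\<lambda>x v. exp (l x) * l v"], simp)
qed

lemma Ck_exp_snd: "Ck k (\<lambda>p :: 'a::euclidean_space \<times> real. exp (c * snd p))"
  by (rule Ck_exp) (intro bounded_linear_mult_right[THEN bounded_linear_compose] bounded_linear_snd)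

lemma Ck_heis_eta: "Ck k (\<lambda>p :: 'n::finite heis \<times> real. heis_eta s (fst p) v)"
proof -
  have "bounded_linear (\<lambda>x :: 'n heis. omega heis_e s 0 x v)"
    by (intro linear_conv_bounded_linear[THEN iffD1] linearI) (simp_all add: omega_heis_e_linear)
  then show ?thesis
    unfolding heis_eta_def
    by (intro Ck_add Ck_const Ck_bounded_linear bounded_linear_compose[OF _ bounded_linear_fst])
qed

lemma riemannian_metric_qk:
  assumes b: "b \<noteq> 0"
  shows "riemannian_metric (qk_metric b :: ('n::finite heis \<times> real) two_tensor)"
proof -
  interpret moving_frame "qk_frame b :: 'n heis \<times> real \<Rightarrow> _" "qk_frame_inv b"
    "qk_frame_deriv b" "qk_frame_deriv2 b" "\<lambda>x y. b *\<^sub>R qk_conn x y"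
    by (rule moving_frame_qk[OF b])
  have "Ck k (\<lambda>p :: 'n heis \<times> real. qk_metric b p v w)" for v w k
    unfolding qk_metric_def dsigma_def heis_e_def
    by (intro Ck_add Ck_mult Ck_sum Ck_const Ck_exp_snd Ck_heis_eta)
  moreover have "qk_metric b p v v > 0" if "v \<noteq> 0" for p v :: "'n heis \<times> real"
    using that frame_eq_iff[of p v 0] linear_0[OF linear, of p] by (simp add: qk_metric_eq)
  ultimately show ?thesis
    unfolding riemannian_metric_def smooth_def
    using bilinear_g unfolding qk_metric_frame[OF b] by (auto simp: g_def inner_commute)
qed

section \<open>Completeness\<close>

context riemannian
begin

text \<open>Integrates the velocity of one linear coordinate. The estimate holds at every time u,
  because bounding the next coordinate requires control along the whole curve and not just at its
  end.\<close>

lemma linear_displacement: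
  assumes v: "path_velocity \<gamma> D S" and h: "bounded_linear h" and M: "M \<ge> 0"
    and bound: "\<And>t. t \<in> {0..1} - S \<Longrightarrow> norm (h (D t)) \<le> M * speed \<gamma> D t"
    and u: "u \<in> {0..1}"
  shows "norm (h (\<gamma> u) - h (\<gamma> 0) :: 'b::euclidean_space) \<le> M * riemannian_length g \<gamma>"
proof -
  \<comment> \<open>On the exceptional set the velocity is replaced by 0, so that the bound by the
    speed holds at every point of the interval.\<close>
  define f where "f t = (if t \<in> S then 0 else h (D t))" for t
  have S: "finite S" "continuous_on {0..1} \<gamma>"
    "\<And>t. t \<in> {0..1} - S \<Longrightarrow> (\<gamma> has_vector_derivative D t) (at t)"
    using v by (auto simp: path_velocity_def)
  have "((\<lambda>t. h (D t)) has_integral h (\<gamma> u) - h (\<gamma> 0)) {0..u}"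
  proof (rule fundamental_theorem_of_calculus_interior_strong[OF S(1)])
    show "continuous_on {0..u} (\<lambda>t. h (\<gamma> t))"
      using u S(2) by (auto intro!: linear_continuous_on_compose[OF _ bounded_linear.linear[OF h]]
          intro: continuous_on_subset)
    show "((\<lambda>t. h (\<gamma> t)) has_vector_derivative h (D t)) (at t)" if "t \<in> {0<..<u} - S" for t
      using bounded_linear.has_vector_derivative[OF h S(3)] that u by auto
  qed (use u in auto)
  then have f: "(f has_integral h (\<gamma> u) - h (\<gamma> 0)) {0..u}"
    by (rule has_integral_spike_finite[OF S(1), rotated]) (simp add: f_def)
  have s: "(\<lambda>t. M * speed \<gamma> D t) integrable_on {0..1}"
    by (rule integrable_on_mult_right[OF speed_integrable[OF v]])
  have su: "(\<lambda>t. M * speed \<gamma> D t) integrable_on {0..u}"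
    by (rule integrable_on_subinterval[OF s]) (use u in auto)
  have "norm (integral {0..u} f) \<le> integral {0..u} (\<lambda>t. M * speed \<gamma> D t)"
    by (rule integral_norm_bound_integral[OF _ su]) (use f bound u M nonneg in \<open>auto simp: f_def\<close>)
  also have "\<dots> \<le> integral {0..1} (\<lambda>t. M * speed \<gamma> D t)"
    by (rule integral_subset_le[OF _ su s]) (use u M nonneg in auto)
  also have "\<dots> = M * riemannian_length g \<gamma>"
    by (simp add: length_eq[OF v])
  finally show ?thesis
    by (simp only: integral_unique[OF f])
qed

end

lemma qk_frame_component_bounds:
  fixes p u :: "'n::finite heis \<times> real"
  shows "\<bar>snd u\<bar> \<le> sqrt (qk_metric b p u u)"
    and "exp (b * snd p) * norm (fst (fst u)) \<le> sqrt (qk_metric b p u u)"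
    and "\<bar>b\<bar> * exp (2 * b * snd p) * norm (eta_vec (fst p) (fst u)) \<le> sqrt (qk_metric b p u u)"
proof -
  have s: "(exp (b * snd p))\<^sup>2 = exp (2 * b * snd p)" "(exp (2 * b * snd p))\<^sup>2 = exp (4 * b * snd p)"
    by (simp_all add: power2_eq_square mult_exp_exp)
  have 1: "(\<Sum>r\<in>UNIV. \<Sum>k\<in>UNIV. heis_e r k (fst p) (fst u) * heis_e r k (fst p) (fst u))
      = (norm (fst (fst u)))\<^sup>2"
    by (simp add: heis_e_def power2_norm_eq_inner inner_vec_def)
  have 2: "(\<Sum>s\<in>UNIV. heis_eta s (fst p) (fst u) * heis_eta s (fst p) (fst u))
      = (norm (eta_vec (fst p) (fst u)))\<^sup>2"
    by (simp add: eta_vec_nth[symmetric] power2_norm_eq_inner inner_vec_def)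
  have g: "qk_metric b p u u = (exp (b * snd p) * norm (fst (fst u)))\<^sup>2
      + (\<bar>b\<bar> * exp (2 * b * snd p) * norm (eta_vec (fst p) (fst u)))\<^sup>2 + (snd u)\<^sup>2"
    unfolding qk_metric_def 1 2 power_mult_distrib s dsigma_def by (simp add: power2_eq_square)
  show "\<bar>snd u\<bar> \<le> sqrt (qk_metric b p u u)"
    and "exp (b * snd p) * norm (fst (fst u)) \<le> sqrt (qk_metric b p u u)"
    and "\<bar>b\<bar> * exp (2 * b * snd p) * norm (eta_vec (fst p) (fst u)) \<le> sqrt (qk_metric b p u u)"
    unfolding g by (rule real_le_rsqrt; simp)+
qed

lemma complete_qk:
  assumes b: "b \<noteq> 0"
  shows "complete_riemannian (qk_metric b :: ('n::finite heis \<times> real) two_tensor)"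
proof -
  interpret riemannian "qk_metric b :: ('n heis \<times> real) two_tensor"
    by unfold_locales (rule riemannian_metric_qk[OF b])
  obtain c where c: "c > 0" "\<And>x y :: 'n heis. norm (heis_omega_vec x y) \<le> norm x * norm y * c"
    using heis_omega_vec.pos_bounded by blast
  \<comment> \<open>The forms ignore the central coordinate, so the bound involves only the
    H^n-components, for which estimates are available first.\<close>
  have om: "norm (heis_omega_vec x y) \<le> norm (fst x) * norm (fst y) * c" for x y :: "'n heis"
  proof -
    have "heis_omega_vec x y = heis_omega_vec (fst x, 0) (fst y, 0)"
      by (metis heis_omega_vec_commute heis_omega_vec_snd prod.collapse)
    then show ?thesis using c(2)[of "(fst x, 0)" "(fst y, 0)"] by simp
  qed
  show ?thesis
  proof (rule complete_if_displacement_bounded)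
    fix K R :: real
    \<comment> \<open>A curve of length at most R starting within K has sigma bounded by
      \<open>\<bar>K\<bar> + \<bar>R\<bar>\<close>, so E dominates the inverse of the weight exp(b
      sigma) along it.\<close>
    define E where "E = exp (\<bar>b\<bar> * (\<bar>K\<bar> + \<bar>R\<bar>))"
    \<comment> \<open>From dz = eta - \<omega>(q, dq): the first summand inverts the weight
      \<open>\<bar>b\<bar>\<close> exp(2b sigma) of eta, the second multiplies the bounds for q, for
      its velocity and for \<omega>.\<close>
    define M where "M = E * E / \<bar>b\<bar> + (\<bar>K\<bar> + E * \<bar>R\<bar>) * E * c"
    have E: "E > 0" and M: "M \<ge> 0"
      using c(1) by (auto simp: E_def M_def)
    have "norm (pathfinish \<gamma> - pathstart \<gamma>) \<le> (1 + E + M) * riemannian_length (qk_metric b) \<gamma>"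
      if \<gamma>: "admissible_path \<gamma>" "norm (pathstart \<gamma>) \<le> K" "riemannian_length (qk_metric b) \<gamma> \<le> R"
      for \<gamma> :: "real \<Rightarrow> 'n heis \<times> real"
    proof -
      define l where "l = riemannian_length (qk_metric b) \<gamma>"
      define D where "D t = vector_derivative \<gamma> (at t)" for t
      obtain S where S: "path_velocity \<gamma> D S"
        using admissible_velocity[OF \<gamma>(1)] unfolding D_def by blast
      have l: "0 \<le> l" "l \<le> \<bar>R\<bar>" using length_nonneg \<gamma>(3) by (auto simp: l_def)
      have start: "\<bar>snd (\<gamma> 0)\<bar> \<le> \<bar>K\<bar>" "norm (fst (fst (\<gamma> 0))) \<le> \<bar>K\<bar>"
        using \<gamma>(2) norm_snd_le[where x = "fst (\<gamma> 0)" and y = "snd (\<gamma> 0)"]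
          norm_fst_le[where x = "fst (\<gamma> 0)" and y = "snd (\<gamma> 0)"]
          norm_fst_le[where x = "fst (fst (\<gamma> 0))" and y = "snd (fst (\<gamma> 0))"]
        unfolding prod.collapse pathstart_def real_norm_def by linarith+
      have 1: "\<bar>snd (\<gamma> t) - snd (\<gamma> 0)\<bar> \<le> 1 * l" if "t \<in> {0..1}" for t
        unfolding l_def real_norm_def[symmetric]
        by (rule linear_displacement[OF S bounded_linear_snd _ _ that])
          (simp_all add: qk_frame_component_bounds(1))
      have sig: "\<bar>snd (\<gamma> t)\<bar> \<le> \<bar>K\<bar> + \<bar>R\<bar>" if "t \<in> {0..1}" for t
        using 1[OF that] start(1) l by linarith
      have e: "1 \<le> E * exp (b * snd (\<gamma> t))" if "t \<in> {0..1}" for t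
      proof -
        have "\<bar>b * snd (\<gamma> t)\<bar> \<le> \<bar>b\<bar> * (\<bar>K\<bar> + \<bar>R\<bar>)"
          unfolding abs_mult using sig[OF that] by (intro mult_left_mono) auto
        then show ?thesis unfolding E_def mult_exp_exp by simp
      qed
      have le: "X \<le> F * Y" if "e * X \<le> Y" "1 \<le> F * e" "X \<ge> 0" "F \<ge> 0" for e X Y F :: real
      proof -
        have "1 * X \<le> F * e * X" using that by (intro mult_right_mono) auto
        also have "\<dots> = F * (e * X)" by simp
        also have "\<dots> \<le> F * Y" using that by (intro mult_left_mono) auto
        finally show ?thesis by simp
      qed
      have q': "norm (fst (fst (D t))) \<le> E * sqrt (qk_metric b (\<gamma> t) (D t) (D t))" if "t \<in> {0..1}" for t
        using le[OF qk_frame_component_bounds(2) e[OF that]] E by auto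
      have 2: "norm (fst (fst (\<gamma> t)) - fst (fst (\<gamma> 0))) \<le> E * l" if "t \<in> {0..1}" for t
        unfolding l_def
        by (rule linear_displacement[OF S bounded_linear_compose[OF bounded_linear_fst bounded_linear_fst] _ _ that])
          (use q' E in auto)
      have q: "norm (fst (fst (\<gamma> t))) \<le> \<bar>K\<bar> + E * \<bar>R\<bar>" if "t \<in> {0..1}" for t
      proof -
        have "E * l \<le> E * \<bar>R\<bar>" using l E by simp
        then show ?thesis
          using 2[OF that] start(2) norm_triangle_sub[of "fst (fst (\<gamma> t))" "fst (fst (\<gamma> 0))"] by linarith
      qed
      have z': "norm (snd (fst (D t))) \<le> M * sqrt (qk_metric b (\<gamma> t) (D t) (D t))" if t: "t \<in> {0..1}" for t
      proof -
        define s where "s = sqrt (qk_metric b (\<gamma> t) (D t) (D t))"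
        have "exp (2 * b * snd (\<gamma> t)) = exp (b * snd (\<gamma> t)) * exp (b * snd (\<gamma> t))"
          by (simp add: mult_exp_exp)
        then have "1 \<le> E * E * exp (2 * b * snd (\<gamma> t))"
          using mult_mono[OF e[OF t] e[OF t]] E by (simp add: algebra_simps)
        then have "1 \<le> E * E / \<bar>b\<bar> * (\<bar>b\<bar> * exp (2 * b * snd (\<gamma> t)))"
          using b by simp
        from le[OF qk_frame_component_bounds(3) this]
        have eta: "norm (eta_vec (fst (\<gamma> t)) (fst (D t))) \<le> E * E / \<bar>b\<bar> * s"
          unfolding s_def by simp
        have "norm (heis_omega_vec (fst (\<gamma> t)) (fst (D t)))
            \<le> norm (fst (fst (\<gamma> t))) * norm (fst (fst (D t))) * c" by (rule om)
        also have "\<dots> \<le> (\<bar>K\<bar> + E * \<bar>R\<bar>) * (E * s) * c"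
          using q[OF t] q'[OF t] c(1) E unfolding s_def
          by (intro mult_right_mono mult_mono) auto
        finally have "norm (heis_omega_vec (fst (\<gamma> t)) (fst (D t))) \<le> (\<bar>K\<bar> + E * \<bar>R\<bar>) * (E * s) * c" .
        moreover have "snd (fst (D t)) = eta_vec (fst (\<gamma> t)) (fst (D t)) - heis_omega_vec (fst (\<gamma> t)) (fst (D t))"
          by (simp add: eta_vec_def)
        ultimately have "norm (snd (fst (D t))) \<le> E * E / \<bar>b\<bar> * s + (\<bar>K\<bar> + E * \<bar>R\<bar>) * (E * s) * c"
          using eta norm_triangle_ineq4[of "eta_vec (fst (\<gamma> t)) (fst (D t))" "heis_omega_vec (fst (\<gamma> t)) (fst (D t))"]
          by simp
        also have "\<dots> = M * s" by (simp add: M_def algebra_simps)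
        finally show ?thesis unfolding s_def .
      qed
      have 3: "norm (snd (fst (\<gamma> 1)) - snd (fst (\<gamma> 0))) \<le> M * l"
        unfolding l_def
        by (rule linear_displacement[OF S bounded_linear_compose[OF bounded_linear_snd bounded_linear_fst]])
          (use z' M in auto)
      have "norm (\<gamma> 1 - \<gamma> 0) \<le> norm (fst (\<gamma> 1 - \<gamma> 0)) + norm (snd (\<gamma> 1 - \<gamma> 0))"
        using norm_Pair_le[of "fst (\<gamma> 1 - \<gamma> 0)" "snd (\<gamma> 1 - \<gamma> 0)"] unfolding prod.collapse .
      moreover have "norm (fst (\<gamma> 1 - \<gamma> 0)) \<le> norm (fst (fst (\<gamma> 1 - \<gamma> 0))) + norm (snd (fst (\<gamma> 1 - \<gamma> 0)))"
        using norm_Pair_le[of "fst (fst (\<gamma> 1 - \<gamma> 0))" "snd (fst (\<gamma> 1 - \<gamma> 0))"]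
        unfolding prod.collapse .
      ultimately have "norm (\<gamma> 1 - \<gamma> 0) \<le> 1 * l + E * l + M * l"
        using 1[of 1] 2[of 1] 3 by simp
      then show ?thesis
        unfolding l_def by (simp add: pathstart_def pathfinish_def algebra_simps)
    qed
    then show "\<exists>C. \<forall>\<gamma> :: real \<Rightarrow> 'n heis \<times> real. admissible_path \<gamma> \<longrightarrow> norm (pathstart \<gamma>) \<le> K \<longrightarrow>
      riemannian_length (qk_metric b) \<gamma> \<le> R \<longrightarrow>
      norm (pathfinish \<gamma> - pathstart \<gamma>) \<le> C * riemannian_length (qk_metric b) \<gamma>" by blast
  qed
qed

text \<open>The frame at p is itself the isometry with H^(n+1); the commutator equation is driven by
  b times the imaginary part of the \<open>None\<close>-component of the velocity.\<close>

lemma quaternionic_kaehler_qk: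
  assumes b: "b \<noteq> 0"
  shows "quaternionic_kaehler TYPE('n::finite option) (qk_metric b :: ('n heis \<times> real) two_tensor)"
proof -
  interpret moving_frame "qk_frame b :: 'n heis \<times> real \<Rightarrow> _" "qk_frame_inv b"
    "qk_frame_deriv b" "qk_frame_deriv2 b" "\<lambda>x y. b *\<^sub>R qk_conn x y"
    by (rule moving_frame_qk[OF b])
  have h: "hform (b *\<^sub>R qk_conn x a) c + hform a (b *\<^sub>R qk_conn x c)
     = qmul (hform a c) (b *\<^sub>R qim (x $ None)) - qmul (b *\<^sub>R qim (x $ None)) (hform a c)"
    for x a c :: "quat^('n option)"
    using arg_cong[OF hform_qk_conn[of x a c], of "\<lambda>q. b *\<^sub>R q"]
    by (simp add: hform.scaleR_left hform.scaleR_right qmul.scaleR_left qmul.scaleR_right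
        scaleR_add_right scaleR_diff_right)
  have "linear (qk_frame b p)" "bij (qk_frame b p)" "qk_frame b p v \<bullet> qk_frame b p w = qk_metric b p v w"
    "\<And>A. A \<in> holonomy (qk_metric b) p \<Longrightarrow> qk_frame b p \<circ> A \<circ> inv (qk_frame b p) \<in> SpSp1"
    for p v w :: "'n heis \<times> real"
    using linear holonomy_frame[OF moving_frame_qk[OF b] h, of _ p]
    by (auto simp: qk_metric_eq qk_metric_frame[OF b, symmetric] intro!: o_bij[of "qk_frame_inv b p"] simp: inverse fun_eq_iff)
  then show ?thesis
    unfolding quaternionic_kaehler_def using riemannian_metric_qk[OF b] by blast
qed

section \<open>Structure equations and the Lie algebra\<close>

lemma e_tilde_structure:
  "ext_deriv (e_tilde b r k) p u v = - b * wedge (e_tilde b r k) dsigma p u v"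
proof -
  have "((\<lambda>y. e_tilde b r k y w) has_derivative (\<lambda>h. b * snd h * exp (b * snd p) * fst (fst w) $ r $ k)) (at p)"
    for w :: "'a heis \<times> real"
    unfolding e_tilde_def heis_e_def by (rule has_derivative_mult_left[OF has_derivative_exp_snd])
  note D = fun_cong[OF frechet_derivative_at[OF this, symmetric]]
  show ?thesis
    unfolding ext_deriv_def D by (simp add: wedge_def dsigma_def e_tilde_def heis_e_def algebra_simps)
qed

lemma omega_e_tilde: "omega (e_tilde b) s p u v = exp (2 * b * snd p) * heis_omega_vec (fst u) (fst v) $ s"
proof -
  have e: "exp (2 * b * snd p) = exp (b * snd p) * exp (b * snd p)"
    by (simp add: mult_exp_exp)
  have "wedge (e_tilde b r j) (e_tilde b r' k) p u v
      = exp (2 * b * snd p) * wedge (heis_e r j) (heis_e r' k) 0 (fst u) (fst v)" for r r' j k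
    unfolding e by (simp add: wedge_def e_tilde_def heis_e_def algebra_simps)
  then show ?thesis
    by (simp add: heis_omega_vec_def omega_def sum_distrib_left distrib_left)
qed

lemma eta_tilde_eq: "eta_tilde b s p u = exp (2 * b * snd p) * eta_vec (fst p) (fst u) $ s"
  by (simp add: eta_tilde_def eta_vec_nth)

lemma eta_tilde_structure:
  "ext_deriv (eta_tilde b s) p u v
     = 2 * omega (e_tilde b) s p u v - 2 * b * wedge (eta_tilde b s) dsigma p u v"
proof -
  have "((\<lambda>y. eta_tilde b s y w) has_derivative (\<lambda>h. exp (2 * b * snd p) * heis_omega_vec (fst h) (fst w) $ s
      + (2 * b * snd h * exp (2 * b * snd p)) * eta_vec (fst p) (fst w) $ s)) (at p)"
    for w :: "'a heis \<times> real"
    unfolding eta_tilde_eq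
    by (intro has_derivative_mult has_derivative_exp_snd
        bounded_linear.has_derivative[OF bounded_linear_vec_nth has_derivative_eta_vec])
  note D = fun_cong[OF frechet_derivative_at[OF this, symmetric]]
  show ?thesis
    unfolding ext_deriv_def D omega_e_tilde using heis_omega_vec_commute[of "fst v" "fst u"]
    by (simp add: wedge_def dsigma_def eta_tilde_eq algebra_simps)
qed

lemma coframe_tilde: "coframe (tilde_coframe b :: _ \<Rightarrow> ('n::finite heis \<times> real) one_form)"
  unfolding coframe_def
proof (intro conjI allI)
  fix i :: "('n \<times> 4 + 3) option"
  have 1: "smooth_one_form (dsigma :: ('n heis \<times> real) one_form)"
    unfolding smooth_one_form_def smooth_def dsigma_def by (auto intro!: linearI Ck_const)
  have 2: "smooth_one_form (e_tilde b r k :: ('n heis \<times> real) one_form)" for r k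
    unfolding smooth_one_form_def smooth_def e_tilde_def heis_e_def
    by (intro conjI allI linearI Ck_mult Ck_const Ck_exp_snd) (simp_all add: algebra_simps)
  have l: "linear (eta_tilde b s p)" for s and p :: "'n heis \<times> real"
    by (intro linearI) (simp_all add: eta_tilde_eq eta_vec_linear algebra_simps)
  have 3: "smooth_one_form (eta_tilde b s :: ('n heis \<times> real) one_form)" for s
    unfolding smooth_one_form_def smooth_def using l
    by (simp add: eta_tilde_def[abs_def] Ck_mult Ck_heis_eta Ck_exp_snd del: Ck.simps)
  show "smooth_one_form (tilde_coframe b i :: ('n heis \<times> real) one_form)"
    using 1 2 3 by (auto simp: tilde_coframe_def split: sum.splits prod.splits option.splits)
next
  fix p :: "'n heis \<times> real" and c :: "('n \<times> 4 + 3) option \<Rightarrow> real"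
  \<comment> \<open>Dividing out the exponential weights reduces the duality condition to the one
    already known for \<open>heis_coframe\<close>.\<close>
  define a where "a i = (case i of Inl _ \<Rightarrow> exp (- b * snd p) | Inr _ \<Rightarrow> exp (- 2 * b * snd p)) * c (Some i)" for i
  have eq: "(\<forall>i. tilde_coframe b i p v = c i) \<longleftrightarrow> (\<forall>i. heis_coframe i (fst p) (fst v) = a i) \<and> snd v = c None" for v
  proof -
    have x: "exp y * t = r \<longleftrightarrow> t = exp (- y) * r" for y t r :: real
      by (auto simp: exp_minus field_simps)
    have "tilde_coframe b (Some i) p v = c (Some i) \<longleftrightarrow> heis_coframe i (fst p) (fst v) = a i" for i
      by (cases i) (auto simp: tilde_coframe_def heis_coframe_def a_def e_tilde_def eta_tilde_def x)
    moreover have "tilde_coframe b None p v = snd v" by (simp add: tilde_coframe_def dsigma_def)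
    ultimately show ?thesis by (metis not_Some_eq)
  qed
  have "\<exists>!w. \<forall>i. heis_coframe i (fst p) w = a i"
    using coframe_heis unfolding coframe_def by blast
  then obtain w where w: "\<forall>i. heis_coframe i (fst p) w = a i"
    "\<forall>w'. (\<forall>i. heis_coframe i (fst p) w' = a i) \<longrightarrow> w' = w"
    by (rule ex1E) blast
  show "\<exists>!v. \<forall>i. tilde_coframe b i p v = c i"
    unfolding eq
  proof (rule ex1I[of _ "(w, c None)"])
    show "(\<forall>i. heis_coframe i (fst p) (fst (w, c None)) = a i) \<and> snd (w, c None) = c None"
      using w(1) by simp
    show "v = (w, c None)" if "(\<forall>i. heis_coframe i (fst p) (fst v) = a i) \<and> snd v = c None" for v
      using that w(2)[rule_format, of "fst v"] by (cases v) simp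
  qed
qed

text \<open>Trades structure constants for a bracket on the tangent space at 0, where the Jacobi
  identity carries no indices. The last hypothesis is the Maurer-Cartan equation: u' and v' are the
  vectors at 0 with the same coframe coordinates as u and v at x.\<close>

lemma defines_lie_algebra_bracket:
  fixes \<theta> :: "'i::finite \<Rightarrow> ('a::euclidean_space) one_form"
  assumes \<theta>: "coframe \<theta>" and B: "bounded_bilinear B" and anti: "\<And>u v. B u v = - B v u"
    and jacobi: "\<And>u v w. B (B u v) w + B (B v w) u + B (B w u) v = 0"
    and struct: "\<And>k x u v u' v'. (\<And>i. \<theta> i 0 u' = \<theta> i x u) \<Longrightarrow> (\<And>i. \<theta> i 0 v' = \<theta> i x v) \<Longrightarrow>
      ext_deriv (\<theta> k) x u v = - \<theta> k 0 (B u' v')"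
  shows "defines_lie_algebra \<theta>"
proof -
  interpret B: bounded_bilinear B by fact
  have lin: "linear (\<theta> k x)" for k x
    using \<theta> by (auto simp: coframe_def smooth_one_form_def)
  have "\<exists>v. \<forall>i. \<theta> i 0 v = c i" for c using \<theta> unfolding coframe_def by metis
  then have "\<forall>j. \<exists>v. \<forall>i. \<theta> i 0 v = (if i = j then 1 else 0)"
    by (intro allI)
  then obtain E where E: "\<And>i j. \<theta> i 0 (E j) = (if i = j then 1 else 0)" by metis
  have inj: "u = v" if "\<And>i. \<theta> i 0 u = \<theta> i 0 v" for u v
  proof -
    have "\<exists>!w. \<forall>i. \<theta> i 0 w = \<theta> i 0 v"
      using \<theta>[unfolded coframe_def, THEN conjunct2, rule_format, of 0 "\<lambda>i. \<theta> i 0 v"] .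
    then show ?thesis using that by blast
  qed
  have expand: "u = (\<Sum>i\<in>UNIV. \<theta> i 0 u *\<^sub>R E i)" for u
    by (rule inj) (simp add: linear_sum[OF lin] linear_scale[OF lin] E if_distrib[of "\<lambda>x. _ * x"] cong: if_cong)
  define c where "c i j k = \<theta> k 0 (B (E i) (E j))" for i j k
  have c2: "(\<Sum>m\<in>UNIV. c i j m * c m k l) = \<theta> l 0 (B (B (E i) (E j)) (E k))" for i j k l
    by (subst (2) expand)
      (simp add: B.sum_left B.scaleR_left linear_sum[OF lin] linear_scale[OF lin] c_def)
  have "lie_structure_constants c"
    unfolding lie_structure_constants_def
  proof (intro conjI allI)
    show "c i j k = - c j i k" for i j k
      unfolding c_def by (subst anti) (simp add: linear_neg[OF lin])
    show "(\<Sum>m\<in>UNIV. c i j m * c m k l + c j k m * c m i l + c k i m * c m j l) = 0" for i j k l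
      unfolding sum.distrib c2 linear_add[OF lin, symmetric] jacobi by (rule linear_0[OF lin])
  qed
  moreover have "ext_deriv (\<theta> k) x u v
      = - (1/2) * (\<Sum>i\<in>UNIV. \<Sum>j\<in>UNIV. c i j k * wedge (\<theta> i) (\<theta> j) x u v)" for k x u v
  proof -
    define t where "t u = (\<Sum>i\<in>UNIV. \<theta> i x u *\<^sub>R E i)" for u
    have t: "\<theta> i 0 (t u) = \<theta> i x u" for i u
      by (simp add: t_def linear_sum[OF lin] linear_scale[OF lin] E if_distrib[of "\<lambda>x. _ * x"] cong: if_cong)
    have s: "(\<Sum>i\<in>UNIV. \<Sum>j\<in>UNIV. c i j k * (\<theta> i x u * \<theta> j x v)) = \<theta> k 0 (B (t u) (t v))" for u v
      by (simp add: t_def B.sum_left B.sum_right B.scaleR_left B.scaleR_right linear_sum[OF lin]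
          linear_scale[OF lin] c_def scaleR_sum_right)
        (subst sum.swap, simp add: mult_ac)
    have "(\<Sum>i\<in>UNIV. \<Sum>j\<in>UNIV. c i j k * wedge (\<theta> i) (\<theta> j) x u v)
        = \<theta> k 0 (B (t u) (t v)) - \<theta> k 0 (B (t v) (t u))"
      unfolding s[symmetric] sum_subtractf[symmetric] by (simp add: wedge_def algebra_simps)
    \<comment> \<open>Each bracket is counted twice over ordered pairs, which the factor 1/2
      undoes.\<close>
    also have "\<dots> = 2 * \<theta> k 0 (B (t u) (t v))"
      by (subst (2) anti) (simp add: linear_neg[OF lin])
    finally show ?thesis
      using struct[of "t u" x u "t v" v k] t by simp
  qed
  ultimately show ?thesis
    unfolding defines_lie_algebra_def using \<theta> by blast
qed

lemma heis_omega_vec_cong: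
  assumes "fst x = fst x'" "fst y = fst y'"
  shows "heis_omega_vec x y = heis_omega_vec x' y'"
  using assms by (auto simp: vec_eq_iff heis_omega_vec_def omega_def wedge_def heis_e_def)

text \<open>Read off from the structure equations through d\<theta>(u, v) = -\<theta>([u, v]) at 0,
  where the coframe consists of the standard coordinates.\<close>

definition qk_bracket :: "real \<Rightarrow> ('n::finite) heis \<times> real \<Rightarrow> 'n heis \<times> real \<Rightarrow> 'n heis \<times> real" where
  "qk_bracket b u v =
     ((b *\<^sub>R (snd v *\<^sub>R fst (fst u) - snd u *\<^sub>R fst (fst v)),
       - 2 *\<^sub>R heis_omega_vec (fst u) (fst v)
         + (2 * b) *\<^sub>R (snd v *\<^sub>R snd (fst u) - snd u *\<^sub>R snd (fst v))), 0)"

lemma defines_lie_algebra_tilde: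
  "defines_lie_algebra (tilde_coframe b :: _ \<Rightarrow> ('n::finite heis \<times> real) one_form)"
proof (rule defines_lie_algebra_bracket[OF coframe_tilde])
  note om = heis_omega_vec.add_left heis_omega_vec.add_right heis_omega_vec.scaleR_left
    heis_omega_vec.scaleR_right heis_omega_vec.diff_left
  show "bounded_bilinear (qk_bracket b :: 'n heis \<times> real \<Rightarrow> _)"
    unfolding bilinear_conv_bounded_bilinear[symmetric] bilinear_def qk_bracket_def
    by (intro allI conjI linearI) (simp_all add: om algebra_simps)
  fix u v w :: "'n heis \<times> real"
  show "qk_bracket b u v = - qk_bracket b v u"
    unfolding qk_bracket_def using heis_omega_vec_commute[of "fst u" "fst v"]
    by (simp add: algebra_simps)
  have o: "heis_omega_vec (b *\<^sub>R (s *\<^sub>R fst x - t *\<^sub>R fst y), Z) w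
      = b *\<^sub>R (s *\<^sub>R heis_omega_vec x w - t *\<^sub>R heis_omega_vec y w)" for x y w :: "'n heis" and s t Z
  proof -
    have "heis_omega_vec (b *\<^sub>R (s *\<^sub>R fst x - t *\<^sub>R fst y), Z) w
      = heis_omega_vec (b *\<^sub>R (s *\<^sub>R x - t *\<^sub>R y)) w"
      by (rule heis_omega_vec_cong) simp_all
    then show ?thesis by (simp add: om)
  qed
  \<comment> \<open>The identity expresses that the sigma-direction acts by a derivation: the weight
    2b on the centre is the sum of the weights b of the two arguments of \<omega>.\<close>
  show "qk_bracket b (qk_bracket b u v) w + qk_bracket b (qk_bracket b v w) u
      + qk_bracket b (qk_bracket b w u) v = 0"
    unfolding qk_bracket_def fst_conv snd_conv o
    using heis_omega_vec_commute[of "fst v" "fst u"] heis_omega_vec_commute[of "fst w" "fst v"]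
      heis_omega_vec_commute[of "fst u" "fst w"]
    by (simp add: prod_eq_iff vec_eq_iff algebra_simps)
next
  fix k :: "('n \<times> 4 + 3) option" and x u v u' v' :: "'n heis \<times> real"
  \<comment> \<open>At 0 the exponentials are 1 and the \<omega>-term of eta vanishes, so equal
    coframe values determine the coordinates of u'.\<close>
  have *: "snd u' = snd u \<and> fst (fst u') = exp (b * snd x) *\<^sub>R fst (fst u)
      \<and> snd (fst u') = exp (2 * b * snd x) *\<^sub>R eta_vec (fst x) (fst u)"
    if "\<And>i. tilde_coframe b i 0 u' = tilde_coframe b i x u" for u u' :: "'n heis \<times> real"
    using that[of None] that[of "Some (Inl _)"] that[of "Some (Inr _)"]
    by (auto simp: tilde_coframe_def dsigma_def e_tilde_def heis_e_def eta_tilde_eq vec_eq_iff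
        eta_vec_def heis_omega_vec.zero_left split: prod.splits)
  assume "\<And>i. tilde_coframe b i 0 u' = tilde_coframe b i x u"
    and "\<And>i. tilde_coframe b i 0 v' = tilde_coframe b i x v"
  from *[OF this(1)] *[OF this(2)]
  have u: "snd u' = snd u" "fst (fst u') = exp (b * snd x) *\<^sub>R fst (fst u)"
      "snd (fst u') = exp (2 * b * snd x) *\<^sub>R eta_vec (fst x) (fst u)"
    and v: "snd v' = snd v" "fst (fst v') = exp (b * snd x) *\<^sub>R fst (fst v)"
      "snd (fst v') = exp (2 * b * snd x) *\<^sub>R eta_vec (fst x) (fst v)" by auto
  have "heis_omega_vec (fst u') (fst v')
      = heis_omega_vec (exp (b * snd x) *\<^sub>R fst u) (exp (b * snd x) *\<^sub>R fst v)"
    by (rule heis_omega_vec_cong) (simp_all add: u v)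
  also have "\<dots> = exp (2 * b * snd x) *\<^sub>R heis_omega_vec (fst u) (fst v)"
    by (simp add: heis_omega_vec.scaleR_left heis_omega_vec.scaleR_right mult_exp_exp)
  finally have om: "heis_omega_vec (fst u') (fst v') = exp (2 * b * snd x) *\<^sub>R heis_omega_vec (fst u) (fst v)" .
  have d: "ext_deriv dsigma x u v = 0"
    by (simp add: ext_deriv_def dsigma_def)
  consider "k = None" | r j where "k = Some (Inl (r, j))" | s where "k = Some (Inr s)"
    by (metis not_None_eq sum.exhaust surj_pair)
  then show "ext_deriv (tilde_coframe b k) x u v = - tilde_coframe b k 0 (qk_bracket b u' v')"
  proof cases
    case 1
    then show ?thesis using d by (simp add: tilde_coframe_def dsigma_def[of 0] qk_bracket_def)
  next
    case 2
    then show ?thesis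
      by (simp add: tilde_coframe_def e_tilde_structure wedge_def)
        (simp add: e_tilde_def heis_e_def dsigma_def qk_bracket_def u v algebra_simps)
  next
    case 3
    then show ?thesis
      by (simp add: tilde_coframe_def eta_tilde_structure omega_e_tilde wedge_def)
        (simp add: eta_tilde_eq eta_vec_def[of 0] heis_omega_vec.zero_left dsigma_def qk_bracket_def u v om
          algebra_simps)
  qed
qed

section \<open>The solvable group and left invariance\<close>

definition heis_dil :: "real \<Rightarrow> ('n::finite) heis \<Rightarrow> 'n heis" where
  "heis_dil c x = (c *\<^sub>R fst x, c\<^sup>2 *\<^sub>R snd x)"

text \<open>The semidirect product of G(H) with R acting by dilations. The factor exp(-b sigma) is
  the one that cancels the growth of exp(b sigma) in \<open>e_tilde\<close> under left
  translation.\<close>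

definition qk_mult :: "real \<Rightarrow> ('n::finite) heis \<times> real \<Rightarrow> 'n heis \<times> real \<Rightarrow> 'n heis \<times> real" where
  "qk_mult b x y = (heis_mult (fst x) (heis_dil (exp (- b * snd x)) (fst y)), snd x + snd y)"

definition qk_inv :: "real \<Rightarrow> ('n::finite) heis \<times> real \<Rightarrow> 'n heis \<times> real" where
  "qk_inv b x = (heis_dil (exp (b * snd x)) (heis_inv (fst x)), - snd x)"

lemma heis_mult_eq: "heis_mult x y = (fst x + fst y, snd x + snd y - heis_omega_vec x y)"
  by (simp add: heis_mult_def heis_omega_vec_def)

lemma heis_omega_vec_dil:
  "heis_omega_vec (heis_dil c x) y = c *\<^sub>R heis_omega_vec x y"
  "heis_omega_vec y (heis_dil c x) = c *\<^sub>R heis_omega_vec y x"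
proof -
  have "heis_omega_vec (heis_dil c x) y = heis_omega_vec (c *\<^sub>R x) y"
    "heis_omega_vec y (heis_dil c x) = heis_omega_vec y (c *\<^sub>R x)"
    by (rule heis_omega_vec_cong; simp add: heis_dil_def)+
  then show "heis_omega_vec (heis_dil c x) y = c *\<^sub>R heis_omega_vec x y"
    "heis_omega_vec y (heis_dil c x) = c *\<^sub>R heis_omega_vec y x"
    by (simp_all add: heis_omega_vec.scaleR_left heis_omega_vec.scaleR_right)
qed

text \<open>The central weight is the square of the other because \<omega> scales quadratically;
  this makes dilations automorphisms.\<close>

lemma heis_dil_mult: "heis_dil c (heis_mult x y) = heis_mult (heis_dil c x) (heis_dil c y)"
  unfolding heis_mult_eq heis_omega_vec_dil
  by (simp add: heis_dil_def scaleR_add_right scaleR_diff_right power2_eq_square)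

lemma heis_dil_dil: "heis_dil c (heis_dil d x) = heis_dil (c * d) x" "heis_dil 1 x = x"
  by (simp_all add: heis_dil_def power_mult_distrib)

lemma group_qk: "group (qk_mult b) (0 :: 'n::finite heis \<times> real) (qk_inv b)"
proof -
  interpret H: group heis_mult "0 :: 'n heis" heis_inv
    by (rule lie_group_heis[unfolded lie_group_def, THEN conjunct1])
  show ?thesis
  proof
    fix x y z :: "'n heis \<times> real"
    show "qk_mult b (qk_mult b x y) z = qk_mult b x (qk_mult b y z)"
      by (simp add: qk_mult_def heis_dil_mult heis_dil_dil H.assoc mult_exp_exp algebra_simps)
    show "qk_mult b 0 x = x"
      by (simp add: qk_mult_def heis_dil_dil prod_eq_iff)
    show "qk_mult b (qk_inv b x) x = 0"
      by (simp add: qk_mult_def qk_inv_def heis_dil_mult[symmetric] prod_eq_iff) (simp add: heis_dil_def)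
  qed
qed

lemma lie_group_qk: "lie_group (qk_mult b) (0 :: 'n::finite heis \<times> real) (qk_inv b)"
  unfolding lie_group_def smooth_def
proof (intro conjI allI group_qk)
  fix k
  have c: "exp (- 2 * b * s) = (exp (- b * s))\<^sup>2" "exp (2 * b * s) = (exp (b * s))\<^sup>2" for s :: real
    by (simp_all add: power2_eq_square mult_exp_exp)
  \<comment> \<open>Separates the product into linear, exponential and bilinear factors, each
    covered by the calculus of \<open>Ck\<close>.\<close>
  have eq: "qk_mult b x y = (x + ((0, 0), snd y)) + exp (- b * snd x) *\<^sub>R ((fst (fst y), 0), 0)
      + exp (- 2 * b * snd x) *\<^sub>R ((0, snd (fst y)), 0)
      + exp (- b * snd x) *\<^sub>R ((0, - heis_omega_vec (fst x) (fst y)), 0)" for x y :: "'n heis \<times> real"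
    unfolding qk_mult_def heis_mult_eq heis_omega_vec_dil c by (simp add: heis_dil_def prod_eq_iff)
  have bl: "bounded_bilinear (\<lambda>(x :: 'n heis \<times> real) (y :: 'n heis \<times> real). ((0 :: quat^'n, - heis_omega_vec (fst x) (fst y)), 0 :: real))"
    unfolding bilinear_conv_bounded_bilinear[symmetric] bilinear_def
    by (intro allI conjI linearI)
      (simp_all add: heis_omega_vec.add_left heis_omega_vec.add_right heis_omega_vec.scaleR_left
        heis_omega_vec.scaleR_right)
  have e: "Ck k (\<lambda>p :: ('n heis \<times> real) \<times> ('n heis \<times> real). exp (c * snd (fst p)))" for c
    by (rule Ck_exp) (intro bounded_linear_mult_right[THEN bounded_linear_compose]
        bounded_linear_compose[OF bounded_linear_snd bounded_linear_fst])
  note l = bounded_linear_compose[OF bounded_linear_fst] bounded_linear_compose[OF bounded_linear_snd]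
    bounded_linear_fst bounded_linear_snd
  show "Ck k (\<lambda>p :: ('n heis \<times> real) \<times> ('n heis \<times> real). qk_mult b (fst p) (snd p))"
    unfolding eq
    by (intro Ck_add Ck_scaleR e Ck_bilinear[OF bl] Ck_bounded_linear bounded_linear_Pair bounded_linear_add
        bounded_linear_zero l)
  have eq: "qk_inv b x = exp (b * snd x) *\<^sub>R ((- fst (fst x), 0), 0)
      + exp (2 * b * snd x) *\<^sub>R ((0, - snd (fst x)), 0) + ((0, 0), - snd x)" for x :: "'n heis \<times> real"
    unfolding qk_inv_def c by (simp add: heis_dil_def heis_inv_def prod_eq_iff)
  show "Ck k (qk_inv b :: 'n heis \<times> real \<Rightarrow> _)"
    unfolding eq[abs_def]
    by (intro Ck_add Ck_scaleR Ck_exp_snd Ck_bounded_linear bounded_linear_Pair bounded_linear_minus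
        bounded_linear_zero l)
qed

text \<open>Left translations are affine in these coordinates, so their linear part is the
  derivative at every point.\<close>

lemma qk_mult_has_derivative:
  fixes a x :: "'n::finite heis \<times> real"
  shows "(qk_mult b a has_derivative (\<lambda>v. (heis_dil (exp (- b * snd a)) (fst v)
      - (0, exp (- b * snd a) *\<^sub>R heis_omega_vec (fst a) (fst v)), snd v))) (at x)" (is "(_ has_derivative ?D) _")
proof -
  have "bounded_linear ?D"
    unfolding linear_conv_bounded_linear[symmetric]
    by (intro linearI) (simp_all add: heis_dil_def prod_eq_iff heis_omega_vec.add_right
        heis_omega_vec.scaleR_right algebra_simps)
  from has_derivative_add[OF has_derivative_const bounded_linear_imp_has_derivative[OF this]]
  have "((\<lambda>x. a + ?D x) has_derivative ?D) (at x)" by simp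
  moreover have "qk_mult b a = (\<lambda>x. a + ?D x)"
    by (intro ext) (simp add: qk_mult_def heis_mult_eq heis_omega_vec_dil, simp add: heis_dil_def prod_eq_iff)
  ultimately show ?thesis by simp
qed

lemma left_invariant_tilde:
  "left_invariant_form (qk_mult b) (tilde_coframe b i :: ('n::finite heis \<times> real) one_form)"
  unfolding left_invariant_form_def
proof (intro allI)
  fix a x v :: "'n heis \<times> real"
  define c where "c = exp (- b * snd a)"
  define w where "w = frechet_derivative (qk_mult b a) (at x) v"
  have w: "w = (heis_dil c (fst v) - (0, c *\<^sub>R heis_omega_vec (fst a) (fst v)), snd v)"
    unfolding w_def c_def frechet_derivative_at[OF qk_mult_has_derivative, symmetric] ..
  have e: "exp (b * (snd a + snd x)) * c = exp (b * snd x)" "exp (2 * b * (snd a + snd x)) * c\<^sup>2 = exp (2 * b * snd x)"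
    by (simp_all add: c_def power2_eq_square mult_exp_exp algebra_simps)
  \<comment> \<open>The first summand cancels the correction in the central component of w, and the
    second scales like the rest of eta.\<close>
  have om: "heis_omega_vec (fst (qk_mult b a x)) (fst w)
      = c *\<^sub>R heis_omega_vec (fst a) (fst v) + c\<^sup>2 *\<^sub>R heis_omega_vec (fst x) (fst v)"
  proof -
    have "heis_omega_vec (fst (qk_mult b a x)) (fst w) = heis_omega_vec (fst a + c *\<^sub>R fst x) (c *\<^sub>R fst v)"
      by (rule heis_omega_vec_cong) (simp_all add: qk_mult_def heis_mult_eq w heis_dil_def c_def)
    then show ?thesis
      by (simp add: heis_omega_vec.add_left heis_omega_vec.scaleR_left heis_omega_vec.scaleR_right
          power2_eq_square scaleR_add_right)
  qed
  have s: "snd (qk_mult b a x) = snd a + snd x" by (simp add: qk_mult_def)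
  have 1: "e_tilde b r k (qk_mult b a x) w = e_tilde b r k x v" for r k
    unfolding e_tilde_def s e(1)[symmetric] by (simp add: heis_e_def w heis_dil_def)
  have 2: "eta_tilde b j (qk_mult b a x) w = eta_tilde b j x v" for j
    unfolding eta_tilde_eq s eta_vec_def om e(2)[symmetric]
    by (simp add: w heis_dil_def algebra_simps)
  have 3: "dsigma (qk_mult b a x) w = dsigma x v"
    by (simp add: dsigma_def w)
  show "tilde_coframe b i (qk_mult b a x) (frechet_derivative (qk_mult b a) (at x) v) = tilde_coframe b i x v"
    unfolding w_def[symmetric] tilde_coframe_def
    using 1 2 3 by (simp split: option.splits sum.splits prod.splits)
qed

text \<open>The coefficients are constant in this coframe, so invariance of the forms passes to the
  metric.\<close>

lemma qk_metric_tilde: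
  "qk_metric b p u v = (\<Sum>r\<in>UNIV. \<Sum>k\<in>UNIV. tilde_coframe b (Some (Inl (r, k))) p u * tilde_coframe b (Some (Inl (r, k))) p v)
     + b\<^sup>2 * (\<Sum>s\<in>UNIV. tilde_coframe b (Some (Inr s)) p u * tilde_coframe b (Some (Inr s)) p v)
     + tilde_coframe b None p u * tilde_coframe b None p v"
proof -
  have e: "exp (2 * b * snd p) = exp (b * snd p) * exp (b * snd p)"
    "exp (4 * b * snd p) = exp (2 * b * snd p) * exp (2 * b * snd p)"
    by (simp_all add: mult_exp_exp)
  have 1: "tilde_coframe b (Some (Inl (r, k))) p u * tilde_coframe b (Some (Inl (r, k))) p v
      = exp (2 * b * snd p) * (heis_e r k (fst p) (fst u) * heis_e r k (fst p) (fst v))" for r k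
    unfolding e(1) by (simp add: tilde_coframe_def e_tilde_def mult_ac)
  have 2: "tilde_coframe b (Some (Inr s)) p u * tilde_coframe b (Some (Inr s)) p v
      = exp (4 * b * snd p) * (heis_eta s (fst p) (fst u) * heis_eta s (fst p) (fst v))" for s
    unfolding e(2) by (simp add: tilde_coframe_def eta_tilde_def mult_ac)
  show ?thesis
    unfolding 1 2 qk_metric_def sum_distrib_left[symmetric] by (simp add: tilde_coframe_def)
qed

theorem mainTheorem12:
  fixes b :: real
  assumes "b \<noteq> 0"
  shows
    "DIM('n::finite heis \<times> real) = 4 * CARD('n) + 4
     \<and> complete_riemannian (qk_metric b :: ('n heis \<times> real) two_tensor)
     \<and> quaternionic_kaehler TYPE('n option) (qk_metric b :: ('n heis \<times> real) two_tensor)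
     \<and> (\<forall>(p :: 'n heis \<times> real) u v.
          ricci (qk_metric b) p u v = - 4 * (real CARD('n) + 3) * b\<^sup>2 * qk_metric b p u v)
     \<and> CARD(('n \<times> 4 + 3) option) = 4 * CARD('n) + 4
     \<and> defines_lie_algebra (tilde_coframe b :: ('n \<times> 4 + 3) option \<Rightarrow> ('n heis \<times> real) one_form)
     \<and> (\<forall>(r::'n) k (p :: 'n heis \<times> real) u v.
          ext_deriv (e_tilde b r k) p u v = - b * wedge (e_tilde b r k) dsigma p u v)
     \<and> (\<forall>s (p :: 'n heis \<times> real) u v.
          ext_deriv (eta_tilde b s) p u v
            = 2 * omega (e_tilde b) s p u v - 2 * b * wedge (eta_tilde b s) dsigma p u v)
     \<and> (\<exists>mul e iv.
          lie_group mul e iv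
          \<and> left_invariant_metric mul (qk_metric b :: ('n heis \<times> real) two_tensor)
          \<and> (\<forall>i. left_invariant_form mul (tilde_coframe b i :: ('n heis \<times> real) one_form)))"
proof (intro conjI allI)
  show "DIM('n heis \<times> real) = 4 * CARD('n) + 4"
    by simp
  show "CARD(('n \<times> 4 + 3) option) = 4 * CARD('n) + 4"
    by simp
  have "left_invariant_metric (qk_mult b) (qk_metric b :: ('n heis \<times> real) two_tensor)"
    unfolding left_invariant_metric_def
    by (simp only: qk_metric_tilde left_invariant_tilde[unfolded left_invariant_form_def, rule_format]) simp
  then show "\<exists>mul e iv.
          lie_group mul e iv
          \<and> left_invariant_metric mul (qk_metric b :: ('n heis \<times> real) two_tensor)
          \<and> (\<forall>i. left_invariant_form mul (tilde_coframe b i :: ('n heis \<times> real) one_form))"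
    using lie_group_qk left_invariant_tilde by blast
qed (rule complete_qk[OF assms] quaternionic_kaehler_qk[OF assms] ricci_qk_metric[OF assms]
    defines_lie_algebra_tilde e_tilde_structure eta_tilde_structure)+

end
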